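(* Let $\mathcal G_i=(X_i,Y_i;A_i,B_i,\lambda_i)$, $i=1,2$, be two non-local games with $|X_1\times Y_1|=|X_2\times Y_2|$ and $|A_1\times B_1|=|A_2\times B_2|$. Let $J_i\subseteq\mathcal O(\Lambda_{\mathcal G_i})$ be the $*$-ideal generated by the four families of no-signalling relations on each block, let $H_i:=\mathcal O(\Lambda_{\mathcal G_i})/J_i$ with quotient map $\pi_i:\mathcal O(\Lambda_{\mathcal G_i})\to H_i$, and let $$q:\mathcal O(\Lambda_{\mathcal G_1},\Lambda_{\mathcal G_2})\to\mathcal O_{\mathrm{NS}}:=\mathcal O(\Lambda_{\mathcal G_1},\Lambda_{\mathcal G_2})/I_{\mathrm{NS}}$$ be the quotient map. Then $\mathcal O_{\mathrm{NS}}$ is an $H_1$--$H_2$ bi-Galois extension, with coactions $\overline\delta:\mathcal O_{\mathrm{NS}}\to H_1\otimes\mathcal O_{\mathrm{NS}}$ and $\overline\gamma:\mathcal O_{\mathrm{NS}}\to\mathcal O_{\mathrm{NS}}\otimes H_2$ given by $$\overline\delta\circ q=(\pi_1\otimes q)\circ\delta,\qquad\overline\gamma\circ q=(q\otimes\pi_2)\circ\gamma,$$ where $\delta,\gamma$ are the (commuting) coactions of $\mathcal O(\Lambda_{\mathcal G_1})$, $\mathcal O(\Lambda_{\mathcal G_2})$ on $\mathcal O(\Lambda_{\mathcal G_1},\Lambda_{\mathcal G_2})$.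
   Context: Algebras are over $\mathbb C$; $\otimes$ is algebraic. A non-local game $\mathcal G=(X,Y;A,B,\lambda)$ consists of finite non-empty sets and $\lambda:X\times Y\times A\times B\to\{0,1\}$. Put $U_i=X_i\times Y_i$, $W_i=A_i\times B_i$, and let $A_{\Lambda_i}$ be the $U_i\times W_i$ matrix with entries $\lambda_i(x,y,a,b)$ (the incidence matrix of the hypergraph $\Lambda_{\mathcal G_i}$). A magic unitary over a unital $*$-algebra is a matrix $(p_{i,j})$ with $p_{i,j}=p_{i,j}^*=p_{i,j}^2$, rows and columns summing to $1$, and $p_{i,j}p_{i,j'}=0$ ($j\ne j'$), $p_{i,j}p_{i',j}=0$ ($i\neq i'$). $\mathcal O(\Lambda_{\mathcal G_1},\Lambda_{\mathcal G_2})$ is the universal unital $*$-algebra generated by the entries of magic unitaries $P_U=(p^U_{\alpha,\beta})_{\alpha\in U_1,\beta\in U_2}$, $P_W=(p^W_{\alpha,\beta})_{\alpha\in W_1,\beta\in W_2}$ with $A_{\Lambda_1}P_W=P_UA_{\Lambda_2}$. $\mathcal O(\Lambda_{\mathcal G_i}):=\mathcal O(\Lambda_{\mathcal G_i},\Lambda_{\mathcal G_i})$ is a Hopf $*$-algebra: denoting its generating magic unitaries by $u^U,u^W$ for $i=1$ and $v^U,v^W$ for $i=2$, one has $\Delta(u_{\alpha,\beta})=\sum_\gamma u_{\alpha,\gamma}\otimes u_{\gamma,\beta}$, $\varepsilon(u_{\alpha,\beta})=\delta_{\alpha,\beta}$, $S(u_{\alpha,\beta})=u_{\beta,\alpha}$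 on each block, and likewise for $v$. The coactions are the unital $*$-homomorphisms $\delta(p_{\alpha,\beta})=\sum_\gamma u_{\alpha,\gamma}\otimes p_{\gamma,\beta}$ and $\gamma(p_{\alpha,\beta})=\sum_{\eta}p_{\alpha,\eta}\otimes v_{\eta,\beta}$ (on each of the $U$- and $W$-blocks). $I_{\mathrm{NS}}$ is the $*$-ideal of $\mathcal O(\Lambda_{\mathcal G_1},\Lambda_{\mathcal G_2})$ generated by the relations (for all values of the other indices): $\sum_{x_1}p^U_{(x_1,y_1),(x_2,y_2)}$ is independent of $x_2$; $\sum_{y_1}p^U_{(x_1,y_1),(x_2,y_2)}$ is independent of $y_2$; $\sum_{a_2}p^W_{(a_1,b_1),(a_2,b_2)}$ is independent of $a_1$; $\sum_{b_2}p^W_{(a_1,b_1),(a_2,b_2)}$ is independent of $b_1$. $J_1$ is the $*$-ideal of $\mathcal O(\Lambda_{\mathcal G_1})$ generated by the relations: on the $U$-block, $\sum_{x}u^U_{(x,y),(x',y')}$ is independent of $x'$; $\sum_{x'}u^U_{(x,y),(x',y')}$ is independent of $x$; $\sum_{y}u^U_{(x,y),(x',y')}$ is independent of $y'$; $\sum_{y'}u^U_{(x,y),(x',y')}$ is independent of $y$; and on the $W$-block, $\sum_{a}u^W_{(a,b),(a',b')}$ is independent of $a'$; $\sum_{a'}u^W_{(a,b),(a',b')}$ is independent of $a$; $\sum_{b}u^W_{(a,b),(a',b')}$ is independent of $b'$; $\sum_{b'}u^W_{(a,b),(a',b')}$ is independent of $b$. $J_2\subseteq\mathcal O(\Lambda_{\mathcal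 G_2})$ is defined analogously. $H_i$ carries the quotient Hopf $*$-algebra structure: $\overline\Delta\pi_i=(\pi_i\otimes\pi_i)\Delta$, $\overline\varepsilon\pi_i=\varepsilon$, $\overline S\pi_i=\pi_iS$. Let $\mathcal A,\mathcal B$ be Hopf $*$-algebras. A unital $*$-algebra $\mathcal Z$ is an $\mathcal A$--$\mathcal B$ bi-Galois extension if it carries unital $*$-homomorphisms $\delta:\mathcal Z\to\mathcal A\otimes\mathcal Z$ with $(\mathrm{id}\otimes\delta)\delta=(\Delta\otimes\mathrm{id})\delta$, $(\varepsilon\otimes\mathrm{id})\delta=\mathrm{id}$, and $\gamma:\mathcal Z\to\mathcal Z\otimes\mathcal B$ with $(\gamma\otimes\mathrm{id})\gamma=(\mathrm{id}\otimes\Delta)\gamma$, $(\mathrm{id}\otimes\varepsilon)\gamma=\mathrm{id}$, such that $(\delta\otimes\mathrm{id})\gamma=(\mathrm{id}\otimes\gamma)\delta$ and the maps $\mathcal Z\otimes\mathcal Z\to\mathcal A\otimes\mathcal Z$, $z\otimes z'\mapsto\delta(z)(1\otimes z')$ and $\mathcal Z\otimes\mathcal Z\to\mathcal Z\otimes\mathcal B$, $z\otimes z'\mapsto(z\otimes1)\gamma(z')$ are bijections. *)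

theory Defs
  imports Complex_Main "HOL-Library.Poly_Mapping" "HOL-Algebra.Module" "HOL-Algebra.QuotRing"
begin

section \<open>Unital star-algebras over the complex numbers\<close>

record 'a star_alg = "(complex, 'a) module" +
  star :: "'a \<Rightarrow> 'a"

definition complex_alg :: "complex star_alg" where
  "complex_alg = \<lparr>carrier = UNIV, mult = (*), one = 1, zero = 0, add = (+), smult = (*), star = cnj\<rparr>"

text \<open>
  The zero algebra is a unital star-algebra: \<open>\<one> \<noteq> \<zero>\<close> is not required. HOL-Algebra's locale
  \<open>algebra\<close> is for commutative algebras only and cannot be used here.
\<close>

locale star_algebra = module complex_alg A + ring A for A (structure) +
  assumes smult_mult_left:
      "\<lbrakk>x \<in> carrier A; y \<in> carrier A\<rbrakk> \<Longrightarrow> (c \<odot>\<^bsub>A\<^esub> x) \<otimes>\<^bsub>A\<^esub> y = c \<odot>\<^bsub>A\<^esub> (x \<otimes>\<^bsub>A\<^esub> y)"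
    and smult_mult_right:
      "\<lbrakk>x \<in> carrier A; y \<in> carrier A\<rbrakk> \<Longrightarrow> x \<otimes>\<^bsub>A\<^esub> (c \<odot>\<^bsub>A\<^esub> y) = c \<odot>\<^bsub>A\<^esub> (x \<otimes>\<^bsub>A\<^esub> y)"
    and star_closed: "x \<in> carrier A \<Longrightarrow> star A x \<in> carrier A"
    and star_add:
      "\<lbrakk>x \<in> carrier A; y \<in> carrier A\<rbrakk> \<Longrightarrow> star A (x \<oplus>\<^bsub>A\<^esub> y) = star A x \<oplus>\<^bsub>A\<^esub> star A y"
    and star_smult: "x \<in> carrier A \<Longrightarrow> star A (c \<odot>\<^bsub>A\<^esub> x) = cnj c \<odot>\<^bsub>A\<^esub> star A x"
    and star_mult:
      "\<lbrakk>x \<in> carrier A; y \<in> carrier A\<rbrakk> \<Longrightarrow> star A (x \<otimes>\<^bsub>A\<^esub> y) = star A y \<otimes>\<^bsub>A\<^esub> star A x"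
    and star_star: "x \<in> carrier A \<Longrightarrow> star A (star A x) = x"

definition linear_map ::
  "('a, 'm) star_alg_scheme \<Rightarrow> ('b, 'n) star_alg_scheme \<Rightarrow> ('a \<Rightarrow> 'b) \<Rightarrow> bool" where
  "linear_map A B f \<longleftrightarrow> f \<in> carrier A \<rightarrow> carrier B \<and>
     (\<forall>x\<in>carrier A. \<forall>y\<in>carrier A. f (x \<oplus>\<^bsub>A\<^esub> y) = f x \<oplus>\<^bsub>B\<^esub> f y) \<and>
     (\<forall>c. \<forall>x\<in>carrier A. f (c \<odot>\<^bsub>A\<^esub> x) = c \<odot>\<^bsub>B\<^esub> f x)"

definition star_hom ::
  "('a, 'm) star_alg_scheme \<Rightarrow> ('b, 'n) star_alg_scheme \<Rightarrow> ('a \<Rightarrow> 'b) \<Rightarrow> bool" where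
  "star_hom A B f \<longleftrightarrow> f \<in> ring_hom A B \<and> linear_map A B f \<and>
     (\<forall>x\<in>carrier A. f (star A x) = star B (f x))"

definition opposite_alg :: "'a star_alg \<Rightarrow> 'a star_alg" where
  "opposite_alg A = A\<lparr>mult := \<lambda>x y. y \<otimes>\<^bsub>A\<^esub> x\<rparr>"


section \<open>Star-ideals and quotients\<close>

definition star_ideal :: "'a set \<Rightarrow> ('a, 'm) star_alg_scheme \<Rightarrow> bool" where
  "star_ideal I A \<longleftrightarrow> ideal I A \<and> (\<forall>x\<in>I. star A x \<in> I)"

definition gen_star_ideal :: "('a, 'm) star_alg_scheme \<Rightarrow> 'a set \<Rightarrow> 'a set" where
  "gen_star_ideal A S = \<Inter>{I. star_ideal I A \<and> S \<subseteq> I}"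

definition quot_alg :: "('a, 'm) star_alg_scheme \<Rightarrow> 'a set \<Rightarrow> 'a set star_alg" where
  "quot_alg A I =
     \<lparr>carrier = carrier (A Quot I), mult = mult (A Quot I), one = one (A Quot I),
      zero = zero (A Quot I), add = add (A Quot I),
      smult = (\<lambda>c X. \<Union>x\<in>X. I +>\<^bsub>A\<^esub> (c \<odot>\<^bsub>A\<^esub> x)),
      star = (\<lambda>X. \<Union>x\<in>X. I +>\<^bsub>A\<^esub> star A x)\<rparr>"

definition quot_map :: "('a, 'm) star_alg_scheme \<Rightarrow> 'a set \<Rightarrow> 'a \<Rightarrow> 'a set" where
  "quot_map A I x = I +>\<^bsub>A\<^esub> x"

text \<open>
  The map on a quotient induced by a map \<open>F\<close> that is constant on each coset:
  \<open>descend F (quot_map A I x) = F x\<close>.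
\<close>

definition descend :: "('a \<Rightarrow> 'b) \<Rightarrow> 'a set \<Rightarrow> 'b" where
  "descend F X = (THE y. \<forall>x\<in>X. F x = y)"


section \<open>The star-algebra of a monoid with involution\<close>

definition monoid_alg :: "('m, 'x) monoid_scheme \<Rightarrow> ('m \<Rightarrow> 'm) \<Rightarrow> ('m \<Rightarrow>\<^sub>0 complex) star_alg" where
  "monoid_alg M invol =
     \<lparr>carrier = {f. Poly_Mapping.keys f \<subseteq> carrier M},
      mult = (\<lambda>f g. \<Sum>m\<in>Poly_Mapping.keys f. \<Sum>n\<in>Poly_Mapping.keys g.
        Poly_Mapping.single (m \<otimes>\<^bsub>M\<^esub> n) (Poly_Mapping.lookup f m * Poly_Mapping.lookup g n)),
      one = Poly_Mapping.single \<one>\<^bsub>M\<^esub> 1, zero = 0, add = (+),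
      smult = (\<lambda>c. Poly_Mapping.map ((*) c)),
      star = (\<lambda>f. \<Sum>m\<in>Poly_Mapping.keys f.
        Poly_Mapping.single (invol m) (cnj (Poly_Mapping.lookup f m)))\<rparr>"

definition lin_ext :: "('v, 'n) star_alg_scheme \<Rightarrow> ('m \<Rightarrow> 'v) \<Rightarrow> ('m \<Rightarrow>\<^sub>0 complex) \<Rightarrow> 'v" where
  "lin_ext V \<phi> f = (\<Oplus>\<^bsub>V\<^esub>m\<in>Poly_Mapping.keys f. Poly_Mapping.lookup f m \<odot>\<^bsub>V\<^esub> \<phi> m)"


section \<open>Universal star-algebras given by generators and relations\<close>

text \<open>
  The free unital star-algebra on \<open>'g\<close> is the monoid algebra of words in the letters
  \<open>(g, False)\<close>, standing for the generator \<open>g\<close>, and \<open>(g, True)\<close>, standing for its adjoint.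
\<close>

type_synonym 'g word = "('g \<times> bool) list"

definition word_monoid :: "'g word monoid" where
  "word_monoid = \<lparr>carrier = UNIV, mult = (@), one = []\<rparr>"

definition free_alg :: "('g word \<Rightarrow>\<^sub>0 complex) star_alg" where
  "free_alg = monoid_alg word_monoid (\<lambda>w. rev (map (\<lambda>(g, s). (g, \<not> s)) w))"

definition free_gen :: "'g \<Rightarrow> 'g word \<Rightarrow>\<^sub>0 complex" where
  "free_gen g = Poly_Mapping.single [(g, False)] 1"

definition free_hom :: "('b, 'n) star_alg_scheme \<Rightarrow> ('g \<Rightarrow> 'b) \<Rightarrow> ('g word \<Rightarrow>\<^sub>0 complex) \<Rightarrow> 'b" where
  "free_hom B \<phi> = lin_ext B
     (\<lambda>w. foldr (\<lambda>(g, s) y. (if s then star B (\<phi> g) else \<phi> g) \<otimes>\<^bsub>B\<^esub> y) w \<one>\<^bsub>B\<^esub>)"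

definition univ_alg :: "('g word \<Rightarrow>\<^sub>0 complex) set \<Rightarrow> ('g word \<Rightarrow>\<^sub>0 complex) set star_alg" where
  "univ_alg R = quot_alg free_alg (gen_star_ideal free_alg R)"

definition univ_gen :: "('g word \<Rightarrow>\<^sub>0 complex) set \<Rightarrow> 'g \<Rightarrow> ('g word \<Rightarrow>\<^sub>0 complex) set" where
  "univ_gen R g = quot_map free_alg (gen_star_ideal free_alg R) (free_gen g)"

text \<open>
  The unital star-homomorphism from a universal star-algebra to \<open>B\<close> that sends each generator
  \<open>g\<close> to \<open>\<phi> g\<close>, when the elements \<open>\<phi> g\<close> satisfy the defining relations.
\<close>

definition univ_hom ::
  "('b, 'n) star_alg_scheme \<Rightarrow> ('g \<Rightarrow> 'b) \<Rightarrow> ('g word \<Rightarrow>\<^sub>0 complex) set \<Rightarrow> 'b" where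
  "univ_hom B \<phi> = descend (free_hom B \<phi>)"


section \<open>The algebraic tensor product\<close>

text \<open>
  \<open>A \<otimes> B\<close> is the free vector space on \<open>carrier A \<times> carrier B\<close> modulo the span of the bilinearity
  relations. The free vector space is the monoid algebra of the product of the multiplicative
  monoids of \<open>A\<close> and \<open>B\<close>, and the span is a star-ideal in it, which gives the star-algebra
  structure \<open>(a \<otimes> b)(a' \<otimes> b') = aa' \<otimes> bb'\<close>, \<open>(a \<otimes> b)* = a* \<otimes> b*\<close>.
\<close>

definition tensor_free ::
  "('a, 'm) star_alg_scheme \<Rightarrow> ('b, 'n) star_alg_scheme \<Rightarrow> ('a \<times> 'b \<Rightarrow>\<^sub>0 complex) star_alg" where
  "tensor_free A B = monoid_alg (A \<times>\<times> B) (map_prod (star A) (star B))"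

inductive_set tensor_null ::
  "('a, 'm) star_alg_scheme \<Rightarrow> ('b, 'n) star_alg_scheme \<Rightarrow> ('a \<times> 'b \<Rightarrow>\<^sub>0 complex) set"
  for A :: "('a, 'm) star_alg_scheme" and B :: "('b, 'n) star_alg_scheme" where
  zero: "0 \<in> tensor_null A B"
| add: "f \<in> tensor_null A B \<Longrightarrow> g \<in> tensor_null A B \<Longrightarrow> f + g \<in> tensor_null A B"
| scale: "f \<in> tensor_null A B \<Longrightarrow> Poly_Mapping.map ((*) c) f \<in> tensor_null A B"
| add_left: "a \<in> carrier A \<Longrightarrow> a' \<in> carrier A \<Longrightarrow> b \<in> carrier B \<Longrightarrow>
    Poly_Mapping.single (a \<oplus>\<^bsub>A\<^esub> a', b) 1 - Poly_Mapping.single (a, b) 1 - Poly_Mapping.single (a', b) 1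
      \<in> tensor_null A B"
| add_right: "a \<in> carrier A \<Longrightarrow> b \<in> carrier B \<Longrightarrow> b' \<in> carrier B \<Longrightarrow>
    Poly_Mapping.single (a, b \<oplus>\<^bsub>B\<^esub> b') 1 - Poly_Mapping.single (a, b) 1 - Poly_Mapping.single (a, b') 1
      \<in> tensor_null A B"
| scale_left: "a \<in> carrier A \<Longrightarrow> b \<in> carrier B \<Longrightarrow>
    Poly_Mapping.single (c \<odot>\<^bsub>A\<^esub> a, b) 1 - Poly_Mapping.single (a, b) c \<in> tensor_null A B"
| scale_right: "a \<in> carrier A \<Longrightarrow> b \<in> carrier B \<Longrightarrow>
    Poly_Mapping.single (a, c \<odot>\<^bsub>B\<^esub> b) 1 - Poly_Mapping.single (a, b) c \<in> tensor_null A B"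

type_synonym ('a, 'b) tensor = "('a \<times> 'b \<Rightarrow>\<^sub>0 complex) set"

definition tensor_alg ::
  "('a, 'm) star_alg_scheme \<Rightarrow> ('b, 'n) star_alg_scheme \<Rightarrow> ('a, 'b) tensor star_alg" where
  "tensor_alg A B = quot_alg (tensor_free A B) (tensor_null A B)"

definition tens ::
  "('a, 'm) star_alg_scheme \<Rightarrow> ('b, 'n) star_alg_scheme \<Rightarrow> 'a \<Rightarrow> 'b \<Rightarrow> ('a, 'b) tensor" where
  "tens A B a b = quot_map (tensor_free A B) (tensor_null A B) (Poly_Mapping.single (a, b) 1)"

text \<open>The linear map into \<open>V\<close> with \<open>a \<otimes> b \<mapsto> \<phi> a b\<close>, for bilinear \<open>\<phi>\<close>.\<close>

definition tensor_lift ::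
  "('v, 'n) star_alg_scheme \<Rightarrow> ('a \<Rightarrow> 'b \<Rightarrow> 'v) \<Rightarrow> ('a, 'b) tensor \<Rightarrow> 'v" where
  "tensor_lift V \<phi> = descend (lin_ext V (\<lambda>(a, b). \<phi> a b))"

definition tensor_map ::
  "('c, 'm) star_alg_scheme \<Rightarrow> ('d, 'n) star_alg_scheme \<Rightarrow> ('a \<Rightarrow> 'c) \<Rightarrow> ('b \<Rightarrow> 'd) \<Rightarrow>
   ('a, 'b) tensor \<Rightarrow> ('c, 'd) tensor" where
  "tensor_map C D f g = tensor_lift (tensor_alg C D) (\<lambda>a b. tens C D (f a) (g b))"

definition tensor_assoc ::
  "('a, 'm) star_alg_scheme \<Rightarrow> ('b, 'n) star_alg_scheme \<Rightarrow> ('c, 'k) star_alg_scheme \<Rightarrow>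
   (('a, 'b) tensor, 'c) tensor \<Rightarrow> ('a, ('b, 'c) tensor) tensor" where
  "tensor_assoc A B C =
     tensor_lift (tensor_alg A (tensor_alg B C))
       (\<lambda>X c. tensor_lift (tensor_alg A (tensor_alg B C))
          (\<lambda>a b. tens A (tensor_alg B C) a (tens B C b c)) X)"


section \<open>Hopf star-algebras and bi-Galois extensions\<close>

record 'a hopf_alg = "'a star_alg" +
  comult :: "'a \<Rightarrow> ('a, 'a) tensor"
  counit :: "'a \<Rightarrow> complex"
  antipode :: "'a \<Rightarrow> 'a"

text \<open>
  The canonical identifications \<open>\<complex> \<otimes> Z = Z = Z \<otimes> \<complex>\<close> are built into the maps below: \<open>\<epsilon> \<otimes> id\<close> is
  the linear map \<open>a \<otimes> z \<mapsto> \<epsilon>(a) z\<close>, and \<open>id \<otimes> \<epsilon>\<close> is \<open>z \<otimes> b \<mapsto> \<epsilon>(b) z\<close>.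
\<close>

definition counit_left ::
  "('a, 'm) hopf_alg_scheme \<Rightarrow> ('z, 'n) star_alg_scheme \<Rightarrow> ('a, 'z) tensor \<Rightarrow> 'z" where
  "counit_left A Z = tensor_lift Z (\<lambda>a z. counit A a \<odot>\<^bsub>Z\<^esub> z)"

definition counit_right ::
  "('z, 'n) star_alg_scheme \<Rightarrow> ('b, 'm) hopf_alg_scheme \<Rightarrow> ('z, 'b) tensor \<Rightarrow> 'z" where
  "counit_right Z B = tensor_lift Z (\<lambda>z b. counit B b \<odot>\<^bsub>Z\<^esub> z)"

definition left_coaction ::
  "('a, 'm) hopf_alg_scheme \<Rightarrow> ('z, 'n) star_alg_scheme \<Rightarrow> ('z \<Rightarrow> ('a, 'z) tensor) \<Rightarrow> bool" where
  "left_coaction A Z \<delta> \<longleftrightarrow> star_hom Z (tensor_alg A Z) \<delta> \<and>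
     (\<forall>z\<in>carrier Z. tensor_map A (tensor_alg A Z) id \<delta> (\<delta> z) =
        tensor_assoc A A Z (tensor_map (tensor_alg A A) Z (comult A) id (\<delta> z))) \<and>
     (\<forall>z\<in>carrier Z. counit_left A Z (\<delta> z) = z)"

definition right_coaction ::
  "('z, 'n) star_alg_scheme \<Rightarrow> ('b, 'm) hopf_alg_scheme \<Rightarrow> ('z \<Rightarrow> ('z, 'b) tensor) \<Rightarrow> bool" where
  "right_coaction Z B \<gamma> \<longleftrightarrow> star_hom Z (tensor_alg Z B) \<gamma> \<and>
     (\<forall>z\<in>carrier Z. tensor_assoc Z B B (tensor_map (tensor_alg Z B) B \<gamma> id (\<gamma> z)) =
        tensor_map Z (tensor_alg B B) id (comult B) (\<gamma> z)) \<and>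
     (\<forall>z\<in>carrier Z. counit_right Z B (\<gamma> z) = z)"

definition hopf_star_algebra :: "('a, 'm) hopf_alg_scheme \<Rightarrow> bool" where
  "hopf_star_algebra H \<longleftrightarrow> star_algebra H \<and>
     star_hom H (tensor_alg H H) (comult H) \<and>
     star_hom H complex_alg (counit H) \<and>
     (\<forall>x\<in>carrier H. tensor_assoc H H H (tensor_map (tensor_alg H H) H (comult H) id (comult H x)) =
        tensor_map H (tensor_alg H H) id (comult H) (comult H x)) \<and>
     (\<forall>x\<in>carrier H. counit_left H H (comult H x) = x) \<and>
     (\<forall>x\<in>carrier H. counit_right H H (comult H x) = x) \<and>
     linear_map H H (antipode H) \<and>
     (\<forall>x\<in>carrier H. tensor_lift H (\<lambda>a b. antipode H a \<otimes>\<^bsub>H\<^esub> b) (comult H x) =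
        counit H x \<odot>\<^bsub>H\<^esub> \<one>\<^bsub>H\<^esub>) \<and>
     (\<forall>x\<in>carrier H. tensor_lift H (\<lambda>a b. a \<otimes>\<^bsub>H\<^esub> antipode H b) (comult H x) =
        counit H x \<odot>\<^bsub>H\<^esub> \<one>\<^bsub>H\<^esub>)"

definition galois_left ::
  "('a, 'm) star_alg_scheme \<Rightarrow> ('z, 'n) star_alg_scheme \<Rightarrow> ('z \<Rightarrow> ('a, 'z) tensor) \<Rightarrow>
   ('z, 'z) tensor \<Rightarrow> ('a, 'z) tensor" where
  "galois_left A Z \<delta> = tensor_lift (tensor_alg A Z)
     (\<lambda>z z'. \<delta> z \<otimes>\<^bsub>tensor_alg A Z\<^esub> tens A Z \<one>\<^bsub>A\<^esub> z')"

definition galois_right ::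
  "('z, 'n) star_alg_scheme \<Rightarrow> ('b, 'm) star_alg_scheme \<Rightarrow> ('z \<Rightarrow> ('z, 'b) tensor) \<Rightarrow>
   ('z, 'z) tensor \<Rightarrow> ('z, 'b) tensor" where
  "galois_right Z B \<gamma> = tensor_lift (tensor_alg Z B)
     (\<lambda>z z'. tens Z B z \<one>\<^bsub>B\<^esub> \<otimes>\<^bsub>tensor_alg Z B\<^esub> \<gamma> z')"

definition bi_galois_extension ::
  "('a, 'm) hopf_alg_scheme \<Rightarrow> ('b, 'k) hopf_alg_scheme \<Rightarrow> ('z, 'n) star_alg_scheme \<Rightarrow>
   ('z \<Rightarrow> ('a, 'z) tensor) \<Rightarrow> ('z \<Rightarrow> ('z, 'b) tensor) \<Rightarrow> bool" where
  "bi_galois_extension A B Z \<delta> \<gamma> \<longleftrightarrow>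
     hopf_star_algebra A \<and> hopf_star_algebra B \<and> star_algebra Z \<and>
     left_coaction A Z \<delta> \<and> right_coaction Z B \<gamma> \<and>
     (\<forall>z\<in>carrier Z. tensor_assoc A Z B (tensor_map (tensor_alg A Z) B \<delta> id (\<gamma> z)) =
        tensor_map A (tensor_alg Z B) id \<gamma> (\<delta> z)) \<and>
     bij_betw (galois_left A Z \<delta>) (carrier (tensor_alg Z Z)) (carrier (tensor_alg A Z)) \<and>
     bij_betw (galois_right Z B \<gamma>) (carrier (tensor_alg Z Z)) (carrier (tensor_alg Z B))"

definition quot_hopf_alg :: "('a, 'm) hopf_alg_scheme \<Rightarrow> 'a set \<Rightarrow> 'a set hopf_alg" where
  "quot_hopf_alg A I = star_alg.extend (quot_alg A I) (hopf_alg.fields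
     (descend (\<lambda>x. tensor_map (quot_alg A I) (quot_alg A I) (quot_map A I) (quot_map A I) (comult A x)))
     (descend (counit A))
     (descend (\<lambda>x. quot_map A I (antipode A x))))"


section \<open>The algebras attached to non-local games\<close>

text \<open>
  The question sets \<open>X\<close>, \<open>Y\<close> and answer sets \<open>A\<close>, \<open>B\<close> are finite (automatically non-empty) types.
\<close>

type_synonym ('x, 'y, 'a, 'b) game = "'x \<Rightarrow> 'y \<Rightarrow> 'a \<Rightarrow> 'b \<Rightarrow> bool"

definition incidence :: "('x, 'y, 'a, 'b) game \<Rightarrow> 'x \<times> 'y \<Rightarrow> 'a \<times> 'b \<Rightarrow> complex" where
  "incidence lam = (\<lambda>(x, y) (a, b). of_bool (lam x y a b))"

definition magic_relators ::
  "('c, 'm) star_alg_scheme \<Rightarrow> ('i::finite \<Rightarrow> 'j::finite \<Rightarrow> 'c) \<Rightarrow> 'c set" where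
  "magic_relators A p =
     {p i j \<ominus>\<^bsub>A\<^esub> star A (p i j) | i j. True} \<union>
     {p i j \<ominus>\<^bsub>A\<^esub> p i j \<otimes>\<^bsub>A\<^esub> p i j | i j. True} \<union>
     {(\<Oplus>\<^bsub>A\<^esub>j\<in>UNIV. p i j) \<ominus>\<^bsub>A\<^esub> \<one>\<^bsub>A\<^esub> | i. True} \<union>
     {(\<Oplus>\<^bsub>A\<^esub>i\<in>UNIV. p i j) \<ominus>\<^bsub>A\<^esub> \<one>\<^bsub>A\<^esub> | j. True} \<union>
     {p i j \<otimes>\<^bsub>A\<^esub> p i j' | i j j'. j \<noteq> j'} \<union>
     {p i j \<otimes>\<^bsub>A\<^esub> p i' j | i i' j. i \<noteq> i'}"

definition intertwining_relators ::
  "('c, 'm) star_alg_scheme \<Rightarrow> ('u1 \<Rightarrow> 'w1 \<Rightarrow> complex) \<Rightarrow> ('u2 \<Rightarrow> 'w2 \<Rightarrow> complex) \<Rightarrow>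
   ('u1::finite \<Rightarrow> 'u2::finite \<Rightarrow> 'c) \<Rightarrow> ('w1::finite \<Rightarrow> 'w2::finite \<Rightarrow> 'c) \<Rightarrow> 'c set" where
  "intertwining_relators A L1 L2 pU pW =
     {(\<Oplus>\<^bsub>A\<^esub>\<omega>\<in>UNIV. L1 \<alpha> \<omega> \<odot>\<^bsub>A\<^esub> pW \<omega> \<beta>) \<ominus>\<^bsub>A\<^esub> (\<Oplus>\<^bsub>A\<^esub>\<kappa>\<in>UNIV. L2 \<kappa> \<beta> \<odot>\<^bsub>A\<^esub> pU \<alpha> \<kappa>) | \<alpha> \<beta>. True}"

datatype ('u1, 'u2, 'w1, 'w2) gen = GenU 'u1 'u2 | GenW 'w1 'w2

type_synonym ('x1, 'y1, 'a1, 'b1, 'x2, 'y2, 'a2, 'b2) game_gen =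
  "('x1 \<times> 'y1, 'x2 \<times> 'y2, 'a1 \<times> 'b1, 'a2 \<times> 'b2) gen"

definition game_relators ::
  "('x1::finite, 'y1::finite, 'a1::finite, 'b1::finite) game \<Rightarrow>
   ('x2::finite, 'y2::finite, 'a2::finite, 'b2::finite) game \<Rightarrow>
   (('x1, 'y1, 'a1, 'b1, 'x2, 'y2, 'a2, 'b2) game_gen word \<Rightarrow>\<^sub>0 complex) set" where
  "game_relators G1 G2 =
     magic_relators free_alg (\<lambda>\<alpha> \<beta>. free_gen (GenU \<alpha> \<beta>)) \<union>
     magic_relators free_alg (\<lambda>\<alpha> \<beta>. free_gen (GenW \<alpha> \<beta>)) \<union>
     intertwining_relators free_alg (incidence G1) (incidence G2)
       (\<lambda>\<alpha> \<beta>. free_gen (GenU \<alpha> \<beta>)) (\<lambda>\<alpha> \<beta>. free_gen (GenW \<alpha> \<beta>))"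

type_synonym ('x1, 'y1, 'a1, 'b1, 'x2, 'y2, 'a2, 'b2) game_elt =
  "(('x1, 'y1, 'a1, 'b1, 'x2, 'y2, 'a2, 'b2) game_gen word \<Rightarrow>\<^sub>0 complex) set"

definition game_alg ::
  "('x1::finite, 'y1::finite, 'a1::finite, 'b1::finite) game \<Rightarrow>
   ('x2::finite, 'y2::finite, 'a2::finite, 'b2::finite) game \<Rightarrow>
   ('x1, 'y1, 'a1, 'b1, 'x2, 'y2, 'a2, 'b2) game_elt star_alg" where
  "game_alg G1 G2 = univ_alg (game_relators G1 G2)"

definition genU ::
  "('x1::finite, 'y1::finite, 'a1::finite, 'b1::finite) game \<Rightarrow>
   ('x2::finite, 'y2::finite, 'a2::finite, 'b2::finite) game \<Rightarrow> 'x1 \<times> 'y1 \<Rightarrow> 'x2 \<times> 'y2 \<Rightarrow>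
   ('x1, 'y1, 'a1, 'b1, 'x2, 'y2, 'a2, 'b2) game_elt" where
  "genU G1 G2 \<alpha> \<beta> = univ_gen (game_relators G1 G2) (GenU \<alpha> \<beta>)"

definition genW ::
  "('x1::finite, 'y1::finite, 'a1::finite, 'b1::finite) game \<Rightarrow>
   ('x2::finite, 'y2::finite, 'a2::finite, 'b2::finite) game \<Rightarrow> 'a1 \<times> 'b1 \<Rightarrow> 'a2 \<times> 'b2 \<Rightarrow>
   ('x1, 'y1, 'a1, 'b1, 'x2, 'y2, 'a2, 'b2) game_elt" where
  "genW G1 G2 \<alpha> \<beta> = univ_gen (game_relators G1 G2) (GenW \<alpha> \<beta>)"

text \<open>
  The star-homomorphism \<open>\<O>(\<Lambda>\<^sub>1, \<Lambda>\<^sub>3) \<rightarrow> \<O>(\<Lambda>\<^sub>1, \<Lambda>\<^sub>2) \<otimes> \<O>(\<Lambda>\<^sub>2, \<Lambda>\<^sub>3)\<close> with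
  \<open>p\<^sub>\<alpha>\<^sub>\<beta> \<mapsto> \<Sum>\<^sub>\<gamma> p\<^sub>\<alpha>\<^sub>\<gamma> \<otimes> p\<^sub>\<gamma>\<^sub>\<beta>\<close> on both blocks. It is the comultiplication for \<open>\<Lambda>\<^sub>1 = \<Lambda>\<^sub>2 = \<Lambda>\<^sub>3\<close>,
  the left coaction for \<open>\<Lambda>\<^sub>1 = \<Lambda>\<^sub>2\<close> and the right coaction for \<open>\<Lambda>\<^sub>2 = \<Lambda>\<^sub>3\<close>.
\<close>

definition cocomposition ::
  "('x1::finite, 'y1::finite, 'a1::finite, 'b1::finite) game \<Rightarrow>
   ('x2::finite, 'y2::finite, 'a2::finite, 'b2::finite) game \<Rightarrow>
   ('x3::finite, 'y3::finite, 'a3::finite, 'b3::finite) game \<Rightarrow>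
   ('x1, 'y1, 'a1, 'b1, 'x3, 'y3, 'a3, 'b3) game_elt \<Rightarrow>
   (('x1, 'y1, 'a1, 'b1, 'x2, 'y2, 'a2, 'b2) game_elt,
    ('x2, 'y2, 'a2, 'b2, 'x3, 'y3, 'a3, 'b3) game_elt) tensor" where
  "cocomposition G1 G2 G3 =
     (let T = tensor_alg (game_alg G1 G2) (game_alg G2 G3);
          t = tens (game_alg G1 G2) (game_alg G2 G3)
      in univ_hom T (\<lambda>g. case g of
           GenU \<alpha> \<beta> \<Rightarrow> (\<Oplus>\<^bsub>T\<^esub>\<eta>\<in>UNIV. t (genU G1 G2 \<alpha> \<eta>) (genU G2 G3 \<eta> \<beta>))
         | GenW \<alpha> \<beta> \<Rightarrow> (\<Oplus>\<^bsub>T\<^esub>\<eta>\<in>UNIV. t (genW G1 G2 \<alpha> \<eta>) (genW G2 G3 \<eta> \<beta>))))"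

text \<open>
  The antipode is the anti-multiplicative star-preserving map with \<open>u\<^sub>\<alpha>\<^sub>\<beta> \<mapsto> u\<^sub>\<beta>\<^sub>\<alpha>\<close>, i.e. a
  star-homomorphism to the opposite algebra; it preserves the star because the generators and
  their images are self-adjoint.
\<close>

definition game_hopf_alg ::
  "('x::finite, 'y::finite, 'a::finite, 'b::finite) game \<Rightarrow>
   ('x, 'y, 'a, 'b, 'x, 'y, 'a, 'b) game_elt hopf_alg" where
  "game_hopf_alg G = star_alg.extend (game_alg G G) (hopf_alg.fields
     (cocomposition G G G)
     (univ_hom complex_alg (\<lambda>g. case g of
          GenU \<alpha> \<beta> \<Rightarrow> of_bool (\<alpha> = \<beta>) | GenW \<alpha> \<beta> \<Rightarrow> of_bool (\<alpha> = \<beta>)))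
     (univ_hom (opposite_alg (game_alg G G)) (\<lambda>g. case g of
          GenU \<alpha> \<beta> \<Rightarrow> genU G G \<beta> \<alpha> | GenW \<alpha> \<beta> \<Rightarrow> genW G G \<beta> \<alpha>)))"


section \<open>The no-signalling quotients\<close>

definition indep_relators :: "('c, 'm) star_alg_scheme \<Rightarrow> ('i \<Rightarrow> 'c) \<Rightarrow> 'c set" where
  "indep_relators A f = {f i \<ominus>\<^bsub>A\<^esub> f j | i j. True}"

definition ns_ideal ::
  "('x1::finite, 'y1::finite, 'a1::finite, 'b1::finite) game \<Rightarrow>
   ('x2::finite, 'y2::finite, 'a2::finite, 'b2::finite) game \<Rightarrow>
   ('x1, 'y1, 'a1, 'b1, 'x2, 'y2, 'a2, 'b2) game_elt set" where
  "ns_ideal G1 G2 =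
     (let A = game_alg G1 G2; pU = genU G1 G2; pW = genW G1 G2
      in gen_star_ideal A (
        (\<Union>y1 y2. indep_relators A (\<lambda>x2. \<Oplus>\<^bsub>A\<^esub>x1\<in>UNIV. pU (x1, y1) (x2, y2))) \<union>
        (\<Union>x1 x2. indep_relators A (\<lambda>y2. \<Oplus>\<^bsub>A\<^esub>y1\<in>UNIV. pU (x1, y1) (x2, y2))) \<union>
        (\<Union>b1 b2. indep_relators A (\<lambda>a1. \<Oplus>\<^bsub>A\<^esub>a2\<in>UNIV. pW (a1, b1) (a2, b2))) \<union>
        (\<Union>a1 a2. indep_relators A (\<lambda>b1. \<Oplus>\<^bsub>A\<^esub>b2\<in>UNIV. pW (a1, b1) (a2, b2)))))"

definition block_ns_relators ::
  "('c, 'm) star_alg_scheme \<Rightarrow> ('s::finite \<times> 't::finite \<Rightarrow> 's \<times> 't \<Rightarrow> 'c) \<Rightarrow> 'c set" where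
  "block_ns_relators A u =
     (\<Union>t t'. indep_relators A (\<lambda>s'. \<Oplus>\<^bsub>A\<^esub>s\<in>UNIV. u (s, t) (s', t'))) \<union>
     (\<Union>t t'. indep_relators A (\<lambda>s. \<Oplus>\<^bsub>A\<^esub>s'\<in>UNIV. u (s, t) (s', t'))) \<union>
     (\<Union>s s'. indep_relators A (\<lambda>t'. \<Oplus>\<^bsub>A\<^esub>t\<in>UNIV. u (s, t) (s', t'))) \<union>
     (\<Union>s s'. indep_relators A (\<lambda>t. \<Oplus>\<^bsub>A\<^esub>t'\<in>UNIV. u (s, t) (s', t')))"

definition hopf_ns_ideal ::
  "('x::finite, 'y::finite, 'a::finite, 'b::finite) game \<Rightarrow>
   ('x, 'y, 'a, 'b, 'x, 'y, 'a, 'b) game_elt set" where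
  "hopf_ns_ideal G = gen_star_ideal (game_hopf_alg G)
     (block_ns_relators (game_hopf_alg G) (genU G G) \<union>
      block_ns_relators (game_hopf_alg G) (genW G G))"

definition ns_alg ::
  "('x1::finite, 'y1::finite, 'a1::finite, 'b1::finite) game \<Rightarrow>
   ('x2::finite, 'y2::finite, 'a2::finite, 'b2::finite) game \<Rightarrow>
   ('x1, 'y1, 'a1, 'b1, 'x2, 'y2, 'a2, 'b2) game_elt set star_alg" where
  "ns_alg G1 G2 = quot_alg (game_alg G1 G2) (ns_ideal G1 G2)"

definition ns_hopf_alg ::
  "('x::finite, 'y::finite, 'a::finite, 'b::finite) game \<Rightarrow>
   ('x, 'y, 'a, 'b, 'x, 'y, 'a, 'b) game_elt set hopf_alg" where
  "ns_hopf_alg G = quot_hopf_alg (game_hopf_alg G) (hopf_ns_ideal G)"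

end

theory Submission
  imports Defs
begin

text \<open>
  For two games write \<open>Q(G, G')\<close> for the no-signalling quotient \<open>ns_alg G G'\<close>. The theorem holds
  because these algebras form a cogroupoid: there are comultiplications
  \<open>Q(G\<^sub>1, G\<^sub>3) \<rightarrow> Q(G\<^sub>1, G\<^sub>2) \<otimes> Q(G\<^sub>2, G\<^sub>3)\<close>, counits \<open>Q(G, G) \<rightarrow> \<complex>\<close> and antipodes
  \<open>Q(G\<^sub>1, G\<^sub>2) \<rightarrow> Q(G\<^sub>2, G\<^sub>1)\<close>, all given on generators by the formulas for matrix multiplication, the
  identity matrix and transposition, and \<open>H\<^sub>i\<close> is \<open>Q(G\<^sub>i, G\<^sub>i)\<close>.

  That \<open>H\<^sub>i\<close> is \<open>Q(G\<^sub>i, G\<^sub>i)\<close> is the point where the relations matter: the ideal \<open>J\<^sub>i\<close> imposes four families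
  of relations on each block, the ideal of \<open>Q(G\<^sub>i, G\<^sub>i)\<close> only two. The other two follow. If \<open>p\<close> is a
  magic unitary whose entries \<open>p((x, y), (x', y'))\<close> are indexed by pairs, let \<open>P\<close> be the sum of these
  entries over \<open>x\<close> and \<open>R\<close> their sum over \<open>y\<close>. If \<open>P\<close> does not depend on \<open>x'\<close> and \<open>R\<close> does not depend on
  \<open>y'\<close>, then orthogonality within a column gives \<open>p((x, y), (x', y')) = P R\<close>. Summing over \<open>x'\<close> leaves \<open>P\<close>
  times the sum of \<open>R\<close> over \<open>x'\<close>, which is a scalar by a counting argument. So
  the sum over \<open>x'\<close> does not depend on \<open>x\<close> (\<open>column_no_signalling_transposed\<close>), and
  the two ideals coincide (\<open>hopf_ns_ideal_eq\<close>).

  With this identification the Hopf algebra axioms, the coaction axioms and the commutation of the two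
  coactions are instances of the coassociativity \<open>ns_coassoc\<close> for four games, of the counit laws and of
  the antipode laws \<open>ns_antipode_left\<close>, \<open>ns_antipode_right\<close>. Coassociativity and the counit laws are
  identities between star-homomorphisms and are checked on generators; the antipode laws are checked on
  generators and propagate to products because the antipode reverses products.

  The inverse of \<open>z \<otimes> z' \<mapsto> \<delta>(z)(1 \<otimes> z')\<close> is \<open>a \<otimes> z' \<mapsto> a\<^sub>1 \<otimes> S(a\<^sub>2) z'\<close>, where \<open>a\<^sub>1 \<otimes> a\<^sub>2\<close> is the image of \<open>a\<close>
  under the comultiplication \<open>Q(G\<^sub>1, G\<^sub>1) \<rightarrow> Q(G\<^sub>1, G\<^sub>2) \<otimes> Q(G\<^sub>2, G\<^sub>1)\<close> through the other game. The
  computation uses only the cogroupoid identities and is carried out for arbitrary algebras in the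
  locale \<open>galois_data\<close>; the second Galois map is its mirror image.

  All this rests on universal properties: linear maps on a tensor product are determined by
  elementary tensors and exist for bilinear prescriptions, and
  star-homomorphisms on an algebra given by generators and relations are determined by the generators.
\<close>

section \<open>Star-algebras, linear maps and star-homomorphisms\<close>

lemma complex_alg_simps [simp]:
  "carrier complex_alg = UNIV" "x \<otimes>\<^bsub>complex_alg\<^esub> y = x * y" "\<one>\<^bsub>complex_alg\<^esub> = 1"
  "\<zero>\<^bsub>complex_alg\<^esub> = 0" "x \<oplus>\<^bsub>complex_alg\<^esub> y = x + y" "c \<odot>\<^bsub>complex_alg\<^esub> x = c * x"
  "star complex_alg x = cnj x"
  by (simp_all add: complex_alg_def)

lemma cring_complex_alg: "cring complex_alg"
proof (rule cringI)
  show "abelian_group complex_alg"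
    by (rule abelian_groupI) (auto intro: exI[of _ "- x" for x])
  show "comm_monoid complex_alg"
    by (rule comm_monoidI) auto
qed (simp add: algebra_simps)

text \<open>
  The additive inverse of \<open>x\<close> is required in the form \<open>(- 1) \<odot> x\<close>, which every algebra below has at hand.
\<close>

lemma star_algebraI:
  fixes A (structure)
  assumes zero: "\<zero> \<in> carrier A" and one: "\<one> \<in> carrier A"
    and add: "\<And>x y. x \<in> carrier A \<Longrightarrow> y \<in> carrier A \<Longrightarrow> x \<oplus> y \<in> carrier A"
    and mult: "\<And>x y. x \<in> carrier A \<Longrightarrow> y \<in> carrier A \<Longrightarrow> x \<otimes> y \<in> carrier A"
    and smult: "\<And>c x. x \<in> carrier A \<Longrightarrow> c \<odot> x \<in> carrier A"
    and star: "\<And>x. x \<in> carrier A \<Longrightarrow> star A x \<in> carrier A"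
    and add_assoc: "\<And>x y z. x \<in> carrier A \<Longrightarrow> y \<in> carrier A \<Longrightarrow> z \<in> carrier A \<Longrightarrow>
      (x \<oplus> y) \<oplus> z = x \<oplus> (y \<oplus> z)"
    and add_comm: "\<And>x y. x \<in> carrier A \<Longrightarrow> y \<in> carrier A \<Longrightarrow> x \<oplus> y = y \<oplus> x"
    and add_zero: "\<And>x. x \<in> carrier A \<Longrightarrow> \<zero> \<oplus> x = x"
    and add_inv: "\<And>x. x \<in> carrier A \<Longrightarrow> (- 1) \<odot> x \<oplus> x = \<zero>"
    and mult_assoc: "\<And>x y z. x \<in> carrier A \<Longrightarrow> y \<in> carrier A \<Longrightarrow> z \<in> carrier A \<Longrightarrow>
      (x \<otimes> y) \<otimes> z = x \<otimes> (y \<otimes> z)"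
    and one_l: "\<And>x. x \<in> carrier A \<Longrightarrow> \<one> \<otimes> x = x"
    and one_r: "\<And>x. x \<in> carrier A \<Longrightarrow> x \<otimes> \<one> = x"
    and distr_l: "\<And>x y z. x \<in> carrier A \<Longrightarrow> y \<in> carrier A \<Longrightarrow> z \<in> carrier A \<Longrightarrow>
      (x \<oplus> y) \<otimes> z = x \<otimes> z \<oplus> y \<otimes> z"
    and distr_r: "\<And>x y z. x \<in> carrier A \<Longrightarrow> y \<in> carrier A \<Longrightarrow> z \<in> carrier A \<Longrightarrow>
      z \<otimes> (x \<oplus> y) = z \<otimes> x \<oplus> z \<otimes> y"
    and smult_l: "\<And>c d x. x \<in> carrier A \<Longrightarrow> (c + d) \<odot> x = c \<odot> x \<oplus> d \<odot> x"
    and smult_r: "\<And>c x y. x \<in> carrier A \<Longrightarrow> y \<in> carrier A \<Longrightarrow> c \<odot> (x \<oplus> y) = c \<odot> x \<oplus> c \<odot> y"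
    and smult_assoc: "\<And>c d x. x \<in> carrier A \<Longrightarrow> (c * d) \<odot> x = c \<odot> (d \<odot> x)"
    and smult_one: "\<And>x. x \<in> carrier A \<Longrightarrow> 1 \<odot> x = x"
    and smult_mult_l: "\<And>c x y. x \<in> carrier A \<Longrightarrow> y \<in> carrier A \<Longrightarrow> (c \<odot> x) \<otimes> y = c \<odot> (x \<otimes> y)"
    and smult_mult_r: "\<And>c x y. x \<in> carrier A \<Longrightarrow> y \<in> carrier A \<Longrightarrow> x \<otimes> (c \<odot> y) = c \<odot> (x \<otimes> y)"
    and star_add: "\<And>x y. x \<in> carrier A \<Longrightarrow> y \<in> carrier A \<Longrightarrow> star A (x \<oplus> y) = star A x \<oplus> star A y"
    and star_smult: "\<And>c x. x \<in> carrier A \<Longrightarrow> star A (c \<odot> x) = cnj c \<odot> star A x"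
    and star_mult: "\<And>x y. x \<in> carrier A \<Longrightarrow> y \<in> carrier A \<Longrightarrow> star A (x \<otimes> y) = star A y \<otimes> star A x"
    and star_star: "\<And>x. x \<in> carrier A \<Longrightarrow> star A (star A x) = x"
  shows "star_algebra A"
proof -
  have ag: "abelian_group A"
    by (rule abelian_groupI) (use assms in \<open>auto intro!: bexI[of _ "(-1) \<odot> x" for x]\<close>)
  have "monoid A" by (rule monoidI) (use assms in auto)
  with ag have "ring A" by (rule ringI) (use assms in auto)
  moreover have "module complex_alg A"
    by (rule moduleI) (use assms cring_complex_alg ag in auto)
  ultimately show ?thesis
    by (intro star_algebra.intro star_algebra_axioms.intro) (use assms in auto)
qed

lemma star_algebra_complex_alg: "star_algebra complex_alg"
  by (rule star_algebraI) (auto simp: algebra_simps)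

lemma (in abelian_monoid) finsum_swap:
  assumes "finite S" "finite T" "\<And>i j. i \<in> S \<Longrightarrow> j \<in> T \<Longrightarrow> f i j \<in> carrier G"
  shows "(\<Oplus>i\<in>S. \<Oplus>j\<in>T. f i j) = (\<Oplus>j\<in>T. \<Oplus>i\<in>S. f i j)"
  using assms(1,3)
proof (induction S rule: finite_induct)
  case empty
  then show ?case by simp
next
  case (insert i S)
  then have "(\<Oplus>i\<in>insert i S. \<Oplus>j\<in>T. f i j) = (\<Oplus>j\<in>T. f i j) \<oplus> (\<Oplus>j\<in>T. \<Oplus>i\<in>S. f i j)"
    using assms(2) by (subst finsum_insert) (auto intro!: finsum_closed)
  also have "\<dots> = (\<Oplus>j\<in>T. f i j \<oplus> (\<Oplus>i\<in>S. f i j))"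
    using insert by (subst finsum_addf) (auto intro!: finsum_closed)
  also have "\<dots> = (\<Oplus>j\<in>T. \<Oplus>i\<in>insert i S. f i j)"
    using insert by (intro finsum_cong') (auto intro!: finsum_closed simp: Pi_def)
  finally show ?case .
qed

lemma (in abelian_monoid) finsum_Times:
  assumes "finite S" "finite T" "\<And>i j. i \<in> S \<Longrightarrow> j \<in> T \<Longrightarrow> f (i, j) \<in> carrier G"
  shows "(\<Oplus>p\<in>S \<times> T. f p) = (\<Oplus>i\<in>S. \<Oplus>j\<in>T. f (i, j))"
  using assms(1,3)
proof (induction S rule: finite_induct)
  case empty
  then show ?case by simp
next
  case (insert i S)
  have *: "insert i S \<times> T = Pair i ` T \<union> S \<times> T" by auto
  have "(\<Oplus>p\<in>insert i S \<times> T. f p) = (\<Oplus>p\<in>Pair i ` T. f p) \<oplus> (\<Oplus>p\<in>S \<times> T. f p)"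
    unfolding * using insert assms(2) by (intro finsum_Un_disjoint) auto
  also have "(\<Oplus>p\<in>Pair i ` T. f p) = (\<Oplus>j\<in>T. f (i, j))"
    using insert by (intro finsum_reindex) (auto simp: inj_on_def)
  finally show ?case
    using insert by (simp add: Pi_def)
qed

lemma (in abelian_monoid) finsum_UNIV_prod:
  fixes f :: "'i::finite \<times> 'j::finite \<Rightarrow> 'a"
  assumes "\<And>p. f p \<in> carrier G"
  shows "(\<Oplus>p\<in>UNIV. f p) = (\<Oplus>i\<in>UNIV. \<Oplus>j\<in>UNIV. f (i, j))"
    and "(\<Oplus>p\<in>UNIV. f p) = (\<Oplus>j\<in>UNIV. \<Oplus>i\<in>UNIV. f (i, j))"
proof -
  show *: "(\<Oplus>p\<in>UNIV. f p) = (\<Oplus>i\<in>UNIV. \<Oplus>j\<in>UNIV. f (i, j))"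
    using assms by (subst UNIV_Times_UNIV[symmetric], subst finsum_Times) auto
  show "(\<Oplus>p\<in>UNIV. f p) = (\<Oplus>j\<in>UNIV. \<Oplus>i\<in>UNIV. f (i, j))"
    unfolding * using assms by (intro finsum_swap) auto
qed

lemma (in abelian_monoid) finsum_single:
  assumes "finite S" "i \<in> S" "f i \<in> carrier G" "\<And>j. j \<in> S \<Longrightarrow> j \<noteq> i \<Longrightarrow> f j = \<zero>"
  shows "(\<Oplus>j\<in>S. f j) = f i"
proof -
  have f: "f j \<in> carrier G" if "j \<in> S" for j
    using assms that by (cases "j = i") auto
  have "(\<Oplus>j\<in>S. f j) = (\<Oplus>j\<in>S. if i = j then f j else \<zero>)"
    using assms(4) f by (intro finsum_cong') auto
  also have "\<dots> = f i"
    using assms(1,2) f by (intro finsum_singleton) auto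
  finally show ?thesis .
qed

context star_algebra
begin

lemma smult_closed' [simp, intro]: "x \<in> carrier A \<Longrightarrow> c \<odot> x \<in> carrier A"
  using smult_closed[of c x] by simp

lemma star_closed' [simp, intro]: "x \<in> carrier A \<Longrightarrow> star A x \<in> carrier A"
  by (rule star_closed)

lemma smult_rules:
  "x \<in> carrier A \<Longrightarrow> (c + d) \<odot> x = c \<odot> x \<oplus> d \<odot> x"
  "x \<in> carrier A \<Longrightarrow> y \<in> carrier A \<Longrightarrow> c \<odot> (x \<oplus> y) = c \<odot> x \<oplus> c \<odot> y"
  "x \<in> carrier A \<Longrightarrow> (c * d) \<odot> x = c \<odot> (d \<odot> x)"
  "x \<in> carrier A \<Longrightarrow> 1 \<odot> x = x"
  "x \<in> carrier A \<Longrightarrow> 0 \<odot> x = \<zero>"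
  "c \<odot> \<zero> = \<zero>"
  using smult_l_distr[of c d x] smult_r_distr[of c x y] smult_assoc1[of c d x] smult_one[of x]
    smult_l_null[of x] smult_r_null[of c] by simp_all

lemma smult_minus_one: "x \<in> carrier A \<Longrightarrow> (- 1) \<odot> x = \<ominus> x"
proof -
  assume x: "x \<in> carrier A"
  have "(- 1) \<odot> x \<oplus> x = (- 1 + 1) \<odot> x"
    using x by (subst smult_rules(1)) (simp_all add: smult_rules)
  also have "\<dots> = \<zero>" using x by (simp add: smult_rules)
  finally show ?thesis using x by (intro minus_equality[symmetric]) auto
qed

lemma finsum_smult:
  "finite S \<Longrightarrow> f \<in> S \<rightarrow> carrier A \<Longrightarrow> (\<Oplus>i\<in>S. c \<odot> f i) = c \<odot> (\<Oplus>i\<in>S. f i)"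
  using finsum_smult_ldistr[of S c f] by simp

lemma star_zero: "star A \<zero> = \<zero>"
  using star_smult[of \<zero> 0] by (simp add: smult_rules)

lemma star_one: "star A \<one> = \<one>"
proof -
  have "star A \<one> = star A \<one> \<otimes> star A (star A \<one>)"
    by (simp add: star_star)
  also have "\<dots> = star A (star A \<one> \<otimes> \<one>)"
    by (subst star_mult) auto
  also have "\<dots> = \<one>" by (simp add: star_star)
  finally show ?thesis .
qed

lemma star_finsum:
  assumes "finite S" "f \<in> S \<rightarrow> carrier A"
  shows "star A (\<Oplus>i\<in>S. f i) = (\<Oplus>i\<in>S. star A (f i))"
  using assms by (induction S rule: finite_induct) (auto simp: star_zero star_add finsum_closed Pi_def)

lemma minus_eq_zero_iff: "x \<in> carrier A \<Longrightarrow> y \<in> carrier A \<Longrightarrow> x \<ominus> y = \<zero> \<longleftrightarrow> x = y"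
  unfolding a_minus_def using minus_equality[of x "\<ominus> y"] by (auto simp: r_neg)

end

lemma linear_mapD:
  assumes "linear_map A B f"
  shows "x \<in> carrier A \<Longrightarrow> f x \<in> carrier B"
    and "x \<in> carrier A \<Longrightarrow> y \<in> carrier A \<Longrightarrow> f (x \<oplus>\<^bsub>A\<^esub> y) = f x \<oplus>\<^bsub>B\<^esub> f y"
    and "x \<in> carrier A \<Longrightarrow> f (c \<odot>\<^bsub>A\<^esub> x) = c \<odot>\<^bsub>B\<^esub> f x"
  using assms by (auto simp: linear_map_def)

lemma linear_map_zero:
  assumes "star_algebra A" "star_algebra B" "linear_map A B f"
  shows "f \<zero>\<^bsub>A\<^esub> = \<zero>\<^bsub>B\<^esub>"
proof -
  interpret A: star_algebra A by fact
  interpret B: star_algebra B by fact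
  have "f (0 \<odot>\<^bsub>A\<^esub> \<zero>\<^bsub>A\<^esub>) = 0 \<odot>\<^bsub>B\<^esub> f \<zero>\<^bsub>A\<^esub>"
    by (rule linear_mapD[OF assms(3)]) auto
  then show ?thesis
    using linear_mapD(1)[OF assms(3)] by (simp add: A.smult_rules B.smult_rules)
qed

lemma linear_map_minus:
  assumes "star_algebra A" "star_algebra B" "linear_map A B f" "x \<in> carrier A"
  shows "f (\<ominus>\<^bsub>A\<^esub> x) = \<ominus>\<^bsub>B\<^esub> f x"
  using linear_mapD(3)[OF assms(3,4), of "-1"] linear_mapD(1)[OF assms(3,4)] assms(4)
  by (simp add: star_algebra.smult_minus_one[OF assms(1)] star_algebra.smult_minus_one[OF assms(2)])

lemma linear_map_diff:
  assumes "star_algebra A" "star_algebra B" "linear_map A B f" "x \<in> carrier A" "y \<in> carrier A"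
  shows "f (x \<ominus>\<^bsub>A\<^esub> y) = f x \<ominus>\<^bsub>B\<^esub> f y"
proof -
  interpret A: star_algebra A by fact
  show ?thesis
    using assms by (simp add: a_minus_def linear_map_minus linear_mapD(2)[OF assms(3)])
qed

lemma linear_map_finsum:
  assumes "star_algebra A" "star_algebra B" "linear_map A B f" "finite S" "g \<in> S \<rightarrow> carrier A"
  shows "f (\<Oplus>\<^bsub>A\<^esub>i\<in>S. g i) = (\<Oplus>\<^bsub>B\<^esub>i\<in>S. f (g i))"
proof -
  interpret A: star_algebra A by fact
  interpret B: star_algebra B by fact
  show ?thesis
    using assms(4,5)
    by (induction S rule: finite_induct)
      (auto simp: linear_map_zero[OF assms(1-3)] linear_mapD[OF assms(3)] Pi_def)
qed

lemma linear_map_compose: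
  "linear_map A B f \<Longrightarrow> linear_map B C g \<Longrightarrow> linear_map A C (\<lambda>x. g (f x))"
  by (auto simp: linear_map_def Pi_def)

lemma linear_map_ident: "linear_map A A (\<lambda>x. x)" "linear_map A A id"
  by (auto simp: linear_map_def)

lemma star_homD:
  assumes "star_hom A B f"
  shows "linear_map A B f"
    and "x \<in> carrier A \<Longrightarrow> f x \<in> carrier B"
    and "x \<in> carrier A \<Longrightarrow> y \<in> carrier A \<Longrightarrow> f (x \<otimes>\<^bsub>A\<^esub> y) = f x \<otimes>\<^bsub>B\<^esub> f y"
    and "x \<in> carrier A \<Longrightarrow> y \<in> carrier A \<Longrightarrow> f (x \<oplus>\<^bsub>A\<^esub> y) = f x \<oplus>\<^bsub>B\<^esub> f y"
    and "x \<in> carrier A \<Longrightarrow> f (c \<odot>\<^bsub>A\<^esub> x) = c \<odot>\<^bsub>B\<^esub> f x"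
    and "f \<one>\<^bsub>A\<^esub> = \<one>\<^bsub>B\<^esub>"
    and "x \<in> carrier A \<Longrightarrow> f (star A x) = star B (f x)"
  using assms by (auto simp: star_hom_def linear_map_def ring_hom_def)

lemma star_homI:
  assumes "linear_map A B f"
    and "\<And>x y. x \<in> carrier A \<Longrightarrow> y \<in> carrier A \<Longrightarrow> f (x \<otimes>\<^bsub>A\<^esub> y) = f x \<otimes>\<^bsub>B\<^esub> f y"
    and "f \<one>\<^bsub>A\<^esub> = \<one>\<^bsub>B\<^esub>"
    and "\<And>x. x \<in> carrier A \<Longrightarrow> f (star A x) = star B (f x)"
  shows "star_hom A B f"
  using assms by (auto simp: star_hom_def linear_map_def ring_hom_def)

lemma star_hom_compose:
  "star_hom A B f \<Longrightarrow> star_hom B C g \<Longrightarrow> star_hom A C (\<lambda>x. g (f x))"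
  by (rule star_homI) (auto intro: linear_map_compose dest: star_homD simp: star_homD)

lemma star_hom_ident: "star_hom A A (\<lambda>x. x)" "star_hom A A id"
  by (auto intro!: star_homI linear_map_ident)

text \<open>
  All axioms are equations, so they pass to a surjective image. Quotients are treated in this way.
\<close>

lemma star_algebra_image:
  assumes A: "star_algebra A" and f: "star_hom A B f" and surj: "carrier B = f ` carrier A"
    and zero: "f \<zero>\<^bsub>A\<^esub> = \<zero>\<^bsub>B\<^esub>"
  shows "star_algebra B"
proof -
  interpret A: star_algebra A by fact
  note [simp] = star_homD(3-7)[OF f, symmetric] zero[symmetric]
  show ?thesis
    by (rule star_algebraI)
      (auto simp: surj A.a_ac A.smult_minus_one A.r_neg A.m_assoc A.l_distr A.r_distr
        A.smult_rules A.smult_mult_left A.smult_mult_right A.star_add A.star_smult A.star_mult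
        A.star_star)
qed

section \<open>Star-ideals and quotients\<close>

lemma star_idealI:
  assumes "star_algebra A" "I \<subseteq> carrier A" "\<zero>\<^bsub>A\<^esub> \<in> I"
    and "\<And>x y. x \<in> I \<Longrightarrow> y \<in> I \<Longrightarrow> x \<oplus>\<^bsub>A\<^esub> y \<in> I"
    and l: "\<And>x y. x \<in> I \<Longrightarrow> y \<in> carrier A \<Longrightarrow> y \<otimes>\<^bsub>A\<^esub> x \<in> I"
    and "\<And>x y. x \<in> I \<Longrightarrow> y \<in> carrier A \<Longrightarrow> x \<otimes>\<^bsub>A\<^esub> y \<in> I"
    and "\<And>x. x \<in> I \<Longrightarrow> star A x \<in> I"
  shows "star_ideal I A"
proof -
  interpret A: star_algebra A by fact
  have inv: "\<ominus>\<^bsub>A\<^esub> x \<in> I" if "x \<in> I" for x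
    using l[OF that, of "\<ominus>\<^bsub>A\<^esub> \<one>\<^bsub>A\<^esub>"] that assms(2) by (simp add: A.l_minus subset_iff)
  have "ideal I A"
  proof (rule idealI)
    show "subgroup I (add_monoid A)"
      using assms inv by (intro A.add.subgroupI) auto
  qed (use assms A.ring_axioms in auto)
  then show ?thesis using assms by (simp add: star_ideal_def)
qed

lemma star_ideal_kernel:
  assumes "star_algebra A" "star_algebra B" "star_hom A B f"
  shows "star_ideal {x \<in> carrier A. f x = \<zero>\<^bsub>B\<^esub>} A"
proof -
  interpret A: star_algebra A by fact
  interpret B: star_algebra B by fact
  show ?thesis
    by (rule star_idealI)
      (auto simp: assms linear_map_zero[OF assms(1,2) star_homD(1)] star_homD[OF assms(3)] B.star_zero)
qed

lemma star_ideal_carrier: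
  assumes "star_algebra A"
  shows "star_ideal (carrier A) A"
proof -
  interpret A: star_algebra A by fact
  show ?thesis by (rule star_idealI) (auto simp: assms)
qed

lemma gen_star_ideal_least: "star_ideal I A \<Longrightarrow> S \<subseteq> I \<Longrightarrow> gen_star_ideal A S \<subseteq> I"
  by (auto simp: gen_star_ideal_def)

lemma gen_star_ideal_superset: "S \<subseteq> gen_star_ideal A S"
  by (auto simp: gen_star_ideal_def)

lemma star_ideal_subset: "star_ideal I A \<Longrightarrow> I \<subseteq> carrier A"
  using additive_subgroup.a_subset ideal.axioms(1) by (auto simp: star_ideal_def)

lemma star_ideal_gen:
  assumes "star_algebra A" "S \<subseteq> carrier A"
  shows "star_ideal (gen_star_ideal A S) A"
proof -
  interpret A: star_algebra A by fact
  have sub: "gen_star_ideal A S \<subseteq> carrier A"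
    by (rule gen_star_ideal_least[OF star_ideal_carrier]) fact+
  have I: "star_ideal I A \<Longrightarrow> ideal I A" "star_ideal I A \<Longrightarrow> x \<in> I \<Longrightarrow> star A x \<in> I" for I x
    by (auto simp: star_ideal_def)
  show ?thesis
    by (rule star_idealI[OF assms(1) sub])
      (auto simp: gen_star_ideal_def additive_subgroup.zero_closed additive_subgroup.a_closed
        ideal.axioms(1) ideal.I_l_closed ideal.I_r_closed I)
qed

text \<open>
  The kernel is a star-ideal, hence contains the star-ideal generated by any part of it.
\<close>

lemma gen_star_ideal_kernel:
  assumes "star_algebra A" "star_algebra B" "star_hom A B f" "S \<subseteq> carrier A" "f ` S \<subseteq> {\<zero>\<^bsub>B\<^esub>}"
    and "x \<in> gen_star_ideal A S"
  shows "f x = \<zero>\<^bsub>B\<^esub>"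
  using gen_star_ideal_least[OF star_ideal_kernel[OF assms(1-3)], of S] assms(4-6) by blast

locale star_algebra_ideal = star_algebra A for A (structure) and I +
  assumes star_ideal: "star_ideal I A"
begin

sublocale ideal I A
  using star_ideal by (simp add: star_ideal_def)

abbreviation Q where "Q \<equiv> quot_alg A I"
abbreviation \<pi> where "\<pi> \<equiv> quot_map A I"

text \<open>
  Ring ideals of a unital algebra are linear subspaces, because \<open>c \<odot> x = (c \<odot> \<one>) \<otimes> x\<close>.
\<close>

lemma smult_mem: "x \<in> I \<Longrightarrow> c \<odot> x \<in> I"
  using I_l_closed[of x "c \<odot> \<one>"] by (auto simp: smult_mult_left)

lemma quot_map_self: "x \<in> carrier A \<Longrightarrow> x \<in> \<pi> x"
  by (simp add: quot_map_def a_rcos_self)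

lemma mem_quot_map: "x \<in> carrier A \<Longrightarrow> y \<in> \<pi> x \<Longrightarrow> \<exists>i\<in>I. y = i \<oplus> x"
  by (auto simp: quot_map_def a_r_coset_def')

lemma quot_map_eqI: "x \<in> carrier A \<Longrightarrow> i \<in> I \<Longrightarrow> \<pi> (i \<oplus> x) = \<pi> x"
  unfolding quot_map_def
  by (rule a_repr_independence'[symmetric]) (auto simp: a_r_coset_def')

text \<open>
  The scalar multiplication and the star of a quotient are unions over all representatives of a
  coset; such a union collapses when the representatives agree.
\<close>

lemma quot_map_UN:
  assumes "x \<in> carrier A" "\<And>y. y \<in> \<pi> x \<Longrightarrow> F y = F x"
  shows "(\<Union>y\<in>\<pi> x. F y) = F x"
proof
  show "(\<Union>y\<in>\<pi> x. F y) \<subseteq> F x" using assms(2) by blast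
  show "F x \<subseteq> (\<Union>y\<in>\<pi> x. F y)" using quot_map_self[OF assms(1)] by blast
qed

lemma quot_carrier: "carrier Q = \<pi> ` carrier A"
  by (auto simp: quot_alg_def FactRing_def A_RCOSETS_def' quot_map_def)

lemma quot_map_star_hom: "star_hom A Q \<pi>"
proof (rule star_homI)
  have sm: "(\<Union>y\<in>\<pi> x. I +> (c \<odot> y)) = I +> (c \<odot> x)" if x: "x \<in> carrier A" for c x
  proof (rule quot_map_UN[OF x])
    fix y assume "y \<in> \<pi> x"
    then obtain i where "i \<in> I" "y = i \<oplus> x" using mem_quot_map[OF x] by blast
    then show "I +> (c \<odot> y) = I +> (c \<odot> x)"
      using x quot_map_eqI[of "c \<odot> x" "c \<odot> i"] a_subset
      by (auto simp: smult_rules smult_mem quot_map_def)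
  qed
  show "linear_map A Q \<pi>"
    using sm by (auto simp: linear_map_def quot_alg_def quot_map_def FactRing_def a_rcos_sum
        A_RCOSETS_def')
  show "\<pi> (star A x) = star Q (\<pi> x)" if x: "x \<in> carrier A" for x
  proof -
    have "(\<Union>y\<in>\<pi> x. I +> star A y) = I +> star A x"
    proof (rule quot_map_UN[OF x])
      fix y assume "y \<in> \<pi> x"
      then obtain i where "i \<in> I" "y = i \<oplus> x" using mem_quot_map[OF x] by blast
      then show "I +> star A y = I +> star A x"
        using x quot_map_eqI[of "star A x" "star A i"] a_subset star_ideal
        by (auto simp: star_add quot_map_def star_ideal_def)
    qed
    then show ?thesis by (simp add: quot_alg_def quot_map_def)
  qed
qed (auto simp: quot_alg_def quot_map_def FactRing_def rcoset_mult_add)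

lemma quot_zero: "\<zero>\<^bsub>Q\<^esub> = I"
  by (simp add: quot_alg_def FactRing_def)

lemma quot_map_zero_iff: "x \<in> carrier A \<Longrightarrow> \<pi> x = \<zero>\<^bsub>Q\<^esub> \<longleftrightarrow> x \<in> I"
  unfolding quot_zero quot_map_def
  using a_rcos_self a_rcos_const by blast

lemma star_algebra_quot: "star_algebra Q"
proof (rule star_algebra_image[OF star_algebra_axioms quot_map_star_hom quot_carrier])
  show "\<pi> \<zero> = \<zero>\<^bsub>Q\<^esub>" by (simp add: quot_map_zero_iff)
qed

context
  fixes V F
  assumes V: "star_algebra V" and F: "linear_map A V F" and F_zero: "\<And>x. x \<in> I \<Longrightarrow> F x = \<zero>\<^bsub>V\<^esub>"
begin

text \<open>
  A linear map that vanishes on the ideal is constant on each coset, so the description in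
  \<open>descend\<close> denotes its value.
\<close>

lemma descend_quot_map:
  assumes x: "x \<in> carrier A"
  shows "descend F (\<pi> x) = F x"
proof -
  interpret V: star_algebra V by (rule V)
  have "F y = F x" if "y \<in> \<pi> x" for y
    using mem_quot_map[OF x that] x linear_mapD[OF F] F_zero a_subset by auto
  then show ?thesis
    unfolding descend_def using quot_map_self[OF x] by - (rule the_equality, blast, metis)
qed

lemma descend_linear_map: "linear_map Q V (descend F)"
  using linear_mapD[OF F] star_homD(4,5)[OF quot_map_star_hom, symmetric]
  by (auto simp: linear_map_def quot_carrier descend_quot_map)

lemma descend_star_hom:
  assumes "star_hom A V F"
  shows "star_hom Q V (descend F)"
  using star_homD[OF assms] star_homD(3-7)[OF quot_map_star_hom, symmetric]
  by (intro star_homI descend_linear_map) (auto simp: quot_carrier descend_quot_map)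

end

end

lemma star_algebra_ideal_gen:
  "star_algebra A \<Longrightarrow> S \<subseteq> carrier A \<Longrightarrow> star_algebra_ideal A (gen_star_ideal A S)"
  by (simp add: star_algebra_ideal.intro star_algebra_ideal_axioms.intro star_ideal_gen)

section \<open>The star-algebra of a monoid with involution\<close>

abbreviation (input) "keys \<equiv> Poly_Mapping.keys"
abbreviation (input) "lookup \<equiv> Poly_Mapping.lookup"
abbreviation (input) "single \<equiv> Poly_Mapping.single"

lemma lookup_scale: "lookup (Poly_Mapping.map ((*) c) f) k = c * lookup f k"
  for c :: complex
  by (simp add: Poly_Mapping.map.rep_eq when_def)

lemma scale_diff: "Poly_Mapping.map ((*) c) (f - g) = Poly_Mapping.map ((*) c) f - Poly_Mapping.map ((*) c) g"
  for c :: complex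
  by (rule poly_mapping_eqI) (simp add: lookup_scale lookup_minus right_diff_distrib)

lemma keys_scale: "keys (Poly_Mapping.map ((*) c) f) \<subseteq> keys f"
  for c :: complex
  by (auto simp: in_keys_iff lookup_scale)

lemma poly_mapping_sum_singles:
  fixes f :: "'m \<Rightarrow>\<^sub>0 complex"
  shows "(\<Sum>m\<in>keys f. single m (lookup f m)) = f"
proof (rule poly_mapping_eqI)
  fix k
  have "lookup (\<Sum>m\<in>keys f. single m (lookup f m)) k
    = (\<Sum>m\<in>keys f. if k = m then lookup f m else 0)"
    by (auto simp: lookup_sum lookup_single when_def intro!: sum.cong)
  also have "\<dots> = lookup f k"
    by (simp add: in_keys_iff)
  finally show "lookup (\<Sum>m\<in>keys f. single m (lookup f m)) k
    = lookup f k" .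
qed

text \<open>
  Monomials span the monoid algebra. Multilinear identities are reduced to monomials by this rule.
\<close>

lemma poly_mapping_span_induct [consumes 1, case_names zero single add]:
  fixes f :: "'m \<Rightarrow>\<^sub>0 complex"
  assumes "keys f \<subseteq> S" "P 0"
    and single: "\<And>m c. m \<in> S \<Longrightarrow> P (single m c)"
    and add: "\<And>f g. keys f \<subseteq> S \<Longrightarrow> keys g \<subseteq> S \<Longrightarrow> P f \<Longrightarrow> P g \<Longrightarrow> P (f + g)"
  shows "P f"
proof -
  let ?F = "\<lambda>T. \<Sum>m\<in>T. single m (lookup f m)"
  have "P (?F T) \<and> keys (?F T) \<subseteq> S" if "T \<subseteq> S" "finite T" for T
    using that(2,1)
  proof (induction T rule: finite_induct)
    case (insert m T)
    have "keys (single m (lookup f m)) \<subseteq> S"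
      using insert by auto
    then show ?case
      using insert keys_add[of "single m (lookup f m)" "?F T"]
      by (auto intro!: add single)
  qed (simp add: assms)
  from this[of "keys f"] show ?thesis
    using assms(1) by (simp add: poly_mapping_sum_singles)
qed

locale monoid_with_involution = monoid M for M (structure) +
  fixes invol :: "'a \<Rightarrow> 'a"
  assumes invol_closed: "m \<in> carrier M \<Longrightarrow> invol m \<in> carrier M"
    and invol_invol: "m \<in> carrier M \<Longrightarrow> invol (invol m) = m"
    and invol_mult: "m \<in> carrier M \<Longrightarrow> n \<in> carrier M \<Longrightarrow> invol (m \<otimes> n) = invol n \<otimes> invol m"
begin

abbreviation A where "A \<equiv> monoid_alg M invol"

lemma alg_simps:
  "x \<in> carrier A \<longleftrightarrow> keys x \<subseteq> carrier M"
  "x \<oplus>\<^bsub>A\<^esub> y = x + y" "\<zero>\<^bsub>A\<^esub> = 0" "\<one>\<^bsub>A\<^esub> = single \<one> 1"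
  "c \<odot>\<^bsub>A\<^esub> x = Poly_Mapping.map ((*) c) x"
  by (simp_all add: monoid_alg_def)

text \<open>
  With summation sets that do not depend on the supports, additivity in each factor becomes visible.
\<close>

lemma mult_eq:
  assumes "finite S" "keys f \<subseteq> S" "finite T" "keys g \<subseteq> T"
  shows "f \<otimes>\<^bsub>A\<^esub> g = (\<Sum>m\<in>S. \<Sum>n\<in>T.
    single (m \<otimes> n) (lookup f m * lookup g n))"
proof -
  have "f \<otimes>\<^bsub>A\<^esub> g = (\<Sum>m\<in>keys f. \<Sum>n\<in>T.
    single (m \<otimes> n) (lookup f m * lookup g n))"
    unfolding monoid_alg_def using assms
    by (simp, intro sum.cong[OF refl] sum.mono_neutral_left) (auto simp: in_keys_iff)
  also have "\<dots> = (\<Sum>m\<in>S. \<Sum>n\<in>T.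
    single (m \<otimes> n) (lookup f m * lookup g n))"
    using assms by (intro sum.mono_neutral_left) (auto simp: in_keys_iff)
  finally show ?thesis .
qed

lemma star_eq:
  assumes "finite S" "keys f \<subseteq> S"
  shows "star A f = (\<Sum>m\<in>S. single (invol m) (cnj (lookup f m)))"
  unfolding monoid_alg_def using assms
  by (auto intro!: sum.mono_neutral_left simp: in_keys_iff)

lemma mult_single: "single m c \<otimes>\<^bsub>A\<^esub> single n d = single (m \<otimes> n) (c * d)"
  by (subst mult_eq[of "{m}" _ "{n}"]) auto

lemma star_single: "star A (single m c) = single (invol m) (cnj c)"
  by (subst star_eq[of "{m}"]) auto

lemma mult_add:
  "(f + f') \<otimes>\<^bsub>A\<^esub> g = f \<otimes>\<^bsub>A\<^esub> g + f' \<otimes>\<^bsub>A\<^esub> g"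
  "g \<otimes>\<^bsub>A\<^esub> (f + f') = g \<otimes>\<^bsub>A\<^esub> f + g \<otimes>\<^bsub>A\<^esub> f'"
proof -
  let ?S = "keys f \<union> keys f'" and ?T = "keys g"
  note * = mult_eq[of ?S _ ?T] mult_eq[of ?T _ ?S]
  show "(f + f') \<otimes>\<^bsub>A\<^esub> g = f \<otimes>\<^bsub>A\<^esub> g + f' \<otimes>\<^bsub>A\<^esub> g"
    "g \<otimes>\<^bsub>A\<^esub> (f + f') = g \<otimes>\<^bsub>A\<^esub> f + g \<otimes>\<^bsub>A\<^esub> f'"
    using keys_add[of f f']
    by (simp_all add: * lookup_add single_add distrib_left distrib_right sum.distrib)
qed

lemma mult_zero: "0 \<otimes>\<^bsub>A\<^esub> g = 0" "g \<otimes>\<^bsub>A\<^esub> 0 = 0"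
  by (simp_all add: monoid_alg_def)

lemma star_add: "star A (f + f') = star A f + star A f'"
  using keys_add[of f f']
  by (simp add: star_eq[of "keys f \<union> keys f'"] lookup_add single_add sum.distrib)

lemma star_zero: "star A 0 = 0"
  by (simp add: monoid_alg_def)

lemma scale_simps:
  "Poly_Mapping.map ((*) c) (f + g) = Poly_Mapping.map ((*) c) f + Poly_Mapping.map ((*) c) g"
  "Poly_Mapping.map ((*) c) (single m d) = single m (c * d)"
  "Poly_Mapping.map ((*) c) (0 :: 'a \<Rightarrow>\<^sub>0 complex) = 0"
  for f g :: "'a \<Rightarrow>\<^sub>0 complex"
  by (auto intro!: poly_mapping_eqI simp: lookup_scale lookup_add lookup_single when_def distrib_left)

lemma closed:
  assumes "keys f \<subseteq> carrier M" "keys g \<subseteq> carrier M"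
  shows "keys (f + g) \<subseteq> carrier M" "keys (f \<otimes>\<^bsub>A\<^esub> g) \<subseteq> carrier M"
    "keys (star A f) \<subseteq> carrier M" "keys (Poly_Mapping.map ((*) c) f) \<subseteq> carrier M"
proof -
  have add: "keys (f + g) \<subseteq> carrier M"
    if "keys f \<subseteq> carrier M" "keys g \<subseteq> carrier M" for f g :: "'a \<Rightarrow>\<^sub>0 complex"
    using keys_add[of f g] that by auto
  then show "keys (f + g) \<subseteq> carrier M" using assms by auto
  show "keys (Poly_Mapping.map ((*) c) f) \<subseteq> carrier M"
    using keys_scale[of c f] assms by auto
  show "keys (star A f) \<subseteq> carrier M" using assms(1)
    by (induction f rule: poly_mapping_span_induct)
      (simp_all add: star_zero star_single star_add invol_closed add)
  show "keys (f \<otimes>\<^bsub>A\<^esub> g) \<subseteq> carrier M" using assms(1)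
  proof (induction f rule: poly_mapping_span_induct)
    case (single m c)
    show ?case using assms(2)
      by (induction g rule: poly_mapping_span_induct)
        (use single in \<open>simp_all add: mult_zero mult_single mult_add add\<close>)
  qed (simp_all add: mult_zero mult_add add)
qed

lemma star_algebra: "star_algebra A"
proof (rule star_algebraI; unfold alg_simps)
  fix x y z :: "'a \<Rightarrow>\<^sub>0 complex"
  assume x: "keys x \<subseteq> carrier M" and y: "keys y \<subseteq> carrier M"
    and z: "keys z \<subseteq> carrier M"
  show "x \<otimes>\<^bsub>A\<^esub> y \<otimes>\<^bsub>A\<^esub> z = x \<otimes>\<^bsub>A\<^esub> (y \<otimes>\<^bsub>A\<^esub> z)" using x
  proof (induction x rule: poly_mapping_span_induct)
    case (single m c)
    show ?case using y
    proof (induction y rule: poly_mapping_span_induct)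
      case (single n d)
      show ?case using z
        by (induction z rule: poly_mapping_span_induct)
          (use \<open>m \<in> carrier M\<close> single in \<open>auto simp: mult_zero mult_single mult_add m_assoc mult.assoc\<close>)
    qed (auto simp: mult_zero mult_add)
  qed (auto simp: mult_zero mult_add)
next
  fix c and x y :: "'a \<Rightarrow>\<^sub>0 complex"
  assume x: "keys x \<subseteq> carrier M" and y: "keys y \<subseteq> carrier M"
  show "Poly_Mapping.map ((*) c) x \<otimes>\<^bsub>A\<^esub> y = Poly_Mapping.map ((*) c) (x \<otimes>\<^bsub>A\<^esub> y)" using x
  proof (induction x rule: poly_mapping_span_induct)
    case (single m d)
    show ?case using y
      by (induction y rule: poly_mapping_span_induct)
        (auto simp: mult_zero mult_single mult_add scale_simps mult.assoc mult.left_commute)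
  qed (auto simp: mult_zero mult_add scale_simps)
  show "x \<otimes>\<^bsub>A\<^esub> Poly_Mapping.map ((*) c) y = Poly_Mapping.map ((*) c) (x \<otimes>\<^bsub>A\<^esub> y)" using x
  proof (induction x rule: poly_mapping_span_induct)
    case (single m d)
    show ?case using y
      by (induction y rule: poly_mapping_span_induct)
        (auto simp: mult_zero mult_single mult_add scale_simps mult.assoc mult.left_commute)
  qed (auto simp: mult_zero mult_add scale_simps)
  show "star A (x \<otimes>\<^bsub>A\<^esub> y) = star A y \<otimes>\<^bsub>A\<^esub> star A x" using x
  proof (induction x rule: poly_mapping_span_induct)
    case (single m d)
    show ?case using y
      by (induction y rule: poly_mapping_span_induct)
        (use single in \<open>auto simp: mult_zero mult_single mult_add star_zero star_single star_add invol_mult mult.commute\<close>)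
  qed (auto simp: mult_zero mult_add star_zero star_add)
next
  fix c and x :: "'a \<Rightarrow>\<^sub>0 complex"
  assume x: "keys x \<subseteq> carrier M"
  show "star A (star A x) = x" "single \<one> 1 \<otimes>\<^bsub>A\<^esub> x = x" "x \<otimes>\<^bsub>A\<^esub> single \<one> 1 = x"
    "star A (Poly_Mapping.map ((*) c) x) = Poly_Mapping.map ((*) (cnj c)) (star A x)"
    using x by (induction x rule: poly_mapping_span_induct)
      (auto simp: star_zero star_single star_add mult_zero mult_single mult_add invol_invol scale_simps)
qed (auto simp: closed simp del: Un_subset_iff
    intro!: poly_mapping_eqI simp: mult_add star_add lookup_add lookup_scale algebra_simps)

context
  fixes V \<phi>
  assumes V: "star_algebra V" and \<phi>: "\<phi> \<in> carrier M \<rightarrow> carrier V"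
begin

interpretation V: star_algebra V by (rule V)

lemma lin_ext_eq:
  assumes "finite S" "keys f \<subseteq> S" "S \<subseteq> carrier M"
  shows "lin_ext V \<phi> f = (\<Oplus>\<^bsub>V\<^esub>m\<in>S. lookup f m \<odot>\<^bsub>V\<^esub> \<phi> m)"
  unfolding lin_ext_def using assms \<phi>
  by (intro V.add.finprod_mono_neutral_cong_left) (auto simp: in_keys_iff V.smult_rules Pi_def)

lemma lin_ext_single: "m \<in> carrier M \<Longrightarrow> lin_ext V \<phi> (single m c) = c \<odot>\<^bsub>V\<^esub> \<phi> m"
  using \<phi> by (subst lin_ext_eq[of "{m}"]) (auto simp: Pi_def)

lemma lin_ext_linear_map: "linear_map A V (lin_ext V \<phi>)"
  unfolding linear_map_def alg_simps
proof (intro conjI ballI allI funcsetI; unfold alg_simps)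
  fix x y :: "'a \<Rightarrow>\<^sub>0 complex" and c
  assume x: "keys x \<subseteq> carrier M"
  show "lin_ext V \<phi> x \<in> carrier V"
    unfolding lin_ext_def using x \<phi> by (intro V.finsum_closed) (auto simp: Pi_def)
  show "lin_ext V \<phi> (Poly_Mapping.map ((*) c) x) = c \<odot>\<^bsub>V\<^esub> lin_ext V \<phi> x"
  proof -
    have \<phi>': "\<phi> m \<in> carrier V" if "m \<in> keys x" for m using that x \<phi> by auto
    have "(\<Oplus>\<^bsub>V\<^esub>m\<in>keys x. (c * lookup x m) \<odot>\<^bsub>V\<^esub> \<phi> m)
      = (\<Oplus>\<^bsub>V\<^esub>m\<in>keys x. c \<odot>\<^bsub>V\<^esub> (lookup x m \<odot>\<^bsub>V\<^esub> \<phi> m))"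
      using \<phi>' by (intro V.finsum_cong') (auto simp: V.smult_rules)
    also have "\<dots> = c \<odot>\<^bsub>V\<^esub> (\<Oplus>\<^bsub>V\<^esub>m\<in>keys x. lookup x m \<odot>\<^bsub>V\<^esub> \<phi> m)"
      using \<phi>' by (intro V.finsum_smult) auto
    finally show ?thesis
      using x keys_scale[of c x] by (simp add: lin_ext_eq[of "keys x"] lookup_scale)
  qed
  assume y: "keys y \<subseteq> carrier M"
  show "lin_ext V \<phi> (x + y) = lin_ext V \<phi> x \<oplus>\<^bsub>V\<^esub> lin_ext V \<phi> y"
  proof -
    let ?S = "keys x \<union> keys y"
    have \<phi>': "\<phi> m \<in> carrier V" if "m \<in> ?S" for m using that x y \<phi> by auto
    have "(\<Oplus>\<^bsub>V\<^esub>m\<in>?S. (lookup x m + lookup y m) \<odot>\<^bsub>V\<^esub> \<phi> m)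
      = (\<Oplus>\<^bsub>V\<^esub>m\<in>?S. lookup x m \<odot>\<^bsub>V\<^esub> \<phi> m \<oplus>\<^bsub>V\<^esub> lookup y m \<odot>\<^bsub>V\<^esub> \<phi> m)"
      using \<phi>' by (intro V.finsum_cong') (auto simp: V.smult_rules)
    also have "\<dots> = (\<Oplus>\<^bsub>V\<^esub>m\<in>?S. lookup x m \<odot>\<^bsub>V\<^esub> \<phi> m) \<oplus>\<^bsub>V\<^esub>
        (\<Oplus>\<^bsub>V\<^esub>m\<in>?S. lookup y m \<odot>\<^bsub>V\<^esub> \<phi> m)"
      using \<phi>' by (intro V.finsum_addf) auto
    finally show ?thesis
      using x y keys_add[of x y] by (simp add: lin_ext_eq[of ?S] lookup_add)
  qed
qed

text \<open>
  The universal property of the monoid algebra: on monomials the three conditions are the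
  hypotheses, and both sides of each are multilinear.
\<close>

lemma lin_ext_star_hom:
  assumes mult: "\<And>m n. m \<in> carrier M \<Longrightarrow> n \<in> carrier M \<Longrightarrow> \<phi> (m \<otimes> n) = \<phi> m \<otimes>\<^bsub>V\<^esub> \<phi> n"
    and one: "\<phi> \<one> = \<one>\<^bsub>V\<^esub>"
    and invol: "\<And>m. m \<in> carrier M \<Longrightarrow> \<phi> (invol m) = star V (\<phi> m)"
  shows "star_hom A V (lin_ext V \<phi>)"
proof (rule star_homI[OF lin_ext_linear_map]; unfold alg_simps)
  note [simp] = linear_mapD(1,2)[OF lin_ext_linear_map, unfolded alg_simps] lin_ext_single
  have \<phi>' [simp]: "m \<in> carrier M \<Longrightarrow> \<phi> m \<in> carrier V" for m using \<phi> by auto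
  have zero [simp]: "lin_ext V \<phi> 0 = \<zero>\<^bsub>V\<^esub>" by (simp add: lin_ext_def)
  fix x y :: "'a \<Rightarrow>\<^sub>0 complex"
  assume x: "keys x \<subseteq> carrier M"
  show "lin_ext V \<phi> (star A x) = star V (lin_ext V \<phi> x)" using x
    by (induction x rule: poly_mapping_span_induct)
      (auto simp: star_zero V.star_zero star_single star_add V.star_add closed invol_closed invol V.star_smult)
  assume y: "keys y \<subseteq> carrier M"
  show "lin_ext V \<phi> (x \<otimes>\<^bsub>A\<^esub> y) = lin_ext V \<phi> x \<otimes>\<^bsub>V\<^esub> lin_ext V \<phi> y" using x
  proof (induction x rule: poly_mapping_span_induct)
    case (single m d)
    show ?case using y
    proof (induction y rule: poly_mapping_span_induct)
      case (add f g)
      then show ?case using single by (simp add: mult_add closed V.r_distr)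
    next
      case (single n e)
      then show ?case using \<open>m \<in> carrier M\<close>
        by (simp add: mult_single mult V.smult_mult_left V.smult_mult_right V.smult_rules(3)[symmetric] mult.commute[of d e])
    qed (use single in \<open>simp add: mult_zero V.smult_rules\<close>)
  next
    case (add f g)
    then show ?case using y by (simp add: mult_add closed V.l_distr)
  qed (use y in \<open>auto simp: mult_zero\<close>)
qed (use \<phi> in \<open>auto simp: lin_ext_single one V.smult_rules\<close>)

end

end

section \<open>Universal star-algebras\<close>

lemma word_monoid: "monoid_with_involution word_monoid (\<lambda>w. rev (map (\<lambda>(g, s). (g, \<not> s)) w))"
  by unfold_locales (auto simp: word_monoid_def rev_map o_def case_prod_unfold)

interpretation word: monoid_with_involution word_monoid "\<lambda>w. rev (map (\<lambda>(g, s). (g, \<not> s)) w)"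
  by (rule word_monoid)

lemma star_algebra_free_alg: "star_algebra free_alg"
  unfolding free_alg_def by (rule word.star_algebra)

lemma carrier_free_alg [simp]: "carrier free_alg = UNIV"
  by (auto simp: free_alg_def word.alg_simps(1)) (simp add: word_monoid_def)

context
  fixes V :: "('b, 'n) star_alg_scheme" and \<phi> :: "'g \<Rightarrow> 'b"
  assumes V: "star_algebra V" and \<phi>: "\<And>g. \<phi> g \<in> carrier V"
begin

interpretation V: star_algebra V by (rule V)

lemma free_hom_star_hom: "star_hom free_alg V (free_hom V \<phi>)"
  unfolding free_hom_def free_alg_def
proof (rule word.lin_ext_star_hom[OF V])
  let ?l = "\<lambda>(g, s). if s then star V (\<phi> g) else \<phi> g"
  let ?F = "\<lambda>w. foldr (\<lambda>(g, s) y. (if s then star V (\<phi> g) else \<phi> g) \<otimes>\<^bsub>V\<^esub> y) w \<one>\<^bsub>V\<^esub>"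
  have l: "?l x \<in> carrier V" for x by (cases x) (auto simp: \<phi>)
  have F: "?F w \<in> carrier V" for w
    by (induction w) (auto simp: \<phi>)
  then show "?F \<in> carrier word_monoid \<rightarrow> carrier V" by auto
  have F_append: "?F (v @ w) = ?F v \<otimes>\<^bsub>V\<^esub> ?F w" for v w
    by (induction v) (auto simp: \<phi> V.m_assoc F simp del: foldr_append simp: foldr_append[symmetric])
  then show "?F (v \<otimes>\<^bsub>word_monoid\<^esub> w) = ?F v \<otimes>\<^bsub>V\<^esub> ?F w" for v w
    by (simp add: word_monoid_def)
  show "?F \<one>\<^bsub>word_monoid\<^esub> = \<one>\<^bsub>V\<^esub>" by (simp add: word_monoid_def)
  show "?F (rev (map (\<lambda>(g, s). (g, \<not> s)) w)) = star V (?F w)" for w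
  proof (induction w)
    case Nil
    then show ?case by (simp add: V.star_one)
  next
    case (Cons x w)
    have "?F (rev (map (\<lambda>(g, s). (g, \<not> s)) (x # w))) =
      ?F (rev (map (\<lambda>(g, s). (g, \<not> s)) w)) \<otimes>\<^bsub>V\<^esub> ?F [(fst x, \<not> snd x)]"
      by (subst F_append[symmetric]) (simp add: case_prod_unfold)
    also have "\<dots> = star V (?F w) \<otimes>\<^bsub>V\<^esub> star V (?l x)"
      by (subst Cons.IH) (auto simp: case_prod_unfold \<phi> V.star_star)
    also have "\<dots> = star V (?F (x # w))"
      by (subst V.star_mult[symmetric]) (auto simp: case_prod_unfold F[unfolded case_prod_unfold] \<phi>)
    finally show ?case .
  qed
qed

lemma free_hom_gen: "free_hom V \<phi> (free_gen g) = \<phi> g"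
proof -
  have "(\<lambda>w. foldr (\<lambda>(g, s) y. (if s then star V (\<phi> g) else \<phi> g) \<otimes>\<^bsub>V\<^esub> y) w \<one>\<^bsub>V\<^esub>) \<in> carrier word_monoid \<rightarrow> carrier V"
  proof
    fix w
    show "foldr (\<lambda>(g, s) y. (if s then star V (\<phi> g) else \<phi> g) \<otimes>\<^bsub>V\<^esub> y) w \<one>\<^bsub>V\<^esub> \<in> carrier V"
      by (induction w) (auto simp: \<phi>)
  qed
  from word.lin_ext_single[OF V this] show ?thesis
    by (simp add: free_hom_def free_gen_def \<phi> V.smult_rules word_monoid_def)
qed

text \<open>
  The universal property of generators and relations: the extension to the free algebra kills the
  relations, hence the star-ideal generated by them.
\<close>

lemma univ_hom:
  assumes "\<And>r. r \<in> R \<Longrightarrow> free_hom V \<phi> r = \<zero>\<^bsub>V\<^esub>"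
  shows "star_hom (univ_alg R) V (univ_hom V \<phi>)" (is ?hom)
    and "univ_hom V \<phi> (univ_gen R g) = \<phi> g" (is ?gen)
proof -
  interpret F: star_algebra_ideal free_alg "gen_star_ideal free_alg R"
    by (rule star_algebra_ideal_gen[OF star_algebra_free_alg]) simp
  have z: "free_hom V \<phi> r = \<zero>\<^bsub>V\<^esub>" if "r \<in> gen_star_ideal free_alg R" for r
    using gen_star_ideal_kernel[OF star_algebra_free_alg V free_hom_star_hom _ _ that] assms by auto
  note l = V star_homD(1)[OF free_hom_star_hom] z
  show ?hom
    unfolding univ_alg_def univ_hom_def by (rule F.descend_star_hom[OF l]) (auto intro: free_hom_star_hom)
  show ?gen
    unfolding univ_hom_def univ_gen_def by (subst F.descend_quot_map[OF l]) (auto simp: free_hom_gen)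
qed

end

lemma star_algebra_univ_alg: "star_algebra (univ_alg R)"
proof -
  interpret F: star_algebra_ideal free_alg "gen_star_ideal free_alg R"
    by (rule star_algebra_ideal_gen[OF star_algebra_free_alg]) simp
  show ?thesis unfolding univ_alg_def by (rule F.star_algebra_quot)
qed

lemma univ_alg_relation:
  assumes "r \<in> R"
  shows "quot_map free_alg (gen_star_ideal free_alg R) r = \<zero>\<^bsub>univ_alg R\<^esub>"
proof -
  interpret F: star_algebra_ideal free_alg "gen_star_ideal free_alg R"
    by (rule star_algebra_ideal_gen[OF star_algebra_free_alg]) simp
  show ?thesis unfolding univ_alg_def using assms gen_star_ideal_superset[of R free_alg]
    by (subst F.quot_map_zero_iff) auto
qed

lemma star_hom_univ_quot_map:
  "star_hom free_alg (univ_alg R) (quot_map free_alg (gen_star_ideal free_alg R))"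
proof -
  interpret F: star_algebra_ideal free_alg "gen_star_ideal free_alg R"
    by (rule star_algebra_ideal_gen[OF star_algebra_free_alg]) simp
  show ?thesis unfolding univ_alg_def by (rule F.quot_map_star_hom)
qed

lemma univ_gen_closed [simp]: "univ_gen R g \<in> carrier (univ_alg R)"
  using star_homD(2)[OF star_hom_univ_quot_map] by (simp add: univ_gen_def)

text \<open>
  If the generators are self-adjoint, the letters that stand for their adjoints represent the
  generators again, so sums, products and multiples of generators exhaust the algebra and the star
  needs no clause of its own.
\<close>

lemma univ_alg_induct [consumes 1, case_names selfadj one gen add mult smult]:
  assumes "x \<in> carrier (univ_alg R)"
    and selfadj: "\<And>g. star (univ_alg R) (univ_gen R g) = univ_gen R g"
    and "P \<one>\<^bsub>univ_alg R\<^esub>" and gen: "\<And>g. P (univ_gen R g)"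
    and add: "\<And>x y. x \<in> carrier (univ_alg R) \<Longrightarrow> y \<in> carrier (univ_alg R) \<Longrightarrow> P x \<Longrightarrow> P y \<Longrightarrow> P (x \<oplus>\<^bsub>univ_alg R\<^esub> y)"
    and mult: "\<And>x y. x \<in> carrier (univ_alg R) \<Longrightarrow> y \<in> carrier (univ_alg R) \<Longrightarrow> P x \<Longrightarrow> P y \<Longrightarrow> P (x \<otimes>\<^bsub>univ_alg R\<^esub> y)"
    and smult: "\<And>c x. x \<in> carrier (univ_alg R) \<Longrightarrow> P x \<Longrightarrow> P (c \<odot>\<^bsub>univ_alg R\<^esub> x)"
  shows "P x"
proof -
  interpret F: star_algebra free_alg by (rule star_algebra_free_alg)
  interpret U: star_algebra "univ_alg R" by (rule star_algebra_univ_alg)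
  let ?q = "quot_map free_alg (gen_star_ideal free_alg R)"
  note q = star_homD[OF star_hom_univ_quot_map[of R]]
  note l = linear_map_zero[OF star_algebra_free_alg star_algebra_univ_alg q(1)]
  interpret I: star_algebra_ideal free_alg "gen_star_ideal free_alg R"
    by (rule star_algebra_ideal_gen[OF star_algebra_free_alg]) simp
  have letter: "P (?q (single [(g, s)] 1))" for g s
  proof (cases s)
    case False
    then show ?thesis using gen[of g] by (simp add: univ_gen_def free_gen_def)
  next
    case True
    have "?q (single [(g, True)] 1) = ?q (star free_alg (free_gen g))"
      by (simp add: free_gen_def free_alg_def word.star_single)
    also have "\<dots> = univ_gen R g"
      using selfadj[of g] by (simp add: q(7) univ_gen_def)
    finally show ?thesis using gen True by simp
  qed
  have word: "P (?q (single w 1))" for w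
  proof (induction w)
    case Nil
    have "?q (single [] 1) = \<one>\<^bsub>univ_alg R\<^esub>"
      using q(6) unfolding free_alg_def word.alg_simps(4) by (simp add: word_monoid_def)
    then show ?case using assms(3) by simp
  next
    case (Cons x w)
    have "single (x # w) 1 = single [x] 1 \<otimes>\<^bsub>free_alg\<^esub> single w 1"
      unfolding free_alg_def word.mult_single by (simp add: word_monoid_def)
    then show ?case using letter Cons by (cases x) (auto simp: q(2,3) intro!: mult)
  qed
  have "P (?q f)" for f
  proof -
    have "keys f \<subseteq> UNIV" by simp
    then show ?thesis
    proof (induction f rule: poly_mapping_span_induct)
      case (single w c)
      have "single w c = c \<odot>\<^bsub>free_alg\<^esub> single w 1"
        by (simp add: free_alg_def word.alg_simps word.scale_simps)
      then show ?case by (auto simp: q(2,5) intro!: smult word)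
    next
      case zero
      have "P (?q (0 \<odot>\<^bsub>free_alg\<^esub> single [] 1))"
        by (auto simp: q(2,5) intro!: smult word)
      then show ?case by (simp add: free_alg_def word.alg_simps word.scale_simps)
    next
      case (add f g)
      have "f + g = f \<oplus>\<^bsub>free_alg\<^esub> g" by (simp add: free_alg_def word.alg_simps)
      then show ?case using add by (auto simp: q(2,4) intro!: assms(5))
    qed
  qed
  then show ?thesis using assms(1) by (auto simp: univ_alg_def I.quot_carrier)
qed

section \<open>The algebraic tensor product\<close>

definition bilinear_map where
  "bilinear_map A B V \<phi> \<longleftrightarrow>
     (\<forall>a\<in>carrier A. linear_map B V (\<phi> a)) \<and> (\<forall>b\<in>carrier B. linear_map A V (\<lambda>a. \<phi> a b))"

lemma bilinear_mapI:
  assumes "\<And>a b. a \<in> carrier A \<Longrightarrow> b \<in> carrier B \<Longrightarrow> \<phi> a b \<in> carrier V"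
    and "\<And>a a' b. a \<in> carrier A \<Longrightarrow> a' \<in> carrier A \<Longrightarrow> b \<in> carrier B \<Longrightarrow> \<phi> (a \<oplus>\<^bsub>A\<^esub> a') b = \<phi> a b \<oplus>\<^bsub>V\<^esub> \<phi> a' b"
    and "\<And>a b b'. a \<in> carrier A \<Longrightarrow> b \<in> carrier B \<Longrightarrow> b' \<in> carrier B \<Longrightarrow> \<phi> a (b \<oplus>\<^bsub>B\<^esub> b') = \<phi> a b \<oplus>\<^bsub>V\<^esub> \<phi> a b'"
    and "\<And>c a b. a \<in> carrier A \<Longrightarrow> b \<in> carrier B \<Longrightarrow> \<phi> (c \<odot>\<^bsub>A\<^esub> a) b = c \<odot>\<^bsub>V\<^esub> \<phi> a b"
    and "\<And>c a b. a \<in> carrier A \<Longrightarrow> b \<in> carrier B \<Longrightarrow> \<phi> a (c \<odot>\<^bsub>B\<^esub> b) = c \<odot>\<^bsub>V\<^esub> \<phi> a b"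
  shows "bilinear_map A B V \<phi>"
  using assms by (auto simp: bilinear_map_def linear_map_def)

lemma bilinear_mapD:
  assumes "bilinear_map A B V \<phi>"
  shows "a \<in> carrier A \<Longrightarrow> linear_map B V (\<phi> a)" "b \<in> carrier B \<Longrightarrow> linear_map A V (\<lambda>a. \<phi> a b)"
    "a \<in> carrier A \<Longrightarrow> b \<in> carrier B \<Longrightarrow> \<phi> a b \<in> carrier V"
  using assms by (auto simp: bilinear_map_def linear_map_def)

lemma bilinear_map_compose:
  assumes "bilinear_map A B V \<phi>" "linear_map A' A f" "linear_map B' B g" "linear_map V W h"
  shows "bilinear_map A' B' W (\<lambda>a b. h (\<phi> (f a) (g b)))"
proof -
  have "linear_map B' W (\<lambda>b. h (\<phi> (f a) (g b)))" if "a \<in> carrier A'" for a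
    using linear_map_compose[OF linear_map_compose[OF assms(3) bilinear_mapD(1)[OF assms(1)]] assms(4)]
      linear_mapD(1)[OF assms(2) that] by blast
  moreover have "linear_map A' W (\<lambda>a. h (\<phi> (f a) (g b)))" if "b \<in> carrier B'" for b
    using linear_map_compose[OF linear_map_compose[OF assms(2) bilinear_mapD(2)[OF assms(1)]] assms(4)]
      linear_mapD(1)[OF assms(3) that] by blast
  ultimately show ?thesis by (simp add: bilinear_map_def)
qed

lemma tensor_null_mono:
  assumes "carrier A = carrier A'" "carrier B = carrier B'"
    "add A = add A'" "add B = add B'" "smult A = smult A'" "smult B = smult B'"
  shows "tensor_null A B \<subseteq> tensor_null A' B'"
proof
  show "f \<in> tensor_null A' B'" if "f \<in> tensor_null A B" for f
    using that unfolding assms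
    by (induction rule: tensor_null.induct) (unfold assms, (rule tensor_null.intros; assumption)+)
qed

text \<open>
  Only the star-algebra fields enter a tensor product. This moves statements between a Hopf algebra
  and its underlying star-algebra, which have different record types.
\<close>

lemma tensor_alg_cong:
  assumes "carrier A = carrier A'" "carrier B = carrier B'"
    "mult A = mult A'" "mult B = mult B'" "one A = one A'" "one B = one B'"
    "add A = add A'" "add B = add B'" "smult A = smult A'" "smult B = smult B'"
    "star A = star A'" "star B = star B'"
  shows "tensor_free A B = tensor_free A' B'" "tensor_null A B = tensor_null A' B'"
    "tensor_alg A B = tensor_alg A' B'" "tens A B = tens A' B'"
proof -
  show *: "tensor_free A B = tensor_free A' B'"
    by (simp add: tensor_free_def DirProd_def monoid_alg_def assms)
  show **: "tensor_null A B = tensor_null A' B'"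
    using assms by (intro equalityI tensor_null_mono) simp_all
  show "tensor_alg A B = tensor_alg A' B'" "tens A B = tens A' B'"
    by (simp_all add: tensor_alg_def tens_def * ** fun_eq_iff)
qed

context
  fixes A :: "('a, 'm) star_alg_scheme" and B :: "('b, 'n) star_alg_scheme"
  assumes A: "star_algebra A" and B: "star_algebra B"
begin

interpretation A: star_algebra A by (rule A)
interpretation B: star_algebra B by (rule B)

interpretation P: monoid_with_involution "A \<times>\<times> B" "map_prod (star A) (star B)"
proof -
  interpret monoid "A \<times>\<times> B"
    by (intro DirProd_monoid A.monoid_axioms B.monoid_axioms)
  show "monoid_with_involution (A \<times>\<times> B) (map_prod (star A) (star B))"
    by unfold_locales (auto simp: A.star_star B.star_star A.star_mult B.star_mult)
qed

lemma star_algebra_tensor_free: "star_algebra (tensor_free A B)"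
  unfolding tensor_free_def by (rule P.star_algebra)

lemma tensor_free_simps:
  "x \<in> carrier (tensor_free A B) \<longleftrightarrow> keys x \<subseteq> carrier A \<times> carrier B"
  "x \<oplus>\<^bsub>tensor_free A B\<^esub> y = x + y" "\<zero>\<^bsub>tensor_free A B\<^esub> = 0"
  "\<one>\<^bsub>tensor_free A B\<^esub> = single (\<one>\<^bsub>A\<^esub>, \<one>\<^bsub>B\<^esub>) 1"
  "c \<odot>\<^bsub>tensor_free A B\<^esub> x = Poly_Mapping.map ((*) c) x"
  unfolding tensor_free_def P.alg_simps by simp_all

lemma tensor_free_single:
  "single (a, b) c \<otimes>\<^bsub>tensor_free A B\<^esub> single (a', b') d =
     single (a \<otimes>\<^bsub>A\<^esub> a', b \<otimes>\<^bsub>B\<^esub> b') (c * d)"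
  "star (tensor_free A B) (single (a, b) c) = single (star A a, star B b) (cnj c)"
  unfolding tensor_free_def P.mult_single P.star_single by simp_all

interpretation F: star_algebra "tensor_free A B" by (rule star_algebra_tensor_free)

lemma tensor_free_minus:
  assumes "x \<in> carrier (tensor_free A B)" "y \<in> carrier (tensor_free A B)"
  shows "x \<ominus>\<^bsub>tensor_free A B\<^esub> y = x - y"
proof -
  have "\<ominus>\<^bsub>tensor_free A B\<^esub> y = - y"
    using assms by (intro F.minus_equality) (auto simp: tensor_free_simps in_keys_iff subset_iff)
  then show ?thesis by (simp add: a_minus_def tensor_free_simps)
qed

lemma tensor_null_subset: "f \<in> tensor_null A B \<Longrightarrow> f \<in> carrier (tensor_free A B)"
proof -
  have s: "single (a, b) c \<in> carrier (tensor_free A B)"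
    if "a \<in> carrier A" "b \<in> carrier B" for a b c
    using that by (auto simp: tensor_free_simps)
  have d: "x - y \<in> carrier (tensor_free A B)"
    if "x \<in> carrier (tensor_free A B)" "y \<in> carrier (tensor_free A B)" for x y
    using tensor_free_minus[OF that] F.minus_closed[OF that] by simp
  have add: "f + g \<in> carrier (tensor_free A B)"
    if "f \<in> carrier (tensor_free A B)" "g \<in> carrier (tensor_free A B)" for f g
    using F.a_closed[OF that] by (simp add: tensor_free_simps(2))
  have scale: "Poly_Mapping.map ((*) c) f \<in> carrier (tensor_free A B)"
    if "f \<in> carrier (tensor_free A B)" for f c
    using F.smult_closed'[OF that, of c] by (simp add: tensor_free_simps(5))
  have zero: "0 \<in> carrier (tensor_free A B)" by (simp add: tensor_free_simps)
  show "f \<in> tensor_null A B \<Longrightarrow> f \<in> carrier (tensor_free A B)"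
    by (induction rule: tensor_null.induct) (auto intro!: d s add scale zero)
qed

lemma tensor_free_diff:
  "f \<otimes>\<^bsub>tensor_free A B\<^esub> (g - h) = f \<otimes>\<^bsub>tensor_free A B\<^esub> g - f \<otimes>\<^bsub>tensor_free A B\<^esub> h"
  "(g - h) \<otimes>\<^bsub>tensor_free A B\<^esub> f = g \<otimes>\<^bsub>tensor_free A B\<^esub> f - h \<otimes>\<^bsub>tensor_free A B\<^esub> f"
  "star (tensor_free A B) (g - h) = star (tensor_free A B) g - star (tensor_free A B) h"
  using P.mult_add(2)[of f "g - h" h] P.mult_add(1)[of "g - h" h f] P.star_add[of "g - h" h]
  unfolding tensor_free_def by simp_all

lemma tensor_null_scaled:
  "a \<in> carrier A \<Longrightarrow> a' \<in> carrier A \<Longrightarrow> b \<in> carrier B \<Longrightarrow>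
    single (a \<oplus>\<^bsub>A\<^esub> a', b) d - single (a, b) d - single (a', b) d
      \<in> tensor_null A B"
  "a \<in> carrier A \<Longrightarrow> b \<in> carrier B \<Longrightarrow> b' \<in> carrier B \<Longrightarrow>
    single (a, b \<oplus>\<^bsub>B\<^esub> b') d - single (a, b) d - single (a, b') d
      \<in> tensor_null A B"
  "a \<in> carrier A \<Longrightarrow> b \<in> carrier B \<Longrightarrow>
    single (c \<odot>\<^bsub>A\<^esub> a, b) d - single (a, b) (d * c) \<in> tensor_null A B"
  "a \<in> carrier A \<Longrightarrow> b \<in> carrier B \<Longrightarrow>
    single (a, c \<odot>\<^bsub>B\<^esub> b) d - single (a, b) (d * c) \<in> tensor_null A B"
  using tensor_null.scale[OF tensor_null.add_left, of a A a' b B d]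
    tensor_null.scale[OF tensor_null.add_right, of a A b B b' d]
    tensor_null.scale[OF tensor_null.scale_left, of a A b B d c]
    tensor_null.scale[OF tensor_null.scale_right, of a A b B d c]
  by (simp_all add: scale_diff P.scale_simps)

text \<open>
  Multiplying a bilinearity relator by an elementary tensor, or applying the star to it, gives a
  multiple of a relator of the same kind. Hence the span of the relators is a star-ideal.
\<close>

lemma tensor_null_closed_single:
  assumes "f \<in> tensor_null A B" and a: "a \<in> carrier A" "b \<in> carrier B"
  shows "single (a, b) e \<otimes>\<^bsub>tensor_free A B\<^esub> f \<in> tensor_null A B" (is "?l f")
    "f \<otimes>\<^bsub>tensor_free A B\<^esub> single (a, b) e \<in> tensor_null A B" (is "?r f")
    "star (tensor_free A B) f \<in> tensor_null A B" (is "?s f")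
proof -
  have s: "single (a, b) e \<in> carrier (tensor_free A B)"
    using a by (auto simp: tensor_free_simps)
  have "?l f \<and> ?r f \<and> ?s f"
    using assms(1)
  proof (induction rule: tensor_null.induct)
    case zero
    then show ?case using tensor_null.zero
      by (simp add: tensor_free_def P.mult_zero P.star_zero)
  next
    case (add f g)
    then show ?case
      by (auto simp: tensor_free_def P.mult_add P.star_add intro: tensor_null.add)
  next
    case (scale f c)
    then show ?case
      using F.smult_mult_left[of f _ c] F.smult_mult_right[of _ f c] F.star_smult[of f c]
        tensor_null_subset[of f] s
      by (auto simp: tensor_free_simps(5) intro: tensor_null.scale)
  next
    case (add_left x x' y)
    then show ?case using a
      by (simp add: tensor_free_diff tensor_free_single A.l_distr A.r_distr A.star_add tensor_null_scaled)
  next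
    case (add_right x y y')
    then show ?case using a
      by (simp add: tensor_free_diff tensor_free_single B.l_distr B.r_distr B.star_add tensor_null_scaled)
  next
    case (scale_left x y c)
    then show ?case using a tensor_null_scaled(3)[of "a \<otimes>\<^bsub>A\<^esub> x" "b \<otimes>\<^bsub>B\<^esub> y" c e]
        tensor_null_scaled(3)[of "x \<otimes>\<^bsub>A\<^esub> a" "y \<otimes>\<^bsub>B\<^esub> b" c e]
        tensor_null_scaled(3)[of "star A x" "star B y" "cnj c" 1]
      by (simp add: tensor_free_diff tensor_free_single A.smult_mult_left A.smult_mult_right A.star_smult mult.commute)
  next
    case (scale_right x y c)
    then show ?case using a tensor_null_scaled(4)[of "a \<otimes>\<^bsub>A\<^esub> x" "b \<otimes>\<^bsub>B\<^esub> y" c e]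
        tensor_null_scaled(4)[of "x \<otimes>\<^bsub>A\<^esub> a" "y \<otimes>\<^bsub>B\<^esub> b" c e]
        tensor_null_scaled(4)[of "star A x" "star B y" "cnj c" 1]
      by (simp add: tensor_free_diff tensor_free_single B.smult_mult_left B.smult_mult_right B.star_smult mult.commute)
  qed
  then show "?l f" "?r f" "?s f" by auto
qed

lemma star_ideal_tensor_null: "star_ideal (tensor_null A B) (tensor_free A B)"
proof (rule star_idealI[OF star_algebra_tensor_free])
  fix f g
  assume f: "f \<in> tensor_null A B"
  show "star (tensor_free A B) f \<in> tensor_null A B"
    by (rule tensor_null_closed_single[OF f, of "\<one>\<^bsub>A\<^esub>" "\<one>\<^bsub>B\<^esub>"]) auto
  assume "g \<in> carrier (tensor_free A B)"
  then have g: "keys g \<subseteq> carrier (A \<times>\<times> B)" by (simp add: tensor_free_simps)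
  show "g \<otimes>\<^bsub>tensor_free A B\<^esub> f \<in> tensor_null A B" using g
    by (induction g rule: poly_mapping_span_induct)
      (auto simp: tensor_free_def P.mult_zero P.mult_add
        intro: tensor_null.intros tensor_null_closed_single(1)[OF f, unfolded tensor_free_def])
  show "f \<otimes>\<^bsub>tensor_free A B\<^esub> g \<in> tensor_null A B" using g
    by (induction g rule: poly_mapping_span_induct)
      (auto simp: tensor_free_def P.mult_zero P.mult_add
        intro: tensor_null.intros tensor_null_closed_single(2)[OF f, unfolded tensor_free_def])
qed (use tensor_null_subset tensor_null.intros in \<open>auto simp: tensor_free_simps(2,3)\<close>)

interpretation T: star_algebra_ideal "tensor_free A B" "tensor_null A B"
  by (intro star_algebra_ideal.intro star_algebra_ideal_axioms.intro star_ideal_tensor_null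
      star_algebra_tensor_free)

lemma star_algebra_tensor: "star_algebra (tensor_alg A B)"
  unfolding tensor_alg_def by (rule T.star_algebra_quot)

lemmas tensor_quot_hom = star_homD[OF T.quot_map_star_hom, folded tensor_alg_def]

lemma tens_closed [simp]: "a \<in> carrier A \<Longrightarrow> b \<in> carrier B \<Longrightarrow> tens A B a b \<in> carrier (tensor_alg A B)"
  unfolding tens_def by (intro tensor_quot_hom) (simp add: tensor_free_simps)

lemma tens_mult:
  assumes "a \<in> carrier A" "b \<in> carrier B" "a' \<in> carrier A" "b' \<in> carrier B"
  shows "tens A B a b \<otimes>\<^bsub>tensor_alg A B\<^esub> tens A B a' b' = tens A B (a \<otimes>\<^bsub>A\<^esub> a') (b \<otimes>\<^bsub>B\<^esub> b')"
  unfolding tens_def using assms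
  by (subst tensor_quot_hom(3)[symmetric]) (auto simp: tensor_free_simps tensor_free_single)

lemma tens_one: "\<one>\<^bsub>tensor_alg A B\<^esub> = tens A B \<one>\<^bsub>A\<^esub> \<one>\<^bsub>B\<^esub>"
  unfolding tens_def tensor_quot_hom(6)[symmetric] tensor_free_simps ..

lemma tens_star:
  assumes "a \<in> carrier A" "b \<in> carrier B"
  shows "star (tensor_alg A B) (tens A B a b) = tens A B (star A a) (star B b)"
  unfolding tens_def using assms
  by (subst tensor_quot_hom(7)[symmetric]) (auto simp: tensor_free_simps tensor_free_single)

lemma quot_map_tensor_eqI:
  assumes "f \<in> carrier (tensor_free A B)" "g \<in> carrier (tensor_free A B)" "f - g \<in> tensor_null A B"
  shows "quot_map (tensor_free A B) (tensor_null A B) f = quot_map (tensor_free A B) (tensor_null A B) g"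
  using T.quot_map_eqI[OF assms(2,3)] by (simp add: tensor_free_simps(2))

lemma bilinear_tens: "bilinear_map A B (tensor_alg A B) (tens A B)"
proof (rule bilinear_mapI)
  have s: "single (a, b) c \<in> carrier (tensor_free A B)"
    if "a \<in> carrier A" "b \<in> carrier B" for a b c
    using that by (auto simp: tensor_free_simps)
  note [simp] = tensor_quot_hom(4,5)[symmetric] s
  fix a b assume [simp]: "a \<in> carrier A" "b \<in> carrier B"
  show "tens A B a b \<in> carrier (tensor_alg A B)" by simp
  show "tens A B (a \<oplus>\<^bsub>A\<^esub> a') b = tens A B a b \<oplus>\<^bsub>tensor_alg A B\<^esub> tens A B a' b"
    if "a' \<in> carrier A" for a'
    unfolding tens_def using that tensor_null_scaled(1)[of a a' b 1] F.a_closed[of "single (a, b) 1" "single (a', b) 1"]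
    by (simp add: quot_map_tensor_eqI tensor_free_simps(2) diff_diff_eq)
  show "tens A B a (b \<oplus>\<^bsub>B\<^esub> b') = tens A B a b \<oplus>\<^bsub>tensor_alg A B\<^esub> tens A B a b'"
    if "b' \<in> carrier B" for b'
    unfolding tens_def using that tensor_null_scaled(2)[of a b b' 1] F.a_closed[of "single (a, b) 1" "single (a, b') 1"]
    by (simp add: quot_map_tensor_eqI tensor_free_simps(2) diff_diff_eq)
  show "tens A B (c \<odot>\<^bsub>A\<^esub> a) b = c \<odot>\<^bsub>tensor_alg A B\<^esub> tens A B a b"
    "tens A B a (c \<odot>\<^bsub>B\<^esub> b) = c \<odot>\<^bsub>tensor_alg A B\<^esub> tens A B a b" for c
    unfolding tens_def using tensor_null_scaled(3,4)[of a b c 1]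
    by (simp_all add: quot_map_tensor_eqI tensor_free_simps(5) P.scale_simps)
qed

text \<open>
  Elementary tensors span the tensor product additively, as scalars can be absorbed in the first factor.
\<close>

lemma tensor_induct [consumes 1, case_names tens add]:
  assumes "X \<in> carrier (tensor_alg A B)"
    and tens: "\<And>a b. a \<in> carrier A \<Longrightarrow> b \<in> carrier B \<Longrightarrow> P (tens A B a b)"
    and add: "\<And>X Y. X \<in> carrier (tensor_alg A B) \<Longrightarrow> Y \<in> carrier (tensor_alg A B) \<Longrightarrow> P X \<Longrightarrow> P Y \<Longrightarrow>
      P (X \<oplus>\<^bsub>tensor_alg A B\<^esub> Y)"
  shows "P X"
proof -
  obtain f where f: "f \<in> carrier (tensor_free A B)" and X: "X = quot_map (tensor_free A B) (tensor_null A B) f"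
    using assms(1) unfolding tensor_alg_def T.quot_carrier by auto
  have "keys f \<subseteq> carrier A \<times> carrier B" using f by (simp add: tensor_free_simps)
  then show ?thesis unfolding X
  proof (induction f rule: poly_mapping_span_induct)
    case (single m c)
    then obtain a b where m: "m = (a, b)" "a \<in> carrier A" "b \<in> carrier B" by auto
    have "quot_map (tensor_free A B) (tensor_null A B) (single (a, b) c) = tens A B (c \<odot>\<^bsub>A\<^esub> a) b"
      unfolding tens_def using m tensor_null_scaled(3)[of a b c 1]
      by (intro quot_map_tensor_eqI[symmetric]) (auto simp: tensor_free_simps)
    then show ?case using m by (auto intro!: tens)
  next
    case zero
    have "quot_map (tensor_free A B) (tensor_null A B) (single (\<zero>\<^bsub>A\<^esub>, \<one>\<^bsub>B\<^esub>) 0) = tens A B (0 \<odot>\<^bsub>A\<^esub> \<zero>\<^bsub>A\<^esub>) \<one>\<^bsub>B\<^esub>"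
      unfolding tens_def using tensor_null_scaled(3)[of "\<zero>\<^bsub>A\<^esub>" "\<one>\<^bsub>B\<^esub>" 0 1]
      by (intro quot_map_tensor_eqI[symmetric]) (auto simp: tensor_free_simps)
    then show ?case by (auto intro!: tens)
  next
    case (add f g)
    then show ?case using assms(3) tensor_quot_hom(2,4)[of f] tensor_quot_hom(2)[of g] by (simp add: tensor_free_simps)
  qed
qed

lemma tensor_linear_eqI:
  assumes "linear_map (tensor_alg A B) V f" "linear_map (tensor_alg A B) V g"
    and "\<And>a b. a \<in> carrier A \<Longrightarrow> b \<in> carrier B \<Longrightarrow> f (tens A B a b) = g (tens A B a b)"
    and "X \<in> carrier (tensor_alg A B)"
  shows "f X = g X"
  using assms(4)
  by (induction rule: tensor_induct) (simp_all add: assms(3) linear_mapD(2)[OF assms(1)] linear_mapD(2)[OF assms(2)])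

text \<open>
  Both sides of the product condition are bilinear and both sides of the star condition are additive,
  so elementary tensors suffice.
\<close>

lemma tensor_star_homI:
  assumes V: "star_algebra V" and f: "linear_map (tensor_alg A B) V f"
    and mult: "\<And>a b a' b'. a \<in> carrier A \<Longrightarrow> b \<in> carrier B \<Longrightarrow> a' \<in> carrier A \<Longrightarrow> b' \<in> carrier B \<Longrightarrow>
      f (tens A B (a \<otimes>\<^bsub>A\<^esub> a') (b \<otimes>\<^bsub>B\<^esub> b')) = f (tens A B a b) \<otimes>\<^bsub>V\<^esub> f (tens A B a' b')"
    and one: "f (tens A B \<one>\<^bsub>A\<^esub> \<one>\<^bsub>B\<^esub>) = \<one>\<^bsub>V\<^esub>"
    and star: "\<And>a b. a \<in> carrier A \<Longrightarrow> b \<in> carrier B \<Longrightarrow>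
      f (tens A B (star A a) (star B b)) = star V (f (tens A B a b))"
  shows "star_hom (tensor_alg A B) V f"
proof -
  interpret V: star_algebra V by (rule V)
  interpret AB: star_algebra "tensor_alg A B" by (rule star_algebra_tensor)
  note [simp] = linear_mapD(1,2)[OF f]
  show ?thesis
  proof (rule star_homI[OF f])
    fix X Y assume X: "X \<in> carrier (tensor_alg A B)" and Y: "Y \<in> carrier (tensor_alg A B)"
    show "f (X \<otimes>\<^bsub>tensor_alg A B\<^esub> Y) = f X \<otimes>\<^bsub>V\<^esub> f Y" using X
    proof (induction rule: tensor_induct)
      case (tens a b)
      show ?case using Y
        by (induction rule: tensor_induct) (use tens in \<open>simp_all add: tens_mult mult AB.r_distr V.r_distr\<close>)
    qed (simp add: AB.l_distr V.l_distr Y)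
  next
    fix X assume X: "X \<in> carrier (tensor_alg A B)"
    then show "f (star (tensor_alg A B) X) = star V (f X)"
      by (induction rule: tensor_induct) (simp_all add: tens_star star AB.star_add V.star_add)
  qed (simp add: tens_one one)
qed

text \<open>
  The universal property of the tensor product: the linear extension of a bilinear map to the free
  vector space vanishes on the bilinearity relators.
\<close>

lemma tensor_lift:
  assumes V: "star_algebra V" and \<phi>: "bilinear_map A B V \<phi>"
  shows "linear_map (tensor_alg A B) V (tensor_lift V \<phi>)"
    and "a \<in> carrier A \<Longrightarrow> b \<in> carrier B \<Longrightarrow> tensor_lift V \<phi> (tens A B a b) = \<phi> a b"
proof -
  interpret V: star_algebra V by (rule V)
  let ?F = "lin_ext V (\<lambda>(a, b). \<phi> a b)"
  note \<phi>_closed = bilinear_mapD(3)[OF \<phi>]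
  note lD = linear_mapD(2,3)[OF bilinear_mapD(1)[OF \<phi>]] linear_mapD(2,3)[OF bilinear_mapD(2)[OF \<phi>]]
  have closed: "(\<lambda>(a, b). \<phi> a b) \<in> carrier (A \<times>\<times> B) \<rightarrow> carrier V"
    using \<phi>_closed by auto
  have F: "linear_map (tensor_free A B) V ?F"
    unfolding tensor_free_def by (rule P.lin_ext_linear_map[OF V closed])
  have F_single: "?F (single (a, b) c) = c \<odot>\<^bsub>V\<^esub> \<phi> a b"
    if "a \<in> carrier A" "b \<in> carrier B" for a b c
    using P.lin_ext_single[OF V closed, of "(a, b)" c] that by simp
  have s: "single (a, b) c \<in> carrier (tensor_free A B)"
    if "a \<in> carrier A" "b \<in> carrier B" for a b c
    using that by (auto simp: tensor_free_simps)
  have d: "x - y \<in> carrier (tensor_free A B)" "?F (x - y) = ?F x \<ominus>\<^bsub>V\<^esub> ?F y"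
    if "x \<in> carrier (tensor_free A B)" "y \<in> carrier (tensor_free A B)" for x y
    using tensor_free_minus[OF that] F.minus_closed[OF that]
      linear_map_diff[OF star_algebra_tensor_free V F that] by simp_all
  have F_zero: "?F f = \<zero>\<^bsub>V\<^esub>" if "f \<in> tensor_null A B" for f
    using that
  proof (induction rule: tensor_null.induct)
    case zero
    then show ?case by (simp add: lin_ext_def)
  next
    case (add f g)
    then show ?case using linear_mapD(2)[OF F, of f g] tensor_null_subset
      by (simp add: tensor_free_simps(2))
  next
    case (scale f c)
    then show ?case using linear_mapD(3)[OF F, of f c] tensor_null_subset
      by (simp add: tensor_free_simps(5) V.smult_rules)
  next
    case (add_left a a' b)
    then show ?case
      by (simp add: d s F_single \<phi>_closed V.smult_rules lD a_minus_def V.a_ac V.r_neg V.minus_add)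
  next
    case (add_right a b b')
    then show ?case
      by (simp add: d s F_single \<phi>_closed V.smult_rules lD a_minus_def V.a_ac V.r_neg V.minus_add)
  next
    case (scale_left a b c)
    then show ?case
      by (simp add: d s F_single \<phi>_closed V.smult_rules lD V.minus_eq_zero_iff)
  next
    case (scale_right a b c)
    then show ?case
      by (simp add: d s F_single \<phi>_closed V.smult_rules lD V.minus_eq_zero_iff)
  qed
  show "linear_map (tensor_alg A B) V (tensor_lift V \<phi>)"
    unfolding tensor_alg_def tensor_lift_def by (rule T.descend_linear_map[OF V F F_zero])
  show "a \<in> carrier A \<Longrightarrow> b \<in> carrier B \<Longrightarrow> tensor_lift V \<phi> (tens A B a b) = \<phi> a b"
    unfolding tens_def tensor_lift_def
    by (subst T.descend_quot_map[OF V F F_zero]) (auto simp: s F_single \<phi>_closed V.smult_rules)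
qed

end

lemma (in star_algebra) mult_linear_map:
  assumes "y \<in> carrier A"
  shows "linear_map A A (\<lambda>x. x \<otimes> y)" "linear_map A A (\<lambda>x. y \<otimes> x)"
  using assms by (auto simp: linear_map_def l_distr r_distr smult_mult_left smult_mult_right)

lemma bilinear_mult:
  assumes "star_algebra A"
  shows "bilinear_map A A A (mult A)"
proof -
  interpret star_algebra A by fact
  show ?thesis by (simp add: bilinear_map_def mult_linear_map)
qed

subsection \<open>Functoriality and associativity\<close>

context
  fixes A :: "('a, 'm) star_alg_scheme" and B :: "('b, 'n) star_alg_scheme"
    and C :: "('c, 'k) star_alg_scheme" and D :: "('d, 'l) star_alg_scheme"
  assumes A: "star_algebra A" and B: "star_algebra B" and C: "star_algebra C" and D: "star_algebra D"
begin

interpretation A: star_algebra A by (rule A)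
interpretation B: star_algebra B by (rule B)

lemma tensor_map:
  assumes "linear_map A C f" "linear_map B D g"
  shows "linear_map (tensor_alg A B) (tensor_alg C D) (tensor_map C D f g)"
    and "a \<in> carrier A \<Longrightarrow> b \<in> carrier B \<Longrightarrow> tensor_map C D f g (tens A B a b) = tens C D (f a) (g b)"
  unfolding tensor_map_def
  by (rule tensor_lift[OF A B star_algebra_tensor[OF C D]
        bilinear_map_compose[OF bilinear_tens[OF C D] assms linear_map_ident(1)]]; assumption)+

lemma tensor_map_star_hom:
  assumes f: "star_hom A C f" and g: "star_hom B D g"
  shows "star_hom (tensor_alg A B) (tensor_alg C D) (tensor_map C D f g)"
  using star_homD[OF f] star_homD[OF g] tensor_map[OF star_homD(1)[OF f] star_homD(1)[OF g]]
  by (intro tensor_star_homI[OF A B star_algebra_tensor[OF C D]])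
    (simp_all add: tens_mult[OF C D] tens_star[OF C D] tens_one[OF C D])

end

context
  fixes A :: "('a, 'm) star_alg_scheme" and B :: "('b, 'n) star_alg_scheme"
    and C :: "('c, 'k) star_alg_scheme"
  assumes A: "star_algebra A" and B: "star_algebra B" and C: "star_algebra C"
begin

interpretation A: star_algebra A by (rule A)
interpretation B: star_algebra B by (rule B)
interpretation C: star_algebra C by (rule C)

lemmas star_algebra_triple_tensor = star_algebra_tensor[OF A B] star_algebra_tensor[OF B C]
  star_algebra_tensor[OF star_algebra_tensor[OF A B] C] star_algebra_tensor[OF A star_algebra_tensor[OF B C]]

interpretation A_BC: star_algebra "tensor_alg A (tensor_alg B C)" by (rule star_algebra_triple_tensor)

lemma tensor_assoc:
  shows "linear_map (tensor_alg (tensor_alg A B) C) (tensor_alg A (tensor_alg B C)) (tensor_assoc A B C)"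
    and "a \<in> carrier A \<Longrightarrow> b \<in> carrier B \<Longrightarrow> c \<in> carrier C \<Longrightarrow>
      tensor_assoc A B C (tens (tensor_alg A B) C (tens A B a b) c) = tens A (tensor_alg B C) a (tens B C b c)"
proof -
  note AB = star_algebra_triple_tensor(1) and BC = star_algebra_triple_tensor(2)
    and AB_C = star_algebra_triple_tensor(3) and A_BC = star_algebra_triple_tensor(4)
  let ?V = "tensor_alg A (tensor_alg B C)"
  let ?\<phi> = "\<lambda>X c. tensor_lift ?V (\<lambda>a b. tens A (tensor_alg B C) a (tens B C b c)) X"
  note bt = bilinear_tens[OF A BC] bilinear_tens[OF B C]
  have 1: "bilinear_map A B ?V (\<lambda>a b. tens A (tensor_alg B C) a (tens B C b c))" if "c \<in> carrier C" for c
    by (rule bilinear_map_compose[OF bt(1) linear_map_ident(1) bilinear_mapD(2)[OF bt(2) that] linear_map_ident(1)])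
  note l = tensor_lift[OF A B A_BC 1]
  have lin: "linear_map C ?V (\<lambda>c. tens A (tensor_alg B C) a (tens B C b c))"
    if "a \<in> carrier A" "b \<in> carrier B" for a b
    using linear_map_compose[OF bilinear_mapD(1)[OF bt(2)] bilinear_mapD(1)[OF bt(1)]] that by blast
  have 2: "bilinear_map (tensor_alg A B) C ?V ?\<phi>"
    unfolding bilinear_map_def
  proof (intro conjI ballI)
    show "linear_map (tensor_alg A B) ?V (\<lambda>X. ?\<phi> X c)" if "c \<in> carrier C" for c
      by (rule l(1)[OF that])
    fix X assume X: "X \<in> carrier (tensor_alg A B)"
    \<comment> \<open>sums of maps that are linear in the second argument are linear, so elementary tensors \<open>X\<close> suffice\<close>
    then show "linear_map C ?V (?\<phi> X)"
    proof (induction rule: tensor_induct[OF A B, consumes 1, case_names tens add])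
      case (tens a b)
      then show ?case using lin[OF tens] l(2)
        by (auto simp: linear_map_def Pi_def)
    next
      case (add X Y)
      then show ?case
        using linear_mapD(2)[OF l(1)]
        by (auto simp: linear_map_def Pi_def A_BC.smult_rules A_BC.a_ac)
    qed
  qed
  note l2 = tensor_lift[OF AB C A_BC 2]
  show "linear_map (tensor_alg (tensor_alg A B) C) ?V (tensor_assoc A B C)"
    unfolding tensor_assoc_def by (rule l2)
  show "a \<in> carrier A \<Longrightarrow> b \<in> carrier B \<Longrightarrow> c \<in> carrier C \<Longrightarrow>
      tensor_assoc A B C (tens (tensor_alg A B) C (tens A B a b) c) = tens A (tensor_alg B C) a (tens B C b c)"
    unfolding tensor_assoc_def by (subst l2(2)) (auto simp: l(2) tens_closed[OF A B])
qed

lemma tensor_linear_eqI3: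
  assumes "linear_map (tensor_alg (tensor_alg A B) C) V f" "linear_map (tensor_alg (tensor_alg A B) C) V g"
    and eq: "\<And>a b c. a \<in> carrier A \<Longrightarrow> b \<in> carrier B \<Longrightarrow> c \<in> carrier C \<Longrightarrow>
      f (tens (tensor_alg A B) C (tens A B a b) c) = g (tens (tensor_alg A B) C (tens A B a b) c)"
    and "X \<in> carrier (tensor_alg (tensor_alg A B) C)"
  shows "f X = g X"
proof (rule tensor_linear_eqI[OF star_algebra_triple_tensor(1) C assms(1,2) _ assms(4)])
  fix Y c assume Y: "Y \<in> carrier (tensor_alg A B)" and c: "c \<in> carrier C"
  note * = bilinear_mapD(2)[OF bilinear_tens[OF star_algebra_triple_tensor(1) C] c]
  show "f (tens (tensor_alg A B) C Y c) = g (tens (tensor_alg A B) C Y c)"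
    by (rule tensor_linear_eqI[OF A B linear_map_compose[OF * assms(1)] linear_map_compose[OF * assms(2)] _ Y])
      (use eq c in auto)
qed

lemma tensor_assoc_star_hom:
  "star_hom (tensor_alg (tensor_alg A B) C) (tensor_alg A (tensor_alg B C)) (tensor_assoc A B C)"
proof -
  note AB = star_algebra_triple_tensor(1) and BC = star_algebra_triple_tensor(2)
    and AB_C = star_algebra_triple_tensor(3) and A_BC = star_algebra_triple_tensor(4)
  interpret AB: star_algebra "tensor_alg A B" by (rule star_algebra_triple_tensor)
  interpret BC: star_algebra "tensor_alg B C" by (rule star_algebra_triple_tensor)
  interpret L: star_algebra "tensor_alg (tensor_alg A B) C" by (rule star_algebra_triple_tensor)
  let ?L = "tensor_alg (tensor_alg A B) C" and ?V = "tensor_alg A (tensor_alg B C)"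
  let ?s = "tensor_assoc A B C"
  let ?t = "\<lambda>a b c. tens (tensor_alg A B) C (tens A B a b) c"
  note [simp] = tens_closed[OF A B] tens_closed[OF B C] tens_closed[OF AB C] tens_closed[OF A BC]
    tens_mult[OF A B] tens_mult[OF B C] tens_mult[OF AB C] tens_mult[OF A BC]
    tens_star[OF A B] tens_star[OF B C] tens_star[OF AB C] tens_star[OF A BC] tensor_assoc(2)
    linear_mapD(1)[OF tensor_assoc(1)]
  note lin = tensor_assoc(1)
  show ?thesis
  proof (rule star_homI[OF lin])
    fix X Y assume X: "X \<in> carrier ?L" and Y: "Y \<in> carrier ?L"
    have "?s (X \<otimes>\<^bsub>?L\<^esub> ?t a b c) = ?s X \<otimes>\<^bsub>?V\<^esub> ?s (?t a b c)"
      if "a \<in> carrier A" "b \<in> carrier B" "c \<in> carrier C" for a b c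
      by (rule tensor_linear_eqI3[OF linear_map_compose[OF L.mult_linear_map(1) lin]
            linear_map_compose[OF lin A_BC.mult_linear_map(1)] _ X])
        (use that in auto)
    then show "?s (X \<otimes>\<^bsub>?L\<^esub> Y) = ?s X \<otimes>\<^bsub>?V\<^esub> ?s Y"
      by (intro tensor_linear_eqI3[OF linear_map_compose[OF L.mult_linear_map(2) lin]
            linear_map_compose[OF lin A_BC.mult_linear_map(2)] _ Y])
        (use X in auto)
  next
    show "?s \<one>\<^bsub>?L\<^esub> = \<one>\<^bsub>?V\<^esub>"
      by (simp add: tens_one[OF A B] tens_one[OF B C] tens_one[OF AB C] tens_one[OF A BC])
  next
    fix X assume "X \<in> carrier ?L"
    then show "?s (star ?L X) = star ?V (?s X)"
    proof (induction rule: tensor_induct[OF AB C, consumes 1, case_names tens add])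
      case (tens Y c)
      from this(1) show ?case
      proof (induction rule: tensor_induct[OF A B, consumes 1, case_names tens add])
        case (tens a b)
        then show ?case using \<open>c \<in> carrier C\<close> by simp
      next
        case (add Y Y')
        then show ?case using tens linear_mapD(2)[OF bilinear_mapD(2)[OF bilinear_tens[OF AB C]]]
          by (simp add: L.star_add A_BC.star_add linear_mapD(2)[OF lin] del: tens_star[OF AB C])
      qed
    next
      case (add X Y)
      then show ?case by (simp add: L.star_add A_BC.star_add linear_mapD(2)[OF lin])
    qed
  qed
qed

end

section \<open>Bijectivity of the Galois maps\<close>

text \<open>
  The maps \<open>x \<otimes> z \<mapsto> F(x)(1 \<otimes> z)\<close> and \<open>z \<otimes> x \<mapsto> (z \<otimes> 1) F(x)\<close>. The algebra on which \<open>F\<close> is defined may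
  differ from both tensor factors, so that the Galois maps and their inverses are of the same form.
\<close>

definition canonical_left where
  "canonical_left Y Z F = tensor_lift (tensor_alg Y Z) (\<lambda>x z. F x \<otimes>\<^bsub>tensor_alg Y Z\<^esub> tens Y Z \<one>\<^bsub>Y\<^esub> z)"

definition canonical_right where
  "canonical_right Z Y F = tensor_lift (tensor_alg Z Y) (\<lambda>z x. tens Z Y z \<one>\<^bsub>Y\<^esub> \<otimes>\<^bsub>tensor_alg Z Y\<^esub> F x)"

lemma galois_left_eq: "galois_left A Z \<delta> = canonical_left A Z \<delta>"
  by (simp add: galois_left_def canonical_left_def)

lemma galois_right_eq: "galois_right Z B \<gamma> = canonical_right Z B \<gamma>"
  by (simp add: galois_right_def canonical_right_def)

context
  fixes X :: "('x, 'm) star_alg_scheme" and Y :: "('y, 'n) star_alg_scheme"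
    and Z :: "('z, 'k) star_alg_scheme"
  assumes X: "star_algebra X" and Y: "star_algebra Y" and Z: "star_algebra Z"
begin

interpretation X: star_algebra X by (rule X)
interpretation Y: star_algebra Y by (rule Y)
interpretation Z: star_algebra Z by (rule Z)
interpretation YZ: star_algebra "tensor_alg Y Z" by (rule star_algebra_tensor[OF Y Z])
interpretation ZY: star_algebra "tensor_alg Z Y" by (rule star_algebra_tensor[OF Z Y])

lemma canonical_left:
  assumes F: "linear_map X (tensor_alg Y Z) F"
  shows "linear_map (tensor_alg X Z) (tensor_alg Y Z) (canonical_left Y Z F)" (is ?lin)
    and "x \<in> carrier X \<Longrightarrow> z \<in> carrier Z \<Longrightarrow>
      canonical_left Y Z F (tens X Z x z) = F x \<otimes>\<^bsub>tensor_alg Y Z\<^esub> tens Y Z \<one>\<^bsub>Y\<^esub> z" (is "PROP ?val")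
proof -
  have b: "bilinear_map X Z (tensor_alg Y Z) (\<lambda>x z. F x \<otimes>\<^bsub>tensor_alg Y Z\<^esub> tens Y Z \<one>\<^bsub>Y\<^esub> z)"
    by (rule bilinear_map_compose[OF bilinear_mult[OF YZ.star_algebra_axioms] F
          bilinear_mapD(1)[OF bilinear_tens[OF Y Z]] linear_map_ident(1)]) simp
  note l = tensor_lift[OF X Z YZ.star_algebra_axioms b]
  show ?lin "PROP ?val"
    unfolding canonical_left_def by (rule l; assumption)+
qed

lemma canonical_right:
  assumes F: "linear_map X (tensor_alg Z Y) F"
  shows "linear_map (tensor_alg Z X) (tensor_alg Z Y) (canonical_right Z Y F)" (is ?lin)
    and "x \<in> carrier X \<Longrightarrow> z \<in> carrier Z \<Longrightarrow>
      canonical_right Z Y F (tens Z X z x) = tens Z Y z \<one>\<^bsub>Y\<^esub> \<otimes>\<^bsub>tensor_alg Z Y\<^esub> F x" (is "PROP ?val")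
proof -
  have b: "bilinear_map Z X (tensor_alg Z Y) (\<lambda>z x. tens Z Y z \<one>\<^bsub>Y\<^esub> \<otimes>\<^bsub>tensor_alg Z Y\<^esub> F x)"
    by (rule bilinear_map_compose[OF bilinear_mult[OF ZY.star_algebra_axioms]
          bilinear_mapD(2)[OF bilinear_tens[OF Z Y]] F linear_map_ident(1)]) simp
  note l = tensor_lift[OF Z X ZY.star_algebra_axioms b]
  show ?lin "PROP ?val"
    unfolding canonical_right_def by (rule l; assumption)+
qed

lemma canonical_left_right_linear:
  assumes F: "linear_map X (tensor_alg Y Z) F" and U: "U \<in> carrier (tensor_alg X Z)" and z: "z \<in> carrier Z"
  shows "canonical_left Y Z F (U \<otimes>\<^bsub>tensor_alg X Z\<^esub> tens X Z \<one>\<^bsub>X\<^esub> z) =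
    canonical_left Y Z F U \<otimes>\<^bsub>tensor_alg Y Z\<^esub> tens Y Z \<one>\<^bsub>Y\<^esub> z"
proof -
  interpret XZ: star_algebra "tensor_alg X Z" by (rule star_algebra_tensor[OF X Z])
  note c = canonical_left[OF F]
  show ?thesis
    by (rule tensor_linear_eqI[OF X Z linear_map_compose[OF XZ.mult_linear_map(1) c(1)]
          linear_map_compose[OF c(1) YZ.mult_linear_map(1)] _ U])
      (use z linear_mapD(1)[OF F] in \<open>auto simp: tens_mult[OF X Z] tens_mult[OF Y Z] c(2) tens_closed[OF X Z]
        tens_closed[OF Y Z] YZ.m_assoc\<close>)
qed

lemma canonical_right_left_linear:
  assumes F: "linear_map X (tensor_alg Z Y) F" and U: "U \<in> carrier (tensor_alg Z X)" and z: "z \<in> carrier Z"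
  shows "canonical_right Z Y F (tens Z X z \<one>\<^bsub>X\<^esub> \<otimes>\<^bsub>tensor_alg Z X\<^esub> U) =
    tens Z Y z \<one>\<^bsub>Y\<^esub> \<otimes>\<^bsub>tensor_alg Z Y\<^esub> canonical_right Z Y F U"
proof -
  interpret ZX: star_algebra "tensor_alg Z X" by (rule star_algebra_tensor[OF Z X])
  note c = canonical_right[OF F]
  show ?thesis
    by (rule tensor_linear_eqI[OF Z X linear_map_compose[OF ZX.mult_linear_map(2) c(1)]
          linear_map_compose[OF c(1) ZY.mult_linear_map(2)] _ U])
      (use z linear_mapD(1)[OF F] in \<open>auto simp: tens_mult[OF Z X] tens_mult[OF Z Y] c(2) tens_closed[OF Z X]
        tens_closed[OF Z Y] ZY.m_assoc[symmetric]\<close>)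
qed

end

text \<open>
  Both maps commute with right multiplication by \<open>1 \<otimes> z\<close>, so it suffices to go around once starting
  from \<open>x \<otimes> 1\<close>, whose image under the first map is \<open>F x\<close>.
\<close>

lemma canonical_left_inverse:
  assumes X: "star_algebra X" and Y: "star_algebra Y" and Z: "star_algebra Z"
    and F: "linear_map X (tensor_alg Y Z) F" and F': "linear_map Y (tensor_alg X Z) F'"
    and inv: "\<And>x. x \<in> carrier X \<Longrightarrow> canonical_left X Z F' (F x) = tens X Z x \<one>\<^bsub>Z\<^esub>"
    and U: "U \<in> carrier (tensor_alg X Z)"
  shows "canonical_left X Z F' (canonical_left Y Z F U) = U"
proof (rule tensor_linear_eqI[OF X Z linear_map_compose[OF canonical_left(1)[OF X Y Z F]
        canonical_left(1)[OF Y X Z F']] linear_map_ident(1) _ U])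
  interpret X: star_algebra X by (rule X)
  interpret Z: star_algebra Z by (rule Z)
  fix x z assume x: "x \<in> carrier X" and z: "z \<in> carrier Z"
  then show "canonical_left X Z F' (canonical_left Y Z F (tens X Z x z)) = tens X Z x z"
    by (simp add: canonical_left(2)[OF X Y Z F] canonical_left_right_linear[OF Y X Z F'] linear_mapD(1)[OF F]
        inv tens_mult[OF X Z])
qed

lemma canonical_right_inverse:
  assumes X: "star_algebra X" and Y: "star_algebra Y" and Z: "star_algebra Z"
    and F: "linear_map X (tensor_alg Z Y) F" and F': "linear_map Y (tensor_alg Z X) F'"
    and inv: "\<And>x. x \<in> carrier X \<Longrightarrow> canonical_right Z X F' (F x) = tens Z X \<one>\<^bsub>Z\<^esub> x"
    and U: "U \<in> carrier (tensor_alg Z X)"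
  shows "canonical_right Z X F' (canonical_right Z Y F U) = U"
proof (rule tensor_linear_eqI[OF Z X linear_map_compose[OF canonical_right(1)[OF X Y Z F]
        canonical_right(1)[OF Y X Z F']] linear_map_ident(1) _ U])
  interpret X: star_algebra X by (rule X)
  interpret Z: star_algebra Z by (rule Z)
  fix z x assume x: "x \<in> carrier X" and z: "z \<in> carrier Z"
  then show "canonical_right Z X F' (canonical_right Z Y F (tens Z X z x)) = tens Z X z x"
    by (simp add: canonical_right(2)[OF X Y Z F] canonical_right_left_linear[OF Y X Z F'] linear_mapD(1)[OF F]
        inv tens_mult[OF Z X])
qed

text \<open>
  Two linear maps into \<open>Z\<close> whose values will be multiplied, next to a tensor factor \<open>X\<close> that stays
  fixed. In the applications one map is the antipode and the other is the identity.
\<close>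

locale linear_pair =
  X: star_algebra X + P: star_algebra P + R: star_algebra R + Z: star_algebra Z
  for X :: "('x, 'm) star_alg_scheme" and P :: "('p, 'n) star_alg_scheme"
    and R :: "('r, 'k) star_alg_scheme" and Z :: "('z, 'l) star_alg_scheme" +
  fixes g :: "'p \<Rightarrow> 'z" and h :: "'r \<Rightarrow> 'z"
  assumes g: "linear_map P Z g" and h: "linear_map R Z h"
begin

lemmas X = X.star_algebra_axioms and P = P.star_algebra_axioms and R = R.star_algebra_axioms
  and Z = Z.star_algebra_axioms

text \<open>
  The product \<open>(id \<otimes> g)(U) (1 \<otimes> h(r))\<close> arises from \<open>U \<otimes> r\<close> by moving the parentheses and multiplying in
  the last two factors. This is the form to which coassociativity applies.
\<close>

lemma slide_left:
  assumes "U \<in> carrier (tensor_alg X P)" "r \<in> carrier R"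
  shows "tensor_map X Z id (tensor_lift Z (\<lambda>p r. g p \<otimes>\<^bsub>Z\<^esub> h r)) (tensor_assoc X P R (tens (tensor_alg X P) R U r)) =
    tensor_map X Z id g U \<otimes>\<^bsub>tensor_alg X Z\<^esub> tens X Z \<one>\<^bsub>X\<^esub> (h r)"
proof -
  interpret XZ: star_algebra "tensor_alg X Z" by (rule star_algebra_tensor[OF X Z])
  have PR: "star_algebra (tensor_alg P R)" by (rule star_algebra_tensor[OF P R])
  have XP: "star_algebra (tensor_alg X P)" by (rule star_algebra_tensor[OF X P])
  note m = tensor_lift[OF P R Z bilinear_map_compose[OF bilinear_mult[OF Z] g h linear_map_ident(1)]]
  note tm = tensor_map[OF X PR X Z linear_map_ident(2) m(1)]
  note tg = tensor_map[OF X P X Z linear_map_ident(2) g]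
  note hr = linear_mapD(1)[OF h assms(2)]
  show ?thesis
    by (rule tensor_linear_eqI[OF X P linear_map_compose[OF linear_map_compose[OF
            bilinear_mapD(2)[OF bilinear_tens[OF XP R]] tensor_assoc(1)[OF X P R]] tm(1)]
        linear_map_compose[OF tg(1) XZ.mult_linear_map(1)] _ assms(1)])
      (use assms(2) hr linear_mapD(1)[OF g] in \<open>simp_all add: tensor_assoc(2)[OF X P R] tm(2) m(2) tg(2)
         tens_mult[OF X Z] tens_closed[OF P R] tens_closed[OF X Z]\<close>)
qed

text \<open>
  The mirror image of \<open>slide_left\<close>. Here the parentheses have to move in the other direction, so
  the product is written as a function of \<open>R \<otimes> (P \<otimes> X)\<close> and composed with the associator.
\<close>

lemma slide_right:
  shows "V \<in> carrier (tensor_alg (tensor_alg R P) X) \<Longrightarrow> tensor_lift (tensor_alg Z X) (\<lambda>r U. tens Z X (h r) \<one>\<^bsub>X\<^esub> \<otimes>\<^bsub>tensor_alg Z X\<^esub> tensor_map Z X g id U)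
      (tensor_assoc R P X V) = tensor_map Z X (tensor_lift Z (\<lambda>r p. h r \<otimes>\<^bsub>Z\<^esub> g p)) id V"
    and "r \<in> carrier R \<Longrightarrow> U \<in> carrier (tensor_alg P X) \<Longrightarrow> tensor_lift (tensor_alg Z X) (\<lambda>r U. tens Z X (h r) \<one>\<^bsub>X\<^esub> \<otimes>\<^bsub>tensor_alg Z X\<^esub> tensor_map Z X g id U)
      (tens R (tensor_alg P X) r U) = tens Z X (h r) \<one>\<^bsub>X\<^esub> \<otimes>\<^bsub>tensor_alg Z X\<^esub> tensor_map Z X g id U"
    and "linear_map (tensor_alg R (tensor_alg P X)) (tensor_alg Z X)
      (tensor_lift (tensor_alg Z X) (\<lambda>r U. tens Z X (h r) \<one>\<^bsub>X\<^esub> \<otimes>\<^bsub>tensor_alg Z X\<^esub> tensor_map Z X g id U))" (is "linear_map _ _ ?\<Theta>")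
proof -
  interpret ZX: star_algebra "tensor_alg Z X" by (rule star_algebra_tensor[OF Z X])
  note ZX = ZX.star_algebra_axioms
  have RP: "star_algebra (tensor_alg R P)" by (rule star_algebra_tensor[OF R P])
  have PX: "star_algebra (tensor_alg P X)" by (rule star_algebra_tensor[OF P X])
  note m = tensor_lift[OF R P Z bilinear_map_compose[OF bilinear_mult[OF Z] h g linear_map_ident(1)]]
  note tm = tensor_map[OF RP X Z X m(1) linear_map_ident(2)]
  note tg = tensor_map[OF P X Z X g linear_map_ident(2)]
  have b: "bilinear_map R (tensor_alg P X) (tensor_alg Z X)
      (\<lambda>r U. tens Z X (h r) \<one>\<^bsub>X\<^esub> \<otimes>\<^bsub>tensor_alg Z X\<^esub> tensor_map Z X g id U)"
    by (rule bilinear_map_compose[OF bilinear_mult[OF ZX] linear_map_compose[OF h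
            bilinear_mapD(2)[OF bilinear_tens[OF Z X]]] tg(1) linear_map_ident(1)]) simp
  note l = tensor_lift[OF R PX ZX b]
  show "r \<in> carrier R \<Longrightarrow> U \<in> carrier (tensor_alg P X) \<Longrightarrow>
      ?\<Theta> (tens R (tensor_alg P X) r U) = tens Z X (h r) \<one>\<^bsub>X\<^esub> \<otimes>\<^bsub>tensor_alg Z X\<^esub> tensor_map Z X g id U"
    by (rule l(2))
  show "linear_map (tensor_alg R (tensor_alg P X)) (tensor_alg Z X) ?\<Theta>" by (rule l(1))
  show "?\<Theta> (tensor_assoc R P X V) = tensor_map Z X (tensor_lift Z (\<lambda>r p. h r \<otimes>\<^bsub>Z\<^esub> g p)) id V"
    if V: "V \<in> carrier (tensor_alg (tensor_alg R P) X)"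
    by (rule tensor_linear_eqI3[OF R P X linear_map_compose[OF tensor_assoc(1)[OF R P X] l(1)] tm(1) _ V])
      (simp_all add: tensor_assoc(2)[OF R P X] tm(2) m(2) tg(2) l(2) tens_mult[OF Z X]
         tens_closed[OF P X] tens_closed[OF R P] linear_mapD(1)[OF g] linear_mapD(1)[OF h])
qed

end

text \<open>
  When \<open>m \<circ> \<theta>\<close> is scalar-valued, the scalar can be moved to the factor \<open>X\<close>. With \<open>\<theta>\<close> a comultiplication
  and \<open>m\<close> the product with the antipode, this turns an antipode law into a counit.
\<close>

lemma tensor_map_scalar:
  assumes X: "star_algebra X" and W: "star_algebra W" and Q: "star_algebra Q" and Z: "star_algebra Z"
    and \<theta>: "linear_map W Q \<theta>" and m: "linear_map Q Z m" and e: "linear_map W complex_alg e"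
    and eq: "\<And>w. w \<in> carrier W \<Longrightarrow> m (\<theta> w) = e w \<odot>\<^bsub>Z\<^esub> \<one>\<^bsub>Z\<^esub>"
  shows "V \<in> carrier (tensor_alg X W) \<Longrightarrow>
      tensor_map X Z id m (tensor_map X Q id \<theta> V) = tens X Z (tensor_lift X (\<lambda>x w. e w \<odot>\<^bsub>X\<^esub> x) V) \<one>\<^bsub>Z\<^esub>"
    and "V' \<in> carrier (tensor_alg W X) \<Longrightarrow>
      tensor_map Z X m id (tensor_map Q X \<theta> id V') = tens Z X \<one>\<^bsub>Z\<^esub> (tensor_lift X (\<lambda>w x. e w \<odot>\<^bsub>X\<^esub> x) V')"
proof -
  interpret X: star_algebra X by (rule X)
  interpret Z: star_algebra Z by (rule Z)
  note e_lin = linear_mapD(2,3)[OF e, simplified]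
  have b: "bilinear_map X W X (\<lambda>x w. e w \<odot>\<^bsub>X\<^esub> x)" "bilinear_map W X X (\<lambda>w x. e w \<odot>\<^bsub>X\<^esub> x)"
    by (auto intro!: bilinear_mapI simp: e_lin X.smult_rules)
      (simp_all add: X.smult_rules(3)[symmetric] mult.commute)
  note l = tensor_lift[OF X W X b(1)] tensor_lift[OF W X X b(2)]
  note t = tensor_map[OF X W X Q linear_map_ident(2) \<theta>] tensor_map[OF X Q X Z linear_map_ident(2) m]
    tensor_map[OF W X Q X \<theta> linear_map_ident(2)] tensor_map[OF Q X Z X m linear_map_ident(2)]
  note b2 = bilinear_mapD[OF bilinear_tens[OF X Z]] bilinear_mapD[OF bilinear_tens[OF Z X]]
  note s = linear_mapD(3)[OF b2(1)] linear_mapD(3)[OF b2(2)] linear_mapD(3)[OF b2(4)] linear_mapD(3)[OF b2(5)]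
  show "tensor_map X Z id m (tensor_map X Q id \<theta> V) = tens X Z (tensor_lift X (\<lambda>x w. e w \<odot>\<^bsub>X\<^esub> x) V) \<one>\<^bsub>Z\<^esub>"
    if "V \<in> carrier (tensor_alg X W)"
    by (rule tensor_linear_eqI[OF X W linear_map_compose[OF t(1,3)] linear_map_compose[OF l(1) b2(2)] _ that])
      (auto simp: t l eq s linear_mapD(1)[OF \<theta>])
  show "tensor_map Z X m id (tensor_map Q X \<theta> id V') = tens Z X \<one>\<^bsub>Z\<^esub> (tensor_lift X (\<lambda>w x. e w \<odot>\<^bsub>X\<^esub> x) V')"
    if "V' \<in> carrier (tensor_alg W X)"
    by (rule tensor_linear_eqI[OF W X linear_map_compose[OF t(5,7)] linear_map_compose[OF l(3) b2(4)] _ that])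
      (auto simp: t l eq s linear_mapD(1)[OF \<theta>])
qed

lemma tensor_map_id:
  assumes "star_algebra A" "star_algebra B" "X \<in> carrier (tensor_alg A B)"
  shows "tensor_map A B id id X = X"
  using tensor_map[OF assms(1,2,1,2) linear_map_ident(2) linear_map_ident(2)]
  by (intro tensor_linear_eqI[OF assms(1,2) _ linear_map_ident(1) _ assms(3)]) (simp_all del: id_apply, simp)

text \<open>
  The part of a cogroupoid with two objects that the Galois maps involve: \<open>H = Q(1, 1)\<close>,
  \<open>Z = Q(1, 2)\<close>, \<open>Z' = Q(2, 1)\<close> and \<open>K = Q(2, 2)\<close>. The coactions are \<open>\<delta>\<close> and \<open>\<gamma>\<close>, the comultiplications of
  \<open>H\<close> and \<open>K\<close> through the other object are \<open>\<mu>\<close> and \<open>\<nu>\<close>, the counits of \<open>H\<close> and \<open>K\<close> are \<open>\<epsilon>\<close> and \<open>\<eta>\<close>, and \<open>S\<close> is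
  the antipode \<open>Q(2, 1) \<rightarrow> Q(1, 2)\<close>.
\<close>

locale galois_data =
  fixes H :: "'h star_alg" and Z :: "'z star_alg" and Z' :: "'w star_alg" and K :: "'k star_alg"
    and \<Delta>H \<delta> \<mu> \<gamma> \<nu> \<Delta>K S and \<epsilon> \<eta> :: "_ \<Rightarrow> complex"
  assumes H: "star_algebra H" and Z: "star_algebra Z" and Z': "star_algebra Z'" and K: "star_algebra K"
    and \<Delta>H: "linear_map H (tensor_alg H H) \<Delta>H" and \<delta>: "linear_map Z (tensor_alg H Z) \<delta>"
    and \<mu>: "linear_map H (tensor_alg Z Z') \<mu>" and \<gamma>: "linear_map Z (tensor_alg Z K) \<gamma>"
    and \<nu>: "linear_map K (tensor_alg Z' Z) \<nu>" and \<Delta>K: "linear_map K (tensor_alg K K) \<Delta>K"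
    and S: "linear_map Z' Z S" and \<epsilon>: "linear_map H complex_alg \<epsilon>" and \<eta>: "linear_map K complex_alg \<eta>"
    and coassoc_Z: "z \<in> carrier Z \<Longrightarrow> tensor_assoc Z Z' Z (tensor_map (tensor_alg Z Z') Z \<mu> id (\<delta> z)) =
      tensor_map Z (tensor_alg Z' Z) id \<nu> (\<gamma> z)"
    and coassoc_H: "a \<in> carrier H \<Longrightarrow> tensor_assoc H Z Z' (tensor_map (tensor_alg H Z) Z' \<delta> id (\<mu> a)) =
      tensor_map H (tensor_alg Z Z') id \<mu> (\<Delta>H a)"
    and coassoc_K: "b \<in> carrier K \<Longrightarrow> tensor_assoc Z' Z K (tensor_map (tensor_alg Z' Z) K \<nu> id (\<Delta>K b)) =
      tensor_map Z' (tensor_alg Z K) id \<gamma> (\<nu> b)"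
    and antipode_K: "b \<in> carrier K \<Longrightarrow> tensor_lift Z (\<lambda>a b. S a \<otimes>\<^bsub>Z\<^esub> b) (\<nu> b) = \<eta> b \<odot>\<^bsub>Z\<^esub> \<one>\<^bsub>Z\<^esub>"
    and antipode_H: "a \<in> carrier H \<Longrightarrow> tensor_lift Z (\<lambda>a b. a \<otimes>\<^bsub>Z\<^esub> S b) (\<mu> a) = \<epsilon> a \<odot>\<^bsub>Z\<^esub> \<one>\<^bsub>Z\<^esub>"
    and counit_\<gamma>: "z \<in> carrier Z \<Longrightarrow> tensor_lift Z (\<lambda>z b. \<eta> b \<odot>\<^bsub>Z\<^esub> z) (\<gamma> z) = z"
    and counit_\<delta>: "z \<in> carrier Z \<Longrightarrow> tensor_lift Z (\<lambda>a z. \<epsilon> a \<odot>\<^bsub>Z\<^esub> z) (\<delta> z) = z"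
    and counit_H: "a \<in> carrier H \<Longrightarrow> tensor_lift H (\<lambda>a b. \<epsilon> b \<odot>\<^bsub>H\<^esub> a) (\<Delta>H a) = a"
    and counit_K: "b \<in> carrier K \<Longrightarrow> tensor_lift K (\<lambda>a b. \<eta> a \<odot>\<^bsub>K\<^esub> b) (\<Delta>K b) = b"
begin

lemmas tensor_star_algebras = star_algebra_tensor[OF H Z] star_algebra_tensor[OF Z Z]
  star_algebra_tensor[OF Z Z'] star_algebra_tensor[OF Z K] star_algebra_tensor[OF Z' Z]

text \<open>
  The inverse is \<open>a \<otimes> z \<mapsto> a\<^sub>1 \<otimes> S(a\<^sub>2) z\<close> with \<open>\<mu>(a) = a\<^sub>1 \<otimes> a\<^sub>2\<close>. In both composites coassociativity
  brings \<open>S\<close> next to its partner, an antipode law replaces the pair by a counit, and the counit law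
  removes it.
\<close>

lemma galois_left_bij:
  "bij_betw (galois_left H Z \<delta>) (carrier (tensor_alg Z Z)) (carrier (tensor_alg H Z))"
proof -
  interpret H: star_algebra H by (rule H)
  interpret Z: star_algebra Z by (rule Z)
  define F where "F a = tensor_map Z Z id S (\<mu> a)" for a
  note ts = tensor_star_algebras
  note tS = tensor_map[OF Z Z' Z Z linear_map_ident(2) S]
  have F: "linear_map H (tensor_alg Z Z) F"
    unfolding F_def by (rule linear_map_compose[OF \<mu> tS(1)])
  have 1: "canonical_left Z Z F (\<delta> z) = tens Z Z z \<one>\<^bsub>Z\<^esub>" if z: "z \<in> carrier Z" for z
  proof -
    interpret linear_pair Z Z' Z Z S id
      by (intro linear_pair.intro linear_pair_axioms.intro Z Z' S linear_map_ident)
    note m = tensor_lift[OF Z' Z Z bilinear_map_compose[OF bilinear_mult[OF Z] S linear_map_ident(1) linear_map_ident(1)]]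
    note tm = tensor_map[OF Z ts(5) Z Z linear_map_ident(2) m(1)]
    note t\<mu> = tensor_map[OF H Z ts(3) Z \<mu> linear_map_ident(2)]
    have "canonical_left Z Z F (\<delta> z) = tensor_map Z Z id (tensor_lift Z (\<lambda>y w. S y \<otimes>\<^bsub>Z\<^esub> w))
      (tensor_assoc Z Z' Z (tensor_map (tensor_alg Z Z') Z \<mu> id (\<delta> z)))"
      by (rule tensor_linear_eqI[OF H Z canonical_left(1)[OF H Z Z F]
            linear_map_compose[OF linear_map_compose[OF t\<mu>(1) tensor_assoc(1)[OF Z Z' Z]] tm(1)]
            _ linear_mapD(1)[OF \<delta> z]])
        (simp add: canonical_left(2)[OF H Z Z F] t\<mu>(2) slide_left[simplified] linear_mapD(1)[OF \<mu>] F_def)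
    also have "\<dots> = tens Z Z z \<one>\<^bsub>Z\<^esub>"
      unfolding coassoc_Z[OF z]
      by (subst tensor_map_scalar(1)[OF Z K ts(5) Z \<nu> m(1) \<eta>])
        (simp_all add: antipode_K counit_\<gamma> z linear_mapD(1)[OF \<gamma>])
    finally show ?thesis .
  qed
  have 2: "canonical_left H Z \<delta> (F a) = tens H Z a \<one>\<^bsub>Z\<^esub>" if a: "a \<in> carrier H" for a
  proof -
    interpret linear_pair H Z Z' Z id S
      by (intro linear_pair.intro linear_pair_axioms.intro H Z Z' S linear_map_ident)
    note m = tensor_lift[OF Z Z' Z bilinear_map_compose[OF bilinear_mult[OF Z] linear_map_ident(1) S linear_map_ident(1)]]
    note tm = tensor_map[OF H ts(3) H Z linear_map_ident(2) m(1)]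
    note t\<delta> = tensor_map[OF Z Z' ts(1) Z' \<delta> linear_map_ident(2)]
    have "canonical_left H Z \<delta> (F a) = tensor_map H Z id (tensor_lift Z (\<lambda>x y. x \<otimes>\<^bsub>Z\<^esub> S y))
      (tensor_assoc H Z Z' (tensor_map (tensor_alg H Z) Z' \<delta> id (\<mu> a)))"
      unfolding F_def
      by (rule tensor_linear_eqI[OF Z Z' linear_map_compose[OF tS(1) canonical_left(1)[OF Z H Z \<delta>]]
            linear_map_compose[OF linear_map_compose[OF t\<delta>(1) tensor_assoc(1)[OF H Z Z']] tm(1)]
            _ linear_mapD(1)[OF \<mu> a]])
        (simp add: canonical_left(2)[OF Z H Z \<delta>] t\<delta>(2) tS(2) slide_left[simplified] linear_mapD(1)[OF \<delta>]
           linear_mapD(1)[OF S] tensor_map_id[OF H Z])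
    also have "\<dots> = tens H Z a \<one>\<^bsub>Z\<^esub>"
      unfolding coassoc_H[OF a]
      by (subst tensor_map_scalar(1)[OF H H ts(3) Z \<mu> m(1) \<epsilon>])
        (simp_all add: antipode_H counit_H a linear_mapD(1)[OF \<Delta>H])
    finally show ?thesis .
  qed
  show ?thesis
    unfolding galois_left_eq
  proof (rule bij_betwI[where g = "canonical_left Z Z F"])
    show "canonical_left Z Z F (canonical_left H Z \<delta> U) = U" if "U \<in> carrier (tensor_alg Z Z)" for U
      by (rule canonical_left_inverse[OF Z H Z \<delta> F 1 that])
    show "canonical_left H Z \<delta> (canonical_left Z Z F U) = U" if "U \<in> carrier (tensor_alg H Z)" for U
      by (rule canonical_left_inverse[OF H Z Z F \<delta> 2 that])
  qed (use linear_mapD(1)[OF canonical_left(1)[OF Z H Z \<delta>]] linear_mapD(1)[OF canonical_left(1)[OF H Z Z F]] in auto)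
qed

text \<open>
  The inverse is \<open>z \<otimes> b \<mapsto> z S(b\<^sub>1) \<otimes> b\<^sub>2\<close> with \<open>\<nu>(b) = b\<^sub>1 \<otimes> b\<^sub>2\<close>.
\<close>

lemma galois_right_bij:
  "bij_betw (galois_right Z K \<gamma>) (carrier (tensor_alg Z Z)) (carrier (tensor_alg Z K))"
proof -
  interpret K: star_algebra K by (rule K)
  interpret Z: star_algebra Z by (rule Z)
  define F where "F b = tensor_map Z Z S id (\<nu> b)" for b
  note ts = tensor_star_algebras
  note tS = tensor_map[OF Z' Z Z Z S linear_map_ident(2)]
  have F: "linear_map K (tensor_alg Z Z) F"
    unfolding F_def by (rule linear_map_compose[OF \<nu> tS(1)])
  have 1: "canonical_right Z Z F (\<gamma> z) = tens Z Z \<one>\<^bsub>Z\<^esub> z" if z: "z \<in> carrier Z" for z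
  proof -
    interpret linear_pair Z Z' Z Z S id
      by (intro linear_pair.intro linear_pair_axioms.intro Z Z' S linear_map_ident)
    let ?\<Theta> = "tensor_lift (tensor_alg Z Z) (\<lambda>r U. tens Z Z (id r) \<one>\<^bsub>Z\<^esub> \<otimes>\<^bsub>tensor_alg Z Z\<^esub> tensor_map Z Z S id U)"
    note m = tensor_lift[OF Z Z' Z bilinear_map_compose[OF bilinear_mult[OF Z] linear_map_ident(1) S linear_map_ident(1)]]
    note t\<mu> = tensor_map[OF H Z ts(3) Z \<mu> linear_map_ident(2)]
    note t\<nu> = tensor_map[OF Z K Z ts(5) linear_map_ident(2) \<nu>]
    have "canonical_right Z Z F (\<gamma> z) = ?\<Theta> (tensor_map Z (tensor_alg Z' Z) id \<nu> (\<gamma> z))"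
      by (rule tensor_linear_eqI[OF Z K canonical_right(1)[OF K Z Z F]
            linear_map_compose[OF t\<nu>(1) slide_right(3)] _ linear_mapD(1)[OF \<gamma> z]])
        (simp add: canonical_right(2)[OF K Z Z F] t\<nu>(2) slide_right(2)[simplified] linear_mapD(1)[OF \<nu>] F_def)
    also have "\<dots> = tensor_map Z Z (tensor_lift Z (\<lambda>r p. r \<otimes>\<^bsub>Z\<^esub> S p)) id (tensor_map (tensor_alg Z Z') Z \<mu> id (\<delta> z))"
      unfolding coassoc_Z[OF z, symmetric]
      using slide_right(1)[of "tensor_map (tensor_alg Z Z') Z \<mu> id (\<delta> z)"]
      by (simp add: linear_mapD(1)[OF \<delta>] linear_mapD(1)[OF t\<mu>(1)] z)
    also have "\<dots> = tens Z Z \<one>\<^bsub>Z\<^esub> z"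
      by (subst tensor_map_scalar(2)[OF Z H ts(3) Z \<mu> m(1) \<epsilon>])
        (simp_all add: antipode_H counit_\<delta> z linear_mapD(1)[OF \<delta>])
    finally show ?thesis .
  qed
  have 2: "canonical_right Z K \<gamma> (F b) = tens Z K \<one>\<^bsub>Z\<^esub> b" if b: "b \<in> carrier K" for b
  proof -
    interpret linear_pair K Z Z' Z id S
      by (intro linear_pair.intro linear_pair_axioms.intro K Z Z' S linear_map_ident)
    let ?\<Theta> = "tensor_lift (tensor_alg Z K) (\<lambda>r U. tens Z K (S r) \<one>\<^bsub>K\<^esub> \<otimes>\<^bsub>tensor_alg Z K\<^esub> tensor_map Z K id id U)"
    note m = tensor_lift[OF Z' Z Z bilinear_map_compose[OF bilinear_mult[OF Z] S linear_map_ident(1) linear_map_ident(1)]]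
    note t\<nu> = tensor_map[OF K K ts(5) K \<nu> linear_map_ident(2)]
    note t\<gamma> = tensor_map[OF Z' Z Z' ts(4) linear_map_ident(2) \<gamma>]
    have "canonical_right Z K \<gamma> (F b) = ?\<Theta> (tensor_map Z' (tensor_alg Z K) id \<gamma> (\<nu> b))"
      unfolding F_def
      by (rule tensor_linear_eqI[OF Z' Z linear_map_compose[OF tS(1) canonical_right(1)[OF Z K Z \<gamma>]]
            linear_map_compose[OF t\<gamma>(1) slide_right(3)] _ linear_mapD(1)[OF \<nu> b]])
        (simp add: canonical_right(2)[OF Z K Z \<gamma>] t\<gamma>(2) tS(2) slide_right(2)[simplified] linear_mapD(1)[OF \<gamma>]
           linear_mapD(1)[OF S] tensor_map_id[OF Z K])
    also have "\<dots> = tensor_map Z K (tensor_lift Z (\<lambda>r p. S r \<otimes>\<^bsub>Z\<^esub> p)) id (tensor_map (tensor_alg Z' Z) K \<nu> id (\<Delta>K b))"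
      unfolding coassoc_K[OF b, symmetric]
      using slide_right(1)[of "tensor_map (tensor_alg Z' Z) K \<nu> id (\<Delta>K b)"]
      by (simp add: linear_mapD(1)[OF \<Delta>K] linear_mapD(1)[OF t\<nu>(1)] b)
    also have "\<dots> = tens Z K \<one>\<^bsub>Z\<^esub> b"
      by (subst tensor_map_scalar(2)[OF K K ts(5) Z \<nu> m(1) \<eta>])
        (simp_all add: antipode_K counit_K b linear_mapD(1)[OF \<Delta>K])
    finally show ?thesis .
  qed
  show ?thesis
    unfolding galois_right_eq
  proof (rule bij_betwI[where g = "canonical_right Z Z F"])
    show "canonical_right Z Z F (canonical_right Z K \<gamma> U) = U" if "U \<in> carrier (tensor_alg Z Z)" for U
      by (rule canonical_right_inverse[OF Z K Z \<gamma> F 1 that])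
    show "canonical_right Z K \<gamma> (canonical_right Z Z F U) = U" if "U \<in> carrier (tensor_alg Z K)" for U
      by (rule canonical_right_inverse[OF K Z Z F \<gamma> 2 that])
  qed (use linear_mapD(1)[OF canonical_right(1)[OF Z K Z \<gamma>]] linear_mapD(1)[OF canonical_right(1)[OF K Z Z F]] in auto)
qed

end

section \<open>Magic unitaries and no-signalling relations\<close>

definition magic_unitary ::
  "('c, 'm) star_alg_scheme \<Rightarrow> ('i::finite \<Rightarrow> 'j::finite \<Rightarrow> 'c) \<Rightarrow> bool" where
  "magic_unitary A p \<longleftrightarrow>
     (\<forall>i j. p i j \<in> carrier A) \<and> (\<forall>i j. star A (p i j) = p i j) \<and> (\<forall>i j. p i j \<otimes>\<^bsub>A\<^esub> p i j = p i j) \<and>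
     (\<forall>i. (\<Oplus>\<^bsub>A\<^esub>j\<in>UNIV. p i j) = \<one>\<^bsub>A\<^esub>) \<and> (\<forall>j. (\<Oplus>\<^bsub>A\<^esub>i\<in>UNIV. p i j) = \<one>\<^bsub>A\<^esub>) \<and>
     (\<forall>i j j'. j \<noteq> j' \<longrightarrow> p i j \<otimes>\<^bsub>A\<^esub> p i j' = \<zero>\<^bsub>A\<^esub>) \<and> (\<forall>i i' j. i \<noteq> i' \<longrightarrow> p i j \<otimes>\<^bsub>A\<^esub> p i' j = \<zero>\<^bsub>A\<^esub>)"

definition intertwines ::
  "('c, 'm) star_alg_scheme \<Rightarrow> ('u1 \<Rightarrow> 'w1 \<Rightarrow> complex) \<Rightarrow> ('u2 \<Rightarrow> 'w2 \<Rightarrow> complex) \<Rightarrow>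
   ('u1::finite \<Rightarrow> 'u2::finite \<Rightarrow> 'c) \<Rightarrow> ('w1::finite \<Rightarrow> 'w2::finite \<Rightarrow> 'c) \<Rightarrow> bool" where
  "intertwines A L1 L2 pU pW \<longleftrightarrow>
     (\<forall>i j. (\<Oplus>\<^bsub>A\<^esub>\<omega>\<in>UNIV. L1 i \<omega> \<odot>\<^bsub>A\<^esub> pW \<omega> j) = (\<Oplus>\<^bsub>A\<^esub>\<kappa>\<in>UNIV. L2 \<kappa> j \<odot>\<^bsub>A\<^esub> pU i \<kappa>))"

text \<open>
  The relations imposed on the block of questions; those on the block of answers are the same
  relations for the transposed matrix.
\<close>

definition column_no_signalling ::
  "('c, 'm) star_alg_scheme \<Rightarrow> ('s1::finite \<times> 't1::finite \<Rightarrow> 's2 \<times> 't2 \<Rightarrow> 'c) \<Rightarrow> bool" where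
  "column_no_signalling A p \<longleftrightarrow>
     (\<forall>t1 s2 s2' t2. (\<Oplus>\<^bsub>A\<^esub>s1\<in>UNIV. p (s1, t1) (s2, t2)) = (\<Oplus>\<^bsub>A\<^esub>s1\<in>UNIV. p (s1, t1) (s2', t2))) \<and>
     (\<forall>s1 s2 t2 t2'. (\<Oplus>\<^bsub>A\<^esub>t1\<in>UNIV. p (s1, t1) (s2, t2)) = (\<Oplus>\<^bsub>A\<^esub>t1\<in>UNIV. p (s1, t1) (s2, t2')))"

abbreviation (input) transposed :: "('i \<Rightarrow> 'j \<Rightarrow> 'c) \<Rightarrow> 'j \<Rightarrow> 'i \<Rightarrow> 'c" where
  "transposed p \<equiv> \<lambda>i j. p j i"

lemma magic_unitaryD:
  assumes "magic_unitary A p"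
  shows "p i j \<in> carrier A" "star A (p i j) = p i j" "p i j \<otimes>\<^bsub>A\<^esub> p i j = p i j"
    "(\<Oplus>\<^bsub>A\<^esub>j\<in>UNIV. p i j) = \<one>\<^bsub>A\<^esub>" "(\<Oplus>\<^bsub>A\<^esub>i\<in>UNIV. p i j) = \<one>\<^bsub>A\<^esub>"
    "j \<noteq> j' \<Longrightarrow> p i j \<otimes>\<^bsub>A\<^esub> p i j' = \<zero>\<^bsub>A\<^esub>" "i \<noteq> i' \<Longrightarrow> p i j \<otimes>\<^bsub>A\<^esub> p i' j = \<zero>\<^bsub>A\<^esub>"
  using assms unfolding magic_unitary_def by blast+

lemma magic_unitary_transposed:
  assumes "magic_unitary A p"
  shows "magic_unitary A (transposed p)"
  using magic_unitaryD[OF assms] by (simp add: magic_unitary_def)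

lemma intertwinesD:
  "intertwines A L1 L2 pU pW \<Longrightarrow>
     (\<Oplus>\<^bsub>A\<^esub>\<omega>\<in>UNIV. L1 i \<omega> \<odot>\<^bsub>A\<^esub> pW \<omega> j) = (\<Oplus>\<^bsub>A\<^esub>\<kappa>\<in>UNIV. L2 \<kappa> j \<odot>\<^bsub>A\<^esub> pU i \<kappa>)"
  by (simp add: intertwines_def)

lemma column_no_signallingD:
  assumes "column_no_signalling A p"
  shows "(\<Oplus>\<^bsub>A\<^esub>s1\<in>UNIV. p (s1, t1) (s2, t2)) = (\<Oplus>\<^bsub>A\<^esub>s1\<in>UNIV. p (s1, t1) (s2', t2))"
    "(\<Oplus>\<^bsub>A\<^esub>t1\<in>UNIV. p (s1, t1) (s2, t2)) = (\<Oplus>\<^bsub>A\<^esub>t1\<in>UNIV. p (s1, t1) (s2, t2'))"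
  using assms unfolding column_no_signalling_def by blast+

subsection \<open>Relators\<close>

context
  fixes A :: "('a, 'm) star_alg_scheme" (structure)
  assumes A: "star_algebra A"
begin

interpretation A: star_algebra A by (rule A)

lemma Collect_subset_singleton_iff:
  "{f i j | i j. True} \<subseteq> {z} \<longleftrightarrow> (\<forall>i j. f i j = z)"
  "{h i | i. True} \<subseteq> {z} \<longleftrightarrow> (\<forall>i. h i = z)"
  "{k i j l | i j l. Q i j l} \<subseteq> {z} \<longleftrightarrow> (\<forall>i j l. Q i j l \<longrightarrow> k i j l = z)"
  by blast+

lemma magic_relators_zero_iff:
  assumes "\<And>i j. p i j \<in> carrier A"
  shows "magic_relators A p \<subseteq> {\<zero>} \<longleftrightarrow> magic_unitary A p"
proof -
  have *: "(\<forall>i j. p i j = star A (p i j)) = (\<forall>i j. star A (p i j) = p i j)"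
    "(\<forall>i j. p i j = p i j \<otimes> p i j) = (\<forall>i j. p i j \<otimes> p i j = p i j)" by metis+
  show ?thesis
    unfolding magic_relators_def Un_subset_iff Collect_subset_singleton_iff magic_unitary_def
    by (simp add: assms A.minus_eq_zero_iff A.finsum_closed Pi_def *)
qed

lemma intertwining_relators_zero_iff:
  assumes "\<And>i j. pU i j \<in> carrier A" "\<And>i j. pW i j \<in> carrier A"
  shows "intertwining_relators A L1 L2 pU pW \<subseteq> {\<zero>} \<longleftrightarrow> intertwines A L1 L2 pU pW"
  unfolding intertwining_relators_def Collect_subset_singleton_iff intertwines_def
  by (simp add: assms A.minus_eq_zero_iff A.finsum_closed Pi_def)

lemma indep_relators_zero_iff:
  assumes "\<And>i. f i \<in> carrier A"
  shows "indep_relators A f \<subseteq> {\<zero>} \<longleftrightarrow> (\<forall>i j. f i = f j)"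
  unfolding indep_relators_def Collect_subset_singleton_iff
  by (simp add: assms A.minus_eq_zero_iff)

lemma relators_closed:
  "(\<And>i j. p i j \<in> carrier A) \<Longrightarrow> magic_relators A p \<subseteq> carrier A"
  "(\<And>i j. pU i j \<in> carrier A) \<Longrightarrow> (\<And>i j. pW i j \<in> carrier A) \<Longrightarrow> intertwining_relators A L1 L2 pU pW \<subseteq> carrier A"
  "(\<And>i. f i \<in> carrier A) \<Longrightarrow> indep_relators A f \<subseteq> carrier A"
  unfolding magic_relators_def intertwining_relators_def indep_relators_def
  by (auto intro!: A.minus_closed A.finsum_closed)

context
  fixes B :: "('b, 'n) star_alg_scheme" and f
  assumes B: "star_algebra B" and f: "star_hom A B f"
begin

lemma relators_image:
  "(\<And>i j. p i j \<in> carrier A) \<Longrightarrow> f ` magic_relators A p = magic_relators B (\<lambda>i j. f (p i j))"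
  "(\<And>i j. pU i j \<in> carrier A) \<Longrightarrow> (\<And>i j. pW i j \<in> carrier A) \<Longrightarrow>
    f ` intertwining_relators A L1 L2 pU pW =
      intertwining_relators B L1 L2 (\<lambda>i j. f (pU i j)) (\<lambda>i j. f (pW i j))"
  "(\<And>i. g i \<in> carrier A) \<Longrightarrow> f ` indep_relators A g = indep_relators B (\<lambda>i. f (g i))"
proof -
  note f' = star_homD[OF f]
  note d = linear_map_diff[OF A B f'(1)] and s = linear_map_finsum[OF A B f'(1)]
  have *: "f ` {g i j | i j. True} = {f (g i j) | i j. True}" "f ` {h i | i. True} = {f (h i) | i. True}"
    "f ` {k i j l | i j l. Q i j l} = {f (k i j l) | i j l. Q i j l}"
    for g :: "'x \<Rightarrow> 'y \<Rightarrow> 'a" and h :: "'z \<Rightarrow> 'a" and k :: "'r \<Rightarrow> 's \<Rightarrow> 't \<Rightarrow> 'a" and Q by blast+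
  show "f ` magic_relators A p = magic_relators B (\<lambda>i j. f (p i j))" if p: "\<And>i j. p i j \<in> carrier A"
    unfolding magic_relators_def image_Un * by (simp add: p f' d s Pi_def A.finsum_closed)
  show "f ` intertwining_relators A L1 L2 pU pW =
      intertwining_relators B L1 L2 (\<lambda>i j. f (pU i j)) (\<lambda>i j. f (pW i j))"
    if p: "\<And>i j. pU i j \<in> carrier A" "\<And>i j. pW i j \<in> carrier A"
    unfolding intertwining_relators_def * by (simp add: p f' d s Pi_def A.finsum_closed)
  show "f ` indep_relators A g = indep_relators B (\<lambda>i. f (g i))" if g: "\<And>i. g i \<in> carrier A"
    unfolding indep_relators_def * by (simp add: g d)
qed

lemma star_hom_magic_unitary:
  assumes p: "magic_unitary A p"
  shows "magic_unitary B (\<lambda>i j. f (p i j))"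
proof -
  note f' = star_homD[OF f]
  note [simp] = magic_unitaryD[OF p] f'(2) f'(3,6,7)[symmetric]
    linear_map_zero[OF A B f'(1), symmetric] linear_map_finsum[OF A B f'(1), of UNIV, symmetric]
  show ?thesis unfolding magic_unitary_def
    by (intro conjI allI impI) (simp_all add: Pi_def)
qed

lemma star_hom_intertwines:
  assumes "\<And>i j. pU i j \<in> carrier A" "\<And>i j. pW i j \<in> carrier A" "intertwines A L1 L2 pU pW"
  shows "intertwines B L1 L2 (\<lambda>i j. f (pU i j)) (\<lambda>i j. f (pW i j))"
  using assms(3) unfolding intertwines_def
  by (simp add: star_homD(5)[OF f, symmetric] assms(1,2)
    linear_map_finsum[OF A B star_homD(1)[OF f], of UNIV, symmetric])

end

subsection \<open>Column relations imply row relations\<close>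

lemma finsum_constant: "finite S \<Longrightarrow> x \<in> carrier A \<Longrightarrow> (\<Oplus>i\<in>S. x) = of_nat (card S) \<odot> x"
  by (induction S rule: finite_induct) (auto simp: A.smult_rules A.finsum_insert Pi_def)

lemma finsum_mult_finsum:
  assumes "finite S" "finite T" "\<And>i. i \<in> S \<Longrightarrow> f i \<in> carrier A" "\<And>j. j \<in> T \<Longrightarrow> g j \<in> carrier A"
  shows "(\<Oplus>i\<in>S. f i) \<otimes> (\<Oplus>j\<in>T. g j) = (\<Oplus>i\<in>S. \<Oplus>j\<in>T. f i \<otimes> g j)"
  using assms by (subst A.finsum_ldistr) (auto intro!: A.finsum_cong' A.finsum_closed simp: A.finsum_rdistr)

text \<open>
  All products of an entry of the first sum with an entry of the second vanish by orthogonality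
  within the column \<open>j\<close>, except the square of the common entry.
\<close>

lemma magic_unitary_factorization:
  fixes p :: "'s1::finite \<times> 't1::finite \<Rightarrow> 's2::finite \<times> 't2::finite \<Rightarrow> 'a"
  assumes p: "magic_unitary A p"
  shows "(\<Oplus>s\<in>UNIV. p (s, t1) j) \<otimes> (\<Oplus>t\<in>UNIV. p (s1, t) j) = p (s1, t1) j"
proof -
  note [simp] = magic_unitaryD(1,3)[OF p] and orth = magic_unitaryD(7)[OF p]
  have "(\<Oplus>s\<in>UNIV. p (s, t1) j) \<otimes> (\<Oplus>t\<in>UNIV. p (s1, t) j) =
    (\<Oplus>s\<in>UNIV. \<Oplus>t\<in>UNIV. p (s, t1) j \<otimes> p (s1, t) j)"
    by (subst finsum_mult_finsum) auto
  also have "\<dots> = (\<Oplus>t\<in>UNIV. p (s1, t1) j \<otimes> p (s1, t) j)"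
    by (rule A.finsum_single) (auto intro!: A.finsum_closed simp: orth)
  also have "\<dots> = p (s1, t1) j"
    by (subst A.finsum_single[where i = t1]) (auto simp: orth)
  finally show ?thesis .
qed

lemma magic_unitary_swap:
  fixes p :: "'s1::finite \<times> 't1::finite \<Rightarrow> 's2::finite \<times> 't2::finite \<Rightarrow> 'a"
  assumes p: "magic_unitary A p"
  shows "magic_unitary A (\<lambda>i j. p (prod.swap i) (prod.swap j))"
proof -
  have "(\<Oplus>i\<in>UNIV. f (prod.swap i)) = (\<Oplus>i\<in>UNIV. f i)" if "\<And>x. f x \<in> carrier A"
    for f :: "'u::finite \<times> 'v::finite \<Rightarrow> 'a"
    using A.finsum_reindex[of f prod.swap "UNIV :: ('v \<times> 'u) set"] that by (simp add: surj_swap)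
  note swap = this[of "p (prod.swap _)"] this[of "\<lambda>i. p i (prod.swap _)"]
  have inj: "prod.swap a = prod.swap b \<longleftrightarrow> a = b" for a b :: "'x \<times> 'y"
    by (cases a; cases b) auto
  show ?thesis
    unfolding magic_unitary_def
    by (intro conjI allI impI) (simp_all add: magic_unitaryD[OF p] swap inj)
qed

text \<open>
  By the factorization, \<open>p (s1, t1) (s2, t2) = P \<otimes> R\<close>, where \<open>P\<close> is the sum over the first row
  coordinate and \<open>R\<close> the sum over the second. As \<open>P\<close> does not depend on \<open>s2\<close>, summing over \<open>s2\<close> gives
  \<open>P \<otimes> T\<close>, where \<open>T\<close> is the sum of \<open>R\<close> over \<open>s2\<close>. As \<open>R\<close> does not depend on \<open>t2\<close>, neither does \<open>T\<close>; summing
  \<open>T\<close> over \<open>t2\<close> adds up entire rows, which shows that \<open>T\<close> is a scalar.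
\<close>

lemma column_sums_imp_row_sums:
  fixes p :: "'s1::finite \<times> 't1::finite \<Rightarrow> 's2::finite \<times> 't2::finite \<Rightarrow> 'a"
  assumes p: "magic_unitary A p" and ns: "column_no_signalling A p"
  shows "(\<Oplus>s2\<in>UNIV. p (s1, t1) (s2, t2)) = (\<Oplus>s2\<in>UNIV. p (s1', t1) (s2, t2))"
proof -
  note [simp] = magic_unitaryD(1)[OF p]
  define c where "c = of_nat (card (UNIV :: 't1 set)) / (of_nat (card (UNIV :: 't2 set)) :: complex)"
  \<comment> \<open>\<open>undefined\<close> stands for an arbitrary value of \<open>s2\<close>, on which the sum does not depend\<close>
  define P where "P = (\<Oplus>s\<in>UNIV. p (s, t1) (undefined, t2))"
  have [simp]: "P \<in> carrier A" by (simp add: P_def Pi_def)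
  have "(\<Oplus>s2\<in>UNIV. p (s1, t1) (s2, t2)) = c \<odot> P" for s1
  proof -
    define T where "T = (\<Oplus>s2\<in>UNIV. \<Oplus>t\<in>UNIV. p (s1, t) (s2, t2))"
    have [simp]: "T \<in> carrier A" by (simp add: T_def Pi_def)
    have "of_nat (card (UNIV :: 't2 set)) \<odot> T = (\<Oplus>t2'\<in>(UNIV::'t2 set). T)"
      by (simp add: finsum_constant)
    also have "\<dots> = (\<Oplus>t2'\<in>UNIV. \<Oplus>s2\<in>UNIV. \<Oplus>t\<in>UNIV. p (s1, t) (s2, t2'))"
      unfolding T_def by (intro A.finsum_cong' column_no_signallingD(2)[OF ns]) (auto simp: Pi_def)
    also have "\<dots> = (\<Oplus>j\<in>UNIV. \<Oplus>t\<in>UNIV. p (s1, t) j)"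
      by (subst A.finsum_UNIV_prod(2)) (auto simp: Pi_def)
    also have "\<dots> = (\<Oplus>t\<in>UNIV. \<Oplus>j\<in>UNIV. p (s1, t) j)"
      by (rule A.finsum_swap) auto
    also have "\<dots> = of_nat (card (UNIV :: 't1 set)) \<odot> \<one>"
      by (simp add: magic_unitaryD(4)[OF p] finsum_constant)
    finally have "(1 / of_nat (card (UNIV :: 't2 set))) \<odot> (of_nat (card (UNIV :: 't2 set)) \<odot> T) =
      (1 / of_nat (card (UNIV :: 't2 set))) \<odot> (of_nat (card (UNIV :: 't1 set)) \<odot> \<one>)" by simp
    then have T: "T = c \<odot> \<one>"
      by (simp add: A.smult_rules(3)[symmetric] c_def) (simp add: A.smult_rules)
    have "(\<Oplus>s2\<in>UNIV. p (s1, t1) (s2, t2)) = (\<Oplus>s2\<in>UNIV. P \<otimes> (\<Oplus>t\<in>UNIV. p (s1, t) (s2, t2)))"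
    proof (intro A.finsum_cong' refl)
      fix s2
      have "P = (\<Oplus>s\<in>UNIV. p (s, t1) (s2, t2))"
        unfolding P_def by (rule column_no_signallingD(1)[OF ns])
      then show "p (s1, t1) (s2, t2) = P \<otimes> (\<Oplus>t\<in>UNIV. p (s1, t) (s2, t2))"
        by (simp add: magic_unitary_factorization[OF p])
    qed (auto simp: Pi_def)
    also have "\<dots> = P \<otimes> T"
      unfolding T_def by (subst A.finsum_rdistr) (auto simp: Pi_def)
    also have "\<dots> = c \<odot> P"
      by (simp add: T A.smult_mult_right)
    finally show ?thesis .
  qed
  then show ?thesis by metis
qed

text \<open>
  One half is the previous lemma, the other half is the previous lemma with the two coordinates of
  each index exchanged.
\<close>

lemma column_no_signalling_transposed:
  fixes p :: "'s1::finite \<times> 't1::finite \<Rightarrow> 's2::finite \<times> 't2::finite \<Rightarrow> 'a"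
  assumes p: "magic_unitary A p" and ns: "column_no_signalling A p"
  shows "column_no_signalling A (transposed p)"
proof -
  have "column_no_signalling A (\<lambda>i j. p (prod.swap i) (prod.swap j))"
    using ns by (simp add: column_no_signalling_def)
  from column_sums_imp_row_sums[OF magic_unitary_swap[OF p] this] column_sums_imp_row_sums[OF p ns]
  show ?thesis by (simp add: column_no_signalling_def)
qed

text \<open>
  Multiplying the relation at \<open>(\<kappa>, \<omega>)\<close> by \<open>pU \<kappa> i\<close> on the left and by \<open>pW j \<omega>\<close> on the right isolates one
  coefficient on each side; summing over \<open>\<kappa>\<close> and \<open>\<omega>\<close> gives the relation for the transposed matrices.
\<close>

lemma intertwines_transposed:
  assumes pU: "magic_unitary A pU" and pW: "magic_unitary A pW" and i: "intertwines A L1 L2 pU pW"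
  shows "intertwines A L2 L1 (transposed pU) (transposed pW)"
  unfolding intertwines_def
proof (intro allI)
  fix i j
  note [simp] = magic_unitaryD(1,3)[OF pU] magic_unitaryD(1,3)[OF pW]
  have eq: "L1 \<kappa> j \<odot> (pU \<kappa> i \<otimes> pW j \<omega>) = L2 i \<omega> \<odot> (pU \<kappa> i \<otimes> pW j \<omega>)" for \<kappa> \<omega>
  proof -
    have "pU \<kappa> i \<otimes> ((\<Oplus>\<omega>'\<in>UNIV. L1 \<kappa> \<omega>' \<odot> pW \<omega>' \<omega>) \<otimes> pW j \<omega>) =
      pU \<kappa> i \<otimes> (\<Oplus>\<omega>'\<in>UNIV. (L1 \<kappa> \<omega>' \<odot> pW \<omega>' \<omega>) \<otimes> pW j \<omega>)"
      by (subst A.finsum_ldistr) auto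
    also have "(\<Oplus>\<omega>'\<in>UNIV. (L1 \<kappa> \<omega>' \<odot> pW \<omega>' \<omega>) \<otimes> pW j \<omega>) = (L1 \<kappa> j \<odot> pW j \<omega>) \<otimes> pW j \<omega>"
      by (rule A.finsum_single) (auto simp: A.smult_mult_left magic_unitaryD(7)[OF pW] A.smult_rules)
    finally have 1: "pU \<kappa> i \<otimes> ((\<Oplus>\<omega>'\<in>UNIV. L1 \<kappa> \<omega>' \<odot> pW \<omega>' \<omega>) \<otimes> pW j \<omega>) = L1 \<kappa> j \<odot> (pU \<kappa> i \<otimes> pW j \<omega>)"
      by (simp add: A.smult_mult_left A.smult_mult_right)
    have "pU \<kappa> i \<otimes> ((\<Oplus>\<kappa>'\<in>UNIV. L2 \<kappa>' \<omega> \<odot> pU \<kappa> \<kappa>') \<otimes> pW j \<omega>) =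
      (\<Oplus>\<kappa>'\<in>UNIV. pU \<kappa> i \<otimes> (L2 \<kappa>' \<omega> \<odot> pU \<kappa> \<kappa>')) \<otimes> pW j \<omega>"
      by (subst A.m_assoc[symmetric]) (auto simp: A.finsum_rdistr Pi_def)
    also have "(\<Oplus>\<kappa>'\<in>UNIV. pU \<kappa> i \<otimes> (L2 \<kappa>' \<omega> \<odot> pU \<kappa> \<kappa>')) = pU \<kappa> i \<otimes> (L2 i \<omega> \<odot> pU \<kappa> i)"
      by (rule A.finsum_single) (auto simp: A.smult_mult_right magic_unitaryD(6)[OF pU] A.smult_rules)
    finally have 2: "pU \<kappa> i \<otimes> ((\<Oplus>\<kappa>'\<in>UNIV. L2 \<kappa>' \<omega> \<odot> pU \<kappa> \<kappa>') \<otimes> pW j \<omega>) = L2 i \<omega> \<odot> (pU \<kappa> i \<otimes> pW j \<omega>)"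
      by (simp add: A.smult_mult_left A.smult_mult_right)
    show ?thesis using 1 2 intertwinesD[OF i, of \<kappa> \<omega>] by simp
  qed
  have "(\<Oplus>\<kappa>\<in>UNIV. L1 \<kappa> j \<odot> pU \<kappa> i) = (\<Oplus>\<kappa>\<in>UNIV. L1 \<kappa> j \<odot> pU \<kappa> i) \<otimes> (\<Oplus>\<omega>\<in>UNIV. pW j \<omega>)"
    by (simp add: magic_unitaryD(4)[OF pW] Pi_def)
  also have "\<dots> = (\<Oplus>\<kappa>\<in>UNIV. \<Oplus>\<omega>\<in>UNIV. L2 i \<omega> \<odot> (pU \<kappa> i \<otimes> pW j \<omega>))"
    by (subst finsum_mult_finsum) (auto simp: A.smult_mult_left eq)
  also have "\<dots> = (\<Oplus>\<kappa>\<in>UNIV. pU \<kappa> i) \<otimes> (\<Oplus>\<omega>\<in>UNIV. L2 i \<omega> \<odot> pW j \<omega>)"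
    by (subst finsum_mult_finsum) (auto simp: A.smult_mult_right)
  also have "\<dots> = (\<Oplus>\<omega>\<in>UNIV. L2 i \<omega> \<odot> pW j \<omega>)"
    by (simp add: magic_unitaryD(5)[OF pU] Pi_def)
  finally show "(\<Oplus>\<omega>\<in>UNIV. L2 i \<omega> \<odot> pW j \<omega>) = (\<Oplus>\<kappa>\<in>UNIV. L1 \<kappa> j \<odot> pU \<kappa> i)" by simp
qed

end

subsection \<open>Composition of magic unitaries\<close>

text \<open>
  The matrix product in which entries are multiplied by the tensor product.
\<close>

definition compose_unitaries ::
  "('a, 'm) star_alg_scheme \<Rightarrow> ('b, 'n) star_alg_scheme \<Rightarrow>
   ('i \<Rightarrow> 'j::finite \<Rightarrow> 'a) \<Rightarrow> ('j \<Rightarrow> 'k \<Rightarrow> 'b) \<Rightarrow> 'i \<Rightarrow> 'k \<Rightarrow> ('a, 'b) tensor" where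
  "compose_unitaries A B p r i j = (\<Oplus>\<^bsub>tensor_alg A B\<^esub>\<eta>\<in>UNIV. tens A B (p i \<eta>) (r \<eta> j))"

context
  fixes A :: "('a, 'm) star_alg_scheme" and B :: "('b, 'n) star_alg_scheme"
  assumes A: "star_algebra A" and B: "star_algebra B"
begin

interpretation A: star_algebra A by (rule A)
interpretation B: star_algebra B by (rule B)
interpretation T: star_algebra "tensor_alg A B" by (rule star_algebra_tensor[OF A B])

lemma tens_linear:
  "b \<in> carrier B \<Longrightarrow> linear_map A (tensor_alg A B) (\<lambda>a. tens A B a b)"
  "a \<in> carrier A \<Longrightarrow> linear_map B (tensor_alg A B) (tens A B a)"
  using bilinear_mapD[OF bilinear_tens[OF A B]] by auto

lemma tens_zero:
  "b \<in> carrier B \<Longrightarrow> tens A B \<zero>\<^bsub>A\<^esub> b = \<zero>\<^bsub>tensor_alg A B\<^esub>"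
  "a \<in> carrier A \<Longrightarrow> tens A B a \<zero>\<^bsub>B\<^esub> = \<zero>\<^bsub>tensor_alg A B\<^esub>"
  using linear_map_zero[OF A T.star_algebra_axioms tens_linear(1)]
    linear_map_zero[OF B T.star_algebra_axioms tens_linear(2)] by auto

lemma tens_finsum:
  "b \<in> carrier B \<Longrightarrow> finite S \<Longrightarrow> (\<And>i. i \<in> S \<Longrightarrow> f i \<in> carrier A) \<Longrightarrow>
    tens A B (\<Oplus>\<^bsub>A\<^esub>i\<in>S. f i) b = (\<Oplus>\<^bsub>tensor_alg A B\<^esub>i\<in>S. tens A B (f i) b)"
  "a \<in> carrier A \<Longrightarrow> finite S \<Longrightarrow> (\<And>i. i \<in> S \<Longrightarrow> g i \<in> carrier B) \<Longrightarrow>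
    tens A B a (\<Oplus>\<^bsub>B\<^esub>i\<in>S. g i) = (\<Oplus>\<^bsub>tensor_alg A B\<^esub>i\<in>S. tens A B a (g i))"
  by (rule linear_map_finsum[OF A T.star_algebra_axioms tens_linear(1)]; auto)
    (rule linear_map_finsum[OF B T.star_algebra_axioms tens_linear(2)]; auto)

lemma tens_smult:
  "a \<in> carrier A \<Longrightarrow> b \<in> carrier B \<Longrightarrow> tens A B (c \<odot>\<^bsub>A\<^esub> a) b = c \<odot>\<^bsub>tensor_alg A B\<^esub> tens A B a b"
  "a \<in> carrier A \<Longrightarrow> b \<in> carrier B \<Longrightarrow> tens A B a (c \<odot>\<^bsub>B\<^esub> b) = c \<odot>\<^bsub>tensor_alg A B\<^esub> tens A B a b"
  using linear_mapD(3)[OF tens_linear(1)] linear_mapD(3)[OF tens_linear(2)] by auto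

text \<open>
  In a product of two entries that lie in one row or in one column, the terms with different middle
  indices vanish: in one row because the rows of \<open>p\<close> are orthogonal, in one column because the columns
  of \<open>r\<close> are.
\<close>

lemma magic_unitary_compose:
  fixes p :: "'i::finite \<Rightarrow> 'j::finite \<Rightarrow> 'a" and r :: "'j \<Rightarrow> 'k::finite \<Rightarrow> 'b"
  assumes p: "magic_unitary A p" and r: "magic_unitary B r"
  shows "magic_unitary (tensor_alg A B) (compose_unitaries A B p r)"
proof -
  let ?T = "tensor_alg A B" and ?t = "tens A B" and ?c = "compose_unitaries A B p r"
  note [simp] = magic_unitaryD(1-5)[OF p] magic_unitaryD(1-5)[OF r] tens_closed[OF A B]
  note orth = magic_unitaryD(6,7)[OF p] magic_unitaryD(6,7)[OF r]
  have prod: "?c i j \<otimes>\<^bsub>?T\<^esub> ?c i' j' =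
    (\<Oplus>\<^bsub>?T\<^esub>\<eta>\<in>UNIV. ?t (p i \<eta> \<otimes>\<^bsub>A\<^esub> p i' \<eta>) (r \<eta> j \<otimes>\<^bsub>B\<^esub> r \<eta> j'))"
    if "i = i' \<or> j = j'" for i j i' j'
  proof -
    have z: "?t (p i \<eta> \<otimes>\<^bsub>A\<^esub> p i' \<eta>') (r \<eta> j \<otimes>\<^bsub>B\<^esub> r \<eta>' j') = \<zero>\<^bsub>?T\<^esub>" if "\<eta> \<noteq> \<eta>'" for \<eta> \<eta>'
      using \<open>i = i' \<or> j = j'\<close> that by (auto simp: orth tens_zero)
    have "?c i j \<otimes>\<^bsub>?T\<^esub> ?c i' j' =
      (\<Oplus>\<^bsub>?T\<^esub>\<eta>\<in>UNIV. \<Oplus>\<^bsub>?T\<^esub>\<eta>'\<in>UNIV. ?t (p i \<eta> \<otimes>\<^bsub>A\<^esub> p i' \<eta>') (r \<eta> j \<otimes>\<^bsub>B\<^esub> r \<eta>' j'))"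
      unfolding compose_unitaries_def
      by (subst finsum_mult_finsum[OF T.star_algebra_axioms]) (auto simp: tens_mult[OF A B])
    also have "\<dots> = (\<Oplus>\<^bsub>?T\<^esub>\<eta>\<in>UNIV. ?t (p i \<eta> \<otimes>\<^bsub>A\<^esub> p i' \<eta>) (r \<eta> j \<otimes>\<^bsub>B\<^esub> r \<eta> j'))"
      by (intro T.finsum_cong' T.finsum_single refl) (auto simp: z)
    finally show ?thesis .
  qed
  show ?thesis
    unfolding magic_unitary_def
  proof (intro conjI allI impI)
    fix i j
    show "?c i j \<in> carrier (?T)"
      by (simp add: compose_unitaries_def Pi_def)
    show "star (?T) (?c i j) = ?c i j"
      by (simp add: compose_unitaries_def T.star_finsum Pi_def tens_star[OF A B])
    show "?c i j \<otimes>\<^bsub>?T\<^esub> ?c i j = ?c i j"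
      by (subst prod) (auto simp: compose_unitaries_def)
    show "?c i j \<otimes>\<^bsub>?T\<^esub> ?c i j' = \<zero>\<^bsub>?T\<^esub>"
      if "j \<noteq> j'" for j'
      using that by (subst prod) (auto simp: orth tens_zero)
    show "?c i j \<otimes>\<^bsub>?T\<^esub> ?c i' j = \<zero>\<^bsub>?T\<^esub>"
      if "i \<noteq> i'" for i'
      using that by (subst prod) (auto simp: orth tens_zero)
    have "(\<Oplus>\<^bsub>?T\<^esub>j\<in>UNIV. ?c i j) =
      (\<Oplus>\<^bsub>?T\<^esub>\<eta>\<in>UNIV. \<Oplus>\<^bsub>?T\<^esub>j\<in>UNIV. ?t (p i \<eta>) (r \<eta> j))"
      unfolding compose_unitaries_def by (rule T.finsum_swap) auto
    also have "\<dots> = (\<Oplus>\<^bsub>?T\<^esub>\<eta>\<in>UNIV. ?t (p i \<eta>) \<one>\<^bsub>B\<^esub>)"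
      by (simp add: tens_finsum(2)[symmetric])
    also have "\<dots> = \<one>\<^bsub>?T\<^esub>"
      by (simp add: tens_finsum(1)[symmetric] tens_one[OF A B])
    finally show "(\<Oplus>\<^bsub>?T\<^esub>j\<in>UNIV. ?c i j) = \<one>\<^bsub>?T\<^esub>" .
    have "(\<Oplus>\<^bsub>?T\<^esub>i\<in>UNIV. ?c i j) =
      (\<Oplus>\<^bsub>?T\<^esub>\<eta>\<in>UNIV. \<Oplus>\<^bsub>?T\<^esub>i\<in>UNIV. ?t (p i \<eta>) (r \<eta> j))"
      unfolding compose_unitaries_def by (rule T.finsum_swap) auto
    also have "\<dots> = (\<Oplus>\<^bsub>?T\<^esub>\<eta>\<in>UNIV. ?t \<one>\<^bsub>A\<^esub> (r \<eta> j))"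
      by (simp add: tens_finsum(1)[symmetric])
    also have "\<dots> = \<one>\<^bsub>?T\<^esub>"
      by (simp add: tens_finsum(2)[symmetric] tens_one[OF A B])
    finally show "(\<Oplus>\<^bsub>?T\<^esub>i\<in>UNIV. ?c i j) = \<one>\<^bsub>?T\<^esub>" .
  qed
qed

lemma intertwines_compose:
  assumes cl: "\<And>i j. pU i j \<in> carrier A" "\<And>i j. pW i j \<in> carrier A" "\<And>i j. rU i j \<in> carrier B" "\<And>i j. rW i j \<in> carrier B"
    and p: "intertwines A L1 L2 pU pW" and r: "intertwines B L2 L3 rU rW"
  shows "intertwines (tensor_alg A B) L1 L3 (compose_unitaries A B pU rU) (compose_unitaries A B pW rW)"
  unfolding intertwines_def
proof (intro allI)
  fix i j
  let ?T = "tensor_alg A B" and ?t = "tens A B"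
  note [simp] = cl tens_closed[OF A B]
  have "(\<Oplus>\<^bsub>?T\<^esub>\<omega>\<in>UNIV. L1 i \<omega> \<odot>\<^bsub>?T\<^esub> compose_unitaries A B pW rW \<omega> j) =
    (\<Oplus>\<^bsub>?T\<^esub>\<omega>\<in>UNIV. \<Oplus>\<^bsub>?T\<^esub>\<eta>\<in>UNIV. ?t (L1 i \<omega> \<odot>\<^bsub>A\<^esub> pW \<omega> \<eta>) (rW \<eta> j))"
    unfolding compose_unitaries_def by (simp add: T.finsum_smult[symmetric] tens_smult Pi_def)
  also have "\<dots> = (\<Oplus>\<^bsub>?T\<^esub>\<eta>\<in>UNIV. ?t (\<Oplus>\<^bsub>A\<^esub>\<omega>\<in>UNIV. L1 i \<omega> \<odot>\<^bsub>A\<^esub> pW \<omega> \<eta>) (rW \<eta> j))"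
    by (subst T.finsum_swap) (auto simp: tens_finsum)
  also have "\<dots> = (\<Oplus>\<^bsub>?T\<^esub>\<eta>\<in>UNIV. \<Oplus>\<^bsub>?T\<^esub>\<kappa>\<in>UNIV. ?t (L2 \<kappa> \<eta> \<odot>\<^bsub>A\<^esub> pU i \<kappa>) (rW \<eta> j))"
    by (simp add: intertwinesD[OF p] tens_finsum)
  also have "\<dots> = (\<Oplus>\<^bsub>?T\<^esub>\<kappa>\<in>UNIV. \<Oplus>\<^bsub>?T\<^esub>\<eta>\<in>UNIV. ?t (pU i \<kappa>) (L2 \<kappa> \<eta> \<odot>\<^bsub>B\<^esub> rW \<eta> j))"
    by (subst T.finsum_swap) (auto simp: tens_smult)
  also have "\<dots> = (\<Oplus>\<^bsub>?T\<^esub>\<kappa>\<in>UNIV. \<Oplus>\<^bsub>?T\<^esub>\<xi>\<in>UNIV. ?t (pU i \<kappa>) (L3 \<xi> j \<odot>\<^bsub>B\<^esub> rU \<kappa> \<xi>))"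
    by (simp add: tens_finsum(2)[symmetric] intertwinesD[OF r])
  also have "\<dots> = (\<Oplus>\<^bsub>?T\<^esub>\<xi>\<in>UNIV. L3 \<xi> j \<odot>\<^bsub>?T\<^esub> compose_unitaries A B pU rU i \<xi>)"
    unfolding compose_unitaries_def
    by (subst T.finsum_swap) (auto simp: T.finsum_smult[symmetric] tens_smult Pi_def)
  finally show "(\<Oplus>\<^bsub>?T\<^esub>\<omega>\<in>UNIV. L1 i \<omega> \<odot>\<^bsub>?T\<^esub> compose_unitaries A B pW rW \<omega> j) =
    (\<Oplus>\<^bsub>?T\<^esub>\<xi>\<in>UNIV. L3 \<xi> j \<odot>\<^bsub>?T\<^esub> compose_unitaries A B pU rU i \<xi>)" .
qed

text \<open>
  Summing over a row coordinate first makes the left leg independent of one coordinate of the middle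
  index; that coordinate can then be summed in the right leg, where the relation for \<open>r\<close> applies.
\<close>

lemma column_no_signalling_compose:
  fixes p :: "'s1::finite \<times> 't1::finite \<Rightarrow> 's2::finite \<times> 't2::finite \<Rightarrow> 'a"
    and r :: "'s2 \<times> 't2 \<Rightarrow> 's3::finite \<times> 't3::finite \<Rightarrow> 'b"
  assumes cl: "\<And>i j. p i j \<in> carrier A" "\<And>i j. r i j \<in> carrier B"
    and p: "column_no_signalling A p" and r: "column_no_signalling B r"
  shows "column_no_signalling (tensor_alg A B) (compose_unitaries A B p r)"
proof -
  let ?T = "tensor_alg A B" and ?t = "tens A B"
  note [simp] = cl tens_closed[OF A B]
  have 1: "(\<Oplus>\<^bsub>?T\<^esub>s1\<in>UNIV. compose_unitaries A B p r (s1, t1) (s3, t3)) =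
    (\<Oplus>\<^bsub>?T\<^esub>t2\<in>UNIV. ?t (\<Oplus>\<^bsub>A\<^esub>s1\<in>UNIV. p (s1, t1) (undefined, t2)) (\<Oplus>\<^bsub>B\<^esub>s2\<in>UNIV. r (s2, t2) (s3, t3)))" for t1 s3 t3
  proof -
    have "(\<Oplus>\<^bsub>?T\<^esub>s1\<in>UNIV. compose_unitaries A B p r (s1, t1) (s3, t3)) =
      (\<Oplus>\<^bsub>?T\<^esub>\<eta>\<in>UNIV. ?t (\<Oplus>\<^bsub>A\<^esub>s1\<in>UNIV. p (s1, t1) \<eta>) (r \<eta> (s3, t3)))"
      unfolding compose_unitaries_def by (subst T.finsum_swap) (auto simp: tens_finsum)
    also have "\<dots> = (\<Oplus>\<^bsub>?T\<^esub>t2\<in>UNIV. \<Oplus>\<^bsub>?T\<^esub>s2\<in>UNIV. ?t (\<Oplus>\<^bsub>A\<^esub>s1\<in>UNIV. p (s1, t1) (s2, t2)) (r (s2, t2) (s3, t3)))"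
      by (rule T.finsum_UNIV_prod(2)) (auto simp: Pi_def)
    also have "\<dots> = (\<Oplus>\<^bsub>?T\<^esub>t2\<in>UNIV. \<Oplus>\<^bsub>?T\<^esub>s2\<in>UNIV. ?t (\<Oplus>\<^bsub>A\<^esub>s1\<in>UNIV. p (s1, t1) (undefined, t2)) (r (s2, t2) (s3, t3)))"
      using column_no_signallingD(1)[OF p]
      by (intro T.finsum_cong' arg_cong2[where f = ?t] refl) (auto simp: Pi_def)
    also have "\<dots> = (\<Oplus>\<^bsub>?T\<^esub>t2\<in>UNIV. ?t (\<Oplus>\<^bsub>A\<^esub>s1\<in>UNIV. p (s1, t1) (undefined, t2)) (\<Oplus>\<^bsub>B\<^esub>s2\<in>UNIV. r (s2, t2) (s3, t3)))"
      by (intro T.finsum_cong' tens_finsum(2)[symmetric] refl) (auto simp: Pi_def)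
    finally show ?thesis .
  qed
  have 2: "(\<Oplus>\<^bsub>?T\<^esub>t1\<in>UNIV. compose_unitaries A B p r (s1, t1) (s3, t3)) =
    (\<Oplus>\<^bsub>?T\<^esub>s2\<in>UNIV. ?t (\<Oplus>\<^bsub>A\<^esub>t1\<in>UNIV. p (s1, t1) (s2, undefined)) (\<Oplus>\<^bsub>B\<^esub>t2\<in>UNIV. r (s2, t2) (s3, t3)))" for s1 s3 t3
  proof -
    have "(\<Oplus>\<^bsub>?T\<^esub>t1\<in>UNIV. compose_unitaries A B p r (s1, t1) (s3, t3)) =
      (\<Oplus>\<^bsub>?T\<^esub>\<eta>\<in>UNIV. ?t (\<Oplus>\<^bsub>A\<^esub>t1\<in>UNIV. p (s1, t1) \<eta>) (r \<eta> (s3, t3)))"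
      unfolding compose_unitaries_def by (subst T.finsum_swap) (auto simp: tens_finsum)
    also have "\<dots> = (\<Oplus>\<^bsub>?T\<^esub>s2\<in>UNIV. \<Oplus>\<^bsub>?T\<^esub>t2\<in>UNIV. ?t (\<Oplus>\<^bsub>A\<^esub>t1\<in>UNIV. p (s1, t1) (s2, t2)) (r (s2, t2) (s3, t3)))"
      by (rule T.finsum_UNIV_prod(1)) (auto simp: Pi_def)
    also have "\<dots> = (\<Oplus>\<^bsub>?T\<^esub>s2\<in>UNIV. \<Oplus>\<^bsub>?T\<^esub>t2\<in>UNIV. ?t (\<Oplus>\<^bsub>A\<^esub>t1\<in>UNIV. p (s1, t1) (s2, undefined)) (r (s2, t2) (s3, t3)))"
      using column_no_signallingD(2)[OF p]
      by (intro T.finsum_cong' arg_cong2[where f = ?t] refl) (auto simp: Pi_def)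
    also have "\<dots> = (\<Oplus>\<^bsub>?T\<^esub>s2\<in>UNIV. ?t (\<Oplus>\<^bsub>A\<^esub>t1\<in>UNIV. p (s1, t1) (s2, undefined)) (\<Oplus>\<^bsub>B\<^esub>t2\<in>UNIV. r (s2, t2) (s3, t3)))"
      by (intro T.finsum_cong' tens_finsum(2)[symmetric] refl) (auto simp: Pi_def)
    finally show ?thesis .
  qed
  show ?thesis
    unfolding column_no_signalling_def 1 2
    by (intro conjI allI T.finsum_cong' arg_cong2[where f = ?t] refl column_no_signallingD[OF r])
      (auto simp: Pi_def)
qed

end

section \<open>Algebras with the same underlying star-algebra\<close>

text \<open>
  A Hopf algebra and its underlying star-algebra have different record types and cannot be equated;
  this is the substitute for their equality.
\<close>

definition same_star_algebra :: "('a, 'm) star_alg_scheme \<Rightarrow> ('a, 'n) star_alg_scheme \<Rightarrow> bool" where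
  "same_star_algebra A B \<longleftrightarrow> carrier A = carrier B \<and> mult A = mult B \<and> one A = one B \<and> zero A = zero B \<and>
     add A = add B \<and> smult A = smult B \<and> star A = star B"

lemma finsum_cong_algebra:
  "same_star_algebra A B \<Longrightarrow> finsum A = finsum B"
  by (simp add: same_star_algebra_def finsum_def[abs_def] finprod_def[abs_def] cong: if_cong)

context
  fixes A :: "('a, 'm) star_alg_scheme" and A' :: "('a, 'n) star_alg_scheme"
  assumes same: "same_star_algebra A A'"
begin

lemma same_fields:
  "carrier A = carrier A'" "mult A = mult A'" "one A = one A'" "zero A = zero A'"
  "add A = add A'" "smult A = smult A'" "star A = star A'"
  using same by (auto simp: same_star_algebra_def)

lemma same_linear_map:
  "linear_map A B f \<longleftrightarrow> linear_map A' B f" "linear_map B A g \<longleftrightarrow> linear_map B A' g"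
  by (simp_all add: linear_map_def same_fields)

lemma same_star_hom:
  "star_hom A B f \<longleftrightarrow> star_hom A' B f" "star_hom B A g \<longleftrightarrow> star_hom B A' g"
  by (simp_all add: star_hom_def ring_hom_def same_linear_map same_fields)

lemma same_tensor:
  "tensor_alg A B = tensor_alg A' B" "tensor_alg B A = tensor_alg B A'"
  "tens A B = tens A' B" "tens B A = tens B A'"
  by (intro tensor_alg_cong; simp add: same_fields)+

lemma same_tensor_lift: "tensor_lift A \<phi> = tensor_lift A' \<phi>"
  by (simp add: tensor_lift_def lin_ext_def[abs_def] same_fields finsum_cong_algebra[OF same])

lemma same_tensor_map:
  "tensor_map A B f g = tensor_map A' B f g" "tensor_map B A h k = tensor_map B A' h k"
  by (simp_all add: tensor_map_def same_tensor)

lemma same_tensor_assoc: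
  "tensor_assoc A B C = tensor_assoc A' B C" "tensor_assoc B A C = tensor_assoc B A' C"
  "tensor_assoc B C A = tensor_assoc B C A'"
  by (simp_all add: tensor_assoc_def same_tensor)

lemma same_quot:
  "quot_alg A I = quot_alg A' I" "quot_map A I = quot_map A' I"
  by (simp_all add: quot_alg_def quot_map_def[abs_def] FactRing_def A_RCOSETS_def RCOSETS_def
     a_r_coset_def r_coset_def rcoset_mult_def[abs_def] set_add_def set_mult_def[abs_def] same_fields)

lemma star_algebra_if_same: "star_algebra A' \<Longrightarrow> star_algebra A"
  by (rule star_algebra_image[of A' _ id])
    (auto simp: star_hom_def ring_hom_def linear_map_def same_fields)

end

lemma star_algebra_opposite:
  assumes "star_algebra A"
  shows "star_algebra (opposite_alg A)"
proof -
  interpret A: star_algebra A by fact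
  show ?thesis
    by (rule star_algebraI)
      (auto simp: opposite_alg_def A.a_ac A.smult_minus_one A.r_neg A.m_assoc A.l_distr A.r_distr
        A.smult_rules A.smult_mult_left A.smult_mult_right A.star_add A.star_smult A.star_mult A.star_star)
qed

lemma opposite_simps [simp]:
  "carrier (opposite_alg A) = carrier A" "x \<otimes>\<^bsub>opposite_alg A\<^esub> y = y \<otimes>\<^bsub>A\<^esub> x" "one (opposite_alg A) = one A"
  "zero (opposite_alg A) = zero A" "add (opposite_alg A) = add A" "smult (opposite_alg A) = smult A"
  "star (opposite_alg A) = star A" "finsum (opposite_alg A) = finsum A"
  by (simp_all add: opposite_alg_def finsum_def[abs_def] finprod_def[abs_def] cong: if_cong)

lemma opposite_magic:
  "magic_unitary (opposite_alg A) p \<longleftrightarrow> magic_unitary A p"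
  "intertwines (opposite_alg A) L1 L2 pU pW \<longleftrightarrow> intertwines A L1 L2 pU pW"
  "column_no_signalling (opposite_alg A) p' \<longleftrightarrow> column_no_signalling A p'"
  unfolding magic_unitary_def intertwines_def column_no_signalling_def by (simp_all, metis)

section \<open>The algebras of a pair of games\<close>

context
  fixes G1 :: "('x1::finite, 'y1::finite, 'a1::finite, 'b1::finite) game"
    and G2 :: "('x2::finite, 'y2::finite, 'a2::finite, 'b2::finite) game"
begin

lemma star_algebra_game_alg: "star_algebra (game_alg G1 G2)"
  unfolding game_alg_def by (rule star_algebra_univ_alg)

lemma gen_closed [simp]:
  "genU G1 G2 i j \<in> carrier (game_alg G1 G2)" "genW G1 G2 i' j' \<in> carrier (game_alg G1 G2)"
  by (simp_all add: genU_def genW_def game_alg_def)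

lemma game_alg_relations:
  "magic_unitary (game_alg G1 G2) (genU G1 G2)" (is ?U)
  "magic_unitary (game_alg G1 G2) (genW G1 G2)" (is ?W)
  "intertwines (game_alg G1 G2) (incidence G1) (incidence G2) (genU G1 G2) (genW G1 G2)" (is ?i)
proof -
  let ?R = "game_relators G1 G2"
  let ?q = "quot_map free_alg (gen_star_ideal free_alg ?R)"
  note F = star_algebra_free_alg and U = star_algebra_univ_alg[of ?R]
  have "?q ` ?R \<subseteq> {\<zero>\<^bsub>univ_alg ?R\<^esub>}"
    using univ_alg_relation[of _ ?R] by auto
  then have "?q ` magic_relators free_alg (\<lambda>i j. free_gen (GenU i j)) \<subseteq> {\<zero>\<^bsub>univ_alg ?R\<^esub>}"
    "?q ` magic_relators free_alg (\<lambda>i j. free_gen (GenW i j)) \<subseteq> {\<zero>\<^bsub>univ_alg ?R\<^esub>}"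
    "?q ` intertwining_relators free_alg (incidence G1) (incidence G2)
       (\<lambda>i j. free_gen (GenU i j)) (\<lambda>i j. free_gen (GenW i j)) \<subseteq> {\<zero>\<^bsub>univ_alg ?R\<^esub>}"
    unfolding game_relators_def by auto
  then show ?U ?W ?i
    by (simp_all add: relators_image[OF F U star_hom_univ_quot_map] univ_gen_def[symmetric]
      magic_relators_zero_iff[OF U] intertwining_relators_zero_iff[OF U] game_alg_def genU_def[abs_def] genW_def[abs_def])
qed

text \<open>
  The universal property of the algebra of two games. Each relator is mapped to the corresponding
  relator of the images, so the relations become statements about \<open>fU\<close> and \<open>fW\<close>.
\<close>

lemma game_hom:
  fixes V :: "('v, 'n) star_alg_scheme"
  assumes V: "star_algebra V" and U: "magic_unitary V fU" and W: "magic_unitary V fW"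
    and i: "intertwines V (incidence G1) (incidence G2) fU fW"
  shows "star_hom (game_alg G1 G2) V (univ_hom V (case_gen fU fW))" (is ?hom)
    and "univ_hom V (case_gen fU fW) (genU G1 G2 i j) = fU i j" (is ?U)
    and "univ_hom V (case_gen fU fW) (genW G1 G2 i' j') = fW i' j'" (is ?W)
proof -
  note [simp] = magic_unitaryD(1)[OF U] magic_unitaryD(1)[OF W]
  have cl: "case_gen fU fW g \<in> carrier V" for g by (cases g) auto
  note h = free_hom_star_hom[of V "case_gen fU fW", OF V cl] and g = free_hom_gen[of V "case_gen fU fW", OF V cl]
  have "free_hom V (case_gen fU fW) ` game_relators G1 G2 \<subseteq> {\<zero>\<^bsub>V\<^esub>}"
    unfolding game_relators_def image_Un Un_subset_iff
    using U W i
    by (simp add: relators_image[OF star_algebra_free_alg V h] g magic_relators_zero_iff[OF V]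
        intertwining_relators_zero_iff[OF V])
  then have z: "free_hom V (case_gen fU fW) r = \<zero>\<^bsub>V\<^esub>" if "r \<in> game_relators G1 G2" for r
    using that by auto
  note u = univ_hom[of V "case_gen fU fW" "game_relators G1 G2", OF V cl z]
  show ?hom
    unfolding game_alg_def by (rule u)
  show ?U ?W
    unfolding genU_def genW_def by (simp_all add: u(2))
qed

abbreviation ns_map where "ns_map \<equiv> quot_map (game_alg G1 G2) (ns_ideal G1 G2)"

definition nsU where "nsU i j = ns_map (genU G1 G2 i j)"
definition nsW where "nsW i j = ns_map (genW G1 G2 i j)"

definition ns_relators where
  "ns_relators =
    (\<Union>y1 y2. indep_relators (game_alg G1 G2) (\<lambda>x2. \<Oplus>\<^bsub>game_alg G1 G2\<^esub>x1\<in>UNIV. genU G1 G2 (x1, y1) (x2, y2))) \<union>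
    (\<Union>x1 x2. indep_relators (game_alg G1 G2) (\<lambda>y2. \<Oplus>\<^bsub>game_alg G1 G2\<^esub>y1\<in>UNIV. genU G1 G2 (x1, y1) (x2, y2))) \<union>
    (\<Union>b1 b2. indep_relators (game_alg G1 G2) (\<lambda>a1. \<Oplus>\<^bsub>game_alg G1 G2\<^esub>a2\<in>UNIV. genW G1 G2 (a1, b1) (a2, b2))) \<union>
    (\<Union>a1 a2. indep_relators (game_alg G1 G2) (\<lambda>b1. \<Oplus>\<^bsub>game_alg G1 G2\<^esub>b2\<in>UNIV. genW G1 G2 (a1, b1) (a2, b2)))"

lemma ns_ideal_eq: "ns_ideal G1 G2 = gen_star_ideal (game_alg G1 G2) ns_relators"
  by (simp add: ns_ideal_def ns_relators_def Let_def)

interpretation A: star_algebra "game_alg G1 G2" by (rule star_algebra_game_alg)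

lemma ns_relators_closed: "ns_relators \<subseteq> carrier (game_alg G1 G2)"
  unfolding ns_relators_def
  by (intro Un_least UN_least relators_closed(3)[OF star_algebra_game_alg] A.finsum_closed) auto

lemma ns_relators_zero_iff:
  fixes V :: "('v, 'n) star_alg_scheme"
  assumes V: "star_algebra V" and F: "star_hom (game_alg G1 G2) V F"
  shows "F ` ns_relators \<subseteq> {\<zero>\<^bsub>V\<^esub>} \<longleftrightarrow> column_no_signalling V (\<lambda>i j. F (genU G1 G2 i j)) \<and>
    column_no_signalling V (\<lambda>i j. F (genW G1 G2 j i))"
proof -
  interpret V: star_algebra V by (rule V)
  note f = linear_map_finsum[OF star_algebra_game_alg V star_homD(1)[OF F]]
  note [simp] = star_homD(2)[OF F]
  show ?thesis
    unfolding ns_relators_def image_Un image_UN Un_subset_iff UN_subset_iff column_no_signalling_def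
    by (simp add: relators_image(3)[OF star_algebra_game_alg V F] indep_relators_zero_iff[OF V] f Pi_def
        A.finsum_closed V.finsum_closed)
      blast
qed

lemma star_algebra_ideal_ns: "star_algebra_ideal (game_alg G1 G2) (ns_ideal G1 G2)"
  unfolding ns_ideal_eq
  by (rule star_algebra_ideal_gen[OF star_algebra_game_alg ns_relators_closed])

interpretation I: star_algebra_ideal "game_alg G1 G2" "ns_ideal G1 G2"
  by (rule star_algebra_ideal_ns)

lemma star_algebra_ns_alg: "star_algebra (ns_alg G1 G2)"
  unfolding ns_alg_def by (rule I.star_algebra_quot)

lemma ns_map_star_hom: "star_hom (game_alg G1 G2) (ns_alg G1 G2) ns_map"
  unfolding ns_alg_def by (rule I.quot_map_star_hom)

lemma ns_map_zero_iff: "x \<in> carrier (game_alg G1 G2) \<Longrightarrow> ns_map x = \<zero>\<^bsub>ns_alg G1 G2\<^esub> \<longleftrightarrow> x \<in> ns_ideal G1 G2"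
  unfolding ns_alg_def by (rule I.quot_map_zero_iff)

lemma ns_alg_carrier: "carrier (ns_alg G1 G2) = ns_map ` carrier (game_alg G1 G2)"
  unfolding ns_alg_def by (rule I.quot_carrier)

lemma ns_magic:
  "magic_unitary (ns_alg G1 G2) nsU" "magic_unitary (ns_alg G1 G2) nsW"
  "intertwines (ns_alg G1 G2) (incidence G1) (incidence G2) nsU nsW"
  using star_hom_magic_unitary[OF star_algebra_game_alg star_algebra_ns_alg ns_map_star_hom game_alg_relations(1)]
    star_hom_magic_unitary[OF star_algebra_game_alg star_algebra_ns_alg ns_map_star_hom game_alg_relations(2)]
    star_hom_intertwines[OF star_algebra_game_alg star_algebra_ns_alg ns_map_star_hom _ _ game_alg_relations(3)]
  by (simp_all add: nsU_def[abs_def] nsW_def[abs_def])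

text \<open>
  The first two statements are the relations imposed, the last two follow from them by
  \<open>column_no_signalling_transposed\<close>. They make the construction symmetric under transposition.
\<close>

lemma ns_column:
  "column_no_signalling (ns_alg G1 G2) nsU" "column_no_signalling (ns_alg G1 G2) (transposed nsW)"
  "column_no_signalling (ns_alg G1 G2) (transposed nsU)" "column_no_signalling (ns_alg G1 G2) nsW"
proof -
  have "ns_relators \<subseteq> ns_ideal G1 G2" unfolding ns_ideal_eq by (rule gen_star_ideal_superset)
  then have "ns_map ` ns_relators \<subseteq> {\<zero>\<^bsub>ns_alg G1 G2\<^esub>}"
    using ns_relators_closed by (intro image_subsetI singleton_iff[THEN iffD2] ns_map_zero_iff[THEN iffD2]) blast+
  then show *: "column_no_signalling (ns_alg G1 G2) nsU" "column_no_signalling (ns_alg G1 G2) (transposed nsW)"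
    unfolding ns_relators_zero_iff[OF star_algebra_ns_alg ns_map_star_hom] nsU_def[abs_def] nsW_def[abs_def] by auto
  show "column_no_signalling (ns_alg G1 G2) (transposed nsU)" "column_no_signalling (ns_alg G1 G2) nsW"
    using column_no_signalling_transposed[OF star_algebra_ns_alg ns_magic(1) *(1)]
      column_no_signalling_transposed[OF star_algebra_ns_alg magic_unitary_transposed[OF ns_magic(2)] *(2)] by auto
qed

lemma ns_gen_closed [simp]: "nsU i j \<in> carrier (ns_alg G1 G2)" "nsW i' j' \<in> carrier (ns_alg G1 G2)"
  using ns_magic(1,2) by (auto dest: magic_unitaryD)

text \<open>
  The universal property of the no-signalling quotient.
\<close>

lemma ns_descend:
  fixes V :: "('v, 'n) star_alg_scheme"
  assumes V: "star_algebra V" and F: "star_hom (game_alg G1 G2) V F"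
    and U: "column_no_signalling V (\<lambda>i j. F (genU G1 G2 i j))"
    and W: "column_no_signalling V (\<lambda>i j. F (genW G1 G2 j i))"
  shows "star_hom (ns_alg G1 G2) V (descend F)"
    and "x \<in> carrier (game_alg G1 G2) \<Longrightarrow> descend F (ns_map x) = F x"
proof -
  have "F ` ns_relators \<subseteq> {\<zero>\<^bsub>V\<^esub>}" using U W by (simp add: ns_relators_zero_iff[OF V F])
  then have z: "F x = \<zero>\<^bsub>V\<^esub>" if "x \<in> ns_ideal G1 G2" for x
    using gen_star_ideal_kernel[OF star_algebra_game_alg V F ns_relators_closed] that by (simp add: ns_ideal_eq)
  show "star_hom (ns_alg G1 G2) V (descend F)"
    unfolding ns_alg_def by (rule I.descend_star_hom[OF V star_homD(1)[OF F] z F])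
  show "x \<in> carrier (game_alg G1 G2) \<Longrightarrow> descend F (ns_map x) = F x"
    by (rule I.descend_quot_map[OF V star_homD(1)[OF F] z])
qed

lemma ns_induct [consumes 1, case_names one U W add mult smult]:
  assumes "x \<in> carrier (ns_alg G1 G2)" and one: "P \<one>\<^bsub>ns_alg G1 G2\<^esub>"
    and U: "\<And>i j. P (nsU i j)" and W: "\<And>i j. P (nsW i j)"
    and add: "\<And>x y. x \<in> carrier (ns_alg G1 G2) \<Longrightarrow> y \<in> carrier (ns_alg G1 G2) \<Longrightarrow> P x \<Longrightarrow> P y \<Longrightarrow>
      P (x \<oplus>\<^bsub>ns_alg G1 G2\<^esub> y)"
    and mult: "\<And>x y. x \<in> carrier (ns_alg G1 G2) \<Longrightarrow> y \<in> carrier (ns_alg G1 G2) \<Longrightarrow> P x \<Longrightarrow> P y \<Longrightarrow>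
      P (x \<otimes>\<^bsub>ns_alg G1 G2\<^esub> y)"
    and smult: "\<And>c x. x \<in> carrier (ns_alg G1 G2) \<Longrightarrow> P x \<Longrightarrow> P (c \<odot>\<^bsub>ns_alg G1 G2\<^esub> x)"
  shows "P x"
proof -
  note q = star_homD[OF ns_map_star_hom]
  obtain y where y: "y \<in> carrier (univ_alg (game_relators G1 G2))" and x: "x = ns_map y"
    using assms(1) by (auto simp: ns_alg_carrier game_alg_def)
  have star_gen: "star (univ_alg (game_relators G1 G2)) (univ_gen (game_relators G1 G2) g) = univ_gen (game_relators G1 G2) g" for g
    using magic_unitaryD(2)[OF game_alg_relations(1)] magic_unitaryD(2)[OF game_alg_relations(2)]
    by (cases g) (simp_all add: game_alg_def genU_def genW_def)
  show ?thesis unfolding x using y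
  proof (induction y rule: univ_alg_induct[consumes 1, case_names selfadj one gen add mult smult])
    case (selfadj g)
    then show ?case by (rule star_gen)
  next
    case one
    then show ?case using assms(2) q(6) by (simp add: game_alg_def)
  next
    case (gen g)
    then show ?case using U W by (cases g) (simp_all add: nsU_def nsW_def genU_def genW_def)
  next
    case (add x y)
    then show ?case using assms(5) q(2,4)[of x] q(2)[of y] by (simp add: game_alg_def)
  next
    case (mult x y)
    then show ?case using assms(6) q(2,3)[of x] q(2)[of y] by (simp add: game_alg_def)
  next
    case (smult c x)
    then show ?case using assms(7) q(2,5)[of x] by (simp add: game_alg_def)
  qed
qed

lemma ns_hom_eqI:
  assumes f: "star_hom (ns_alg G1 G2) V f" and g: "star_hom (ns_alg G1 G2) V g"
    and "\<And>i j. f (nsU i j) = g (nsU i j)" "\<And>i j. f (nsW i j) = g (nsW i j)"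
    and "x \<in> carrier (ns_alg G1 G2)"
  shows "f x = g x"
  using assms(5)
  by (induction rule: ns_induct) (simp_all add: assms(3,4) star_homD(3-6)[OF f] star_homD(3-6)[OF g])

end

section \<open>Comultiplication, counit and antipode\<close>

lemma compose_unitaries_closed:
  assumes "star_algebra A" "star_algebra B" "\<And>i j. p i j \<in> carrier A" "\<And>i j. r i j \<in> carrier B"
  shows "compose_unitaries A B p r i j \<in> carrier (tensor_alg A B)"
proof -
  interpret T: star_algebra "tensor_alg A B" by (rule star_algebra_tensor[OF assms(1,2)])
  show ?thesis unfolding compose_unitaries_def
    by (intro T.finsum_closed) (simp add: assms tens_closed[OF assms(1,2)])
qed

lemma linear_map_compose_unitaries:
  assumes A: "star_algebra A" and B: "star_algebra B" and V: "star_algebra V"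
    and F: "linear_map (tensor_alg A B) V F"
    and "\<And>i j. p i j \<in> carrier A" "\<And>i j. r i j \<in> carrier B"
  shows "F (compose_unitaries A B p r i j) = (\<Oplus>\<^bsub>V\<^esub>\<eta>\<in>UNIV. F (tens A B (p i \<eta>) (r \<eta> j)))"
  unfolding compose_unitaries_def
  by (rule linear_map_finsum[OF star_algebra_tensor[OF A B] V F]) (simp_all add: assms tens_closed[OF A B])

lemma tensor_map_compose_unitaries:
  assumes A: "star_algebra A" and B: "star_algebra B" and C: "star_algebra C" and D: "star_algebra D"
    and f: "linear_map A C f" and g: "linear_map B D g"
    and p: "\<And>i j. p i j \<in> carrier A" and r: "\<And>i j. r i j \<in> carrier B"
  shows "tensor_map C D f g (compose_unitaries A B p r i j) =
    compose_unitaries C D (\<lambda>i j. f (p i j)) (\<lambda>i j. g (r i j)) i j"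
  unfolding linear_map_compose_unitaries[OF A B star_algebra_tensor[OF C D] tensor_map(1)[OF A B C D f g], OF p r]
  by (simp add: tensor_map(2)[OF A B C D f g] p r compose_unitaries_def)

lemma compose_unitaries_assoc:
  assumes A: "star_algebra A" and B: "star_algebra B" and C: "star_algebra C"
    and p: "\<And>i j. p i j \<in> carrier A" and q: "\<And>i j. q i j \<in> carrier B" and r: "\<And>i j. r i j \<in> carrier C"
  shows "tensor_assoc A B C (compose_unitaries (tensor_alg A B) C (compose_unitaries A B p q) r i j) =
    compose_unitaries A (tensor_alg B C) p (compose_unitaries B C q r) i j"
proof -
  let ?V = "tensor_alg A (tensor_alg B C)" and ?s = "tensor_assoc A B C" and ?pq = "compose_unitaries A B p q"
    and ?t = "tens (tensor_alg A B) C" and ?t' = "tens A (tensor_alg B C)"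
  note AB = star_algebra_tensor[OF A B] and BC = star_algebra_tensor[OF B C]
  interpret V: star_algebra "?V" by (rule star_algebra_tensor[OF A BC])
  note [simp] = p q r tens_closed[OF A B] tens_closed[OF B C] tens_closed[OF A BC] tens_closed[OF AB C]
  have "?s (compose_unitaries (tensor_alg A B) C (?pq) r i j) =
    (\<Oplus>\<^bsub>?V\<^esub>\<kappa>\<in>UNIV. ?s (?t (?pq i \<kappa>) (r \<kappa> j)))"
    by (rule linear_map_compose_unitaries[OF AB C V.star_algebra_axioms tensor_assoc(1)[OF A B C]])
      (simp_all add: compose_unitaries_closed[OF A B])
  also have "\<dots> = (\<Oplus>\<^bsub>?V\<^esub>\<kappa>\<in>UNIV. \<Oplus>\<^bsub>?V\<^esub>\<eta>\<in>UNIV.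
      ?t' (p i \<eta>) (tens B C (q \<eta> \<kappa>) (r \<kappa> j)))"
  proof (intro V.finsum_cong' refl)
    fix \<kappa>
    have "?s (?t (?pq i \<kappa>) (r \<kappa> j)) =
      (\<Oplus>\<^bsub>?V\<^esub>\<eta>\<in>UNIV. ?s (?t (tens A B (p i \<eta>) (q \<eta> \<kappa>)) (r \<kappa> j)))"
      by (rule linear_map_compose_unitaries[OF A B V.star_algebra_axioms
            linear_map_compose[OF tens_linear(1)[OF AB C] tensor_assoc(1)[OF A B C]]]) simp_all
    then show "?s (?t (?pq i \<kappa>) (r \<kappa> j)) =
      (\<Oplus>\<^bsub>?V\<^esub>\<eta>\<in>UNIV. ?t' (p i \<eta>) (tens B C (q \<eta> \<kappa>) (r \<kappa> j)))"
      by (simp add: tensor_assoc(2)[OF A B C])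
  qed (auto intro!: V.finsum_closed)
  also have "\<dots> = (\<Oplus>\<^bsub>?V\<^esub>\<eta>\<in>UNIV. \<Oplus>\<^bsub>?V\<^esub>\<kappa>\<in>UNIV.
      ?t' (p i \<eta>) (tens B C (q \<eta> \<kappa>) (r \<kappa> j)))"
    by (rule V.finsum_swap) simp_all
  also have "\<dots> = compose_unitaries A (tensor_alg B C) p (compose_unitaries B C q r) i j"
    unfolding compose_unitaries_def by (simp add: tens_finsum(2)[OF A BC])
  finally show ?thesis .
qed

lemma tensor_lift_counit:
  assumes W: "star_algebra W" and X: "star_algebra X" and e: "star_hom W complex_alg e"
  shows "star_hom (tensor_alg W X) X (tensor_lift X (\<lambda>w x. e w \<odot>\<^bsub>X\<^esub> x))"
    and "w \<in> carrier W \<Longrightarrow> x \<in> carrier X \<Longrightarrow> tensor_lift X (\<lambda>w x. e w \<odot>\<^bsub>X\<^esub> x) (tens W X w x) = e w \<odot>\<^bsub>X\<^esub> x"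
    and "star_hom (tensor_alg X W) X (tensor_lift X (\<lambda>x w. e w \<odot>\<^bsub>X\<^esub> x))"
    and "w \<in> carrier W \<Longrightarrow> x \<in> carrier X \<Longrightarrow> tensor_lift X (\<lambda>x w. e w \<odot>\<^bsub>X\<^esub> x) (tens X W x w) = e w \<odot>\<^bsub>X\<^esub> x"
proof -
  interpret W: star_algebra W by (rule W)
  interpret X: star_algebra X by (rule X)
  note e' = star_homD(3-7)[OF e, simplified]
  have b: "bilinear_map X W X (\<lambda>x w. e w \<odot>\<^bsub>X\<^esub> x)" "bilinear_map W X X (\<lambda>w x. e w \<odot>\<^bsub>X\<^esub> x)"
    by (auto intro!: bilinear_mapI simp: e' X.smult_rules)
      (simp_all add: X.smult_rules(3)[symmetric] mult.commute)
  note l = tensor_lift[OF X W X b(1)] tensor_lift[OF W X X b(2)]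
  show "w \<in> carrier W \<Longrightarrow> x \<in> carrier X \<Longrightarrow> tensor_lift X (\<lambda>w x. e w \<odot>\<^bsub>X\<^esub> x) (tens W X w x) = e w \<odot>\<^bsub>X\<^esub> x"
    "w \<in> carrier W \<Longrightarrow> x \<in> carrier X \<Longrightarrow> tensor_lift X (\<lambda>x w. e w \<odot>\<^bsub>X\<^esub> x) (tens X W x w) = e w \<odot>\<^bsub>X\<^esub> x"
    by (simp_all add: l)
  show "star_hom (tensor_alg W X) X (tensor_lift X (\<lambda>w x. e w \<odot>\<^bsub>X\<^esub> x))"
    by (rule tensor_star_homI[OF W X X l(3)])
      (simp_all add: l e' X.smult_mult_left X.smult_mult_right X.smult_rules(3)[symmetric] X.smult_rules(4) X.star_smult mult.commute)
  show "star_hom (tensor_alg X W) X (tensor_lift X (\<lambda>x w. e w \<odot>\<^bsub>X\<^esub> x))"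
    by (rule tensor_star_homI[OF X W X l(1)])
      (simp_all add: l e' X.smult_mult_left X.smult_mult_right X.smult_rules(3)[symmetric] X.smult_rules(4) X.star_smult mult.commute)
qed

context
  fixes P :: "('p, 'm) star_alg_scheme" and Z :: "'z star_alg" and S
  assumes P: "star_algebra P" and Z: "star_algebra Z" and S: "star_hom P (opposite_alg Z) S"
begin

interpretation P: star_algebra P by (rule P)
interpretation Z: star_algebra Z by (rule Z)

lemma antihom_linear: "linear_map P Z S"
  using star_homD(1)[OF S] by (simp add: linear_map_def)

lemmas antihom = star_homD(2-7)[OF S, simplified]

lemma tensor_lift_antihom:
  "linear_map (tensor_alg P Z) Z (tensor_lift Z (\<lambda>a b. S a \<otimes>\<^bsub>Z\<^esub> b))"
  "a \<in> carrier P \<Longrightarrow> b \<in> carrier Z \<Longrightarrow> tensor_lift Z (\<lambda>a b. S a \<otimes>\<^bsub>Z\<^esub> b) (tens P Z a b) = S a \<otimes>\<^bsub>Z\<^esub> b"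
  "linear_map (tensor_alg Z P) Z (tensor_lift Z (\<lambda>a b. a \<otimes>\<^bsub>Z\<^esub> S b))"
  "a \<in> carrier P \<Longrightarrow> b \<in> carrier Z \<Longrightarrow> tensor_lift Z (\<lambda>a b. a \<otimes>\<^bsub>Z\<^esub> S b) (tens Z P b a) = b \<otimes>\<^bsub>Z\<^esub> S a"
  using tensor_lift[OF P Z Z bilinear_map_compose[OF bilinear_mult[OF Z] antihom_linear linear_map_ident(1) linear_map_ident(1)]]
    tensor_lift[OF Z P Z bilinear_map_compose[OF bilinear_mult[OF Z] linear_map_ident(1) antihom_linear linear_map_ident(1)]]
  by auto

text \<open>
  Write \<open>m\<close> for the lifted map. As \<open>S\<close> reverses products, \<open>m(U (p \<otimes> r)) = S(p) m(U) r\<close>, and a scalar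
  \<open>m(U)\<close> can be pulled out. Hence elements satisfying an antipode law are closed under products.
\<close>

lemma tensor_lift_antihom_mult_left:
  assumes U: "U \<in> carrier (tensor_alg P Z)" and V: "V \<in> carrier (tensor_alg P Z)"
    and eq: "tensor_lift Z (\<lambda>a b. S a \<otimes>\<^bsub>Z\<^esub> b) U = c \<odot>\<^bsub>Z\<^esub> \<one>\<^bsub>Z\<^esub>"
  shows "tensor_lift Z (\<lambda>a b. S a \<otimes>\<^bsub>Z\<^esub> b) (U \<otimes>\<^bsub>tensor_alg P Z\<^esub> V) = c \<odot>\<^bsub>Z\<^esub> tensor_lift Z (\<lambda>a b. S a \<otimes>\<^bsub>Z\<^esub> b) V"
proof -
  interpret T: star_algebra "tensor_alg P Z" by (rule star_algebra_tensor[OF P Z])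
  let ?m = "tensor_lift Z (\<lambda>a b. S a \<otimes>\<^bsub>Z\<^esub> b)"
  note m = tensor_lift_antihom(1,2)
  have sandwich: "?m (U \<otimes>\<^bsub>tensor_alg P Z\<^esub> tens P Z p r) = S p \<otimes>\<^bsub>Z\<^esub> (?m U \<otimes>\<^bsub>Z\<^esub> r)"
    if p: "p \<in> carrier P" and r: "r \<in> carrier Z" for p r
    by (rule tensor_linear_eqI[OF P Z linear_map_compose[OF T.mult_linear_map(1) m(1)]
          linear_map_compose[OF linear_map_compose[OF m(1) Z.mult_linear_map(1)] Z.mult_linear_map(2)] _ U])
      (use p r in \<open>simp_all add: tens_closed[OF P Z] tens_mult[OF P Z] m(2) antihom Z.m_assoc\<close>)
  show ?thesis
    by (rule tensor_linear_eqI[OF P Z linear_map_compose[OF T.mult_linear_map(2)[OF U] m(1)] _ _ V])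
      (use linear_mapD[OF m(1)] in \<open>auto simp: sandwich eq m(2) antihom Z.smult_mult_left Z.smult_mult_right
        linear_map_def Z.smult_rules(2) Z.smult_rules(3)[symmetric] mult.commute\<close>)
qed

lemma tensor_lift_antihom_mult_right:
  assumes U: "U \<in> carrier (tensor_alg Z P)" and V: "V \<in> carrier (tensor_alg Z P)"
    and eq: "tensor_lift Z (\<lambda>a b. a \<otimes>\<^bsub>Z\<^esub> S b) V = c \<odot>\<^bsub>Z\<^esub> \<one>\<^bsub>Z\<^esub>"
  shows "tensor_lift Z (\<lambda>a b. a \<otimes>\<^bsub>Z\<^esub> S b) (U \<otimes>\<^bsub>tensor_alg Z P\<^esub> V) = c \<odot>\<^bsub>Z\<^esub> tensor_lift Z (\<lambda>a b. a \<otimes>\<^bsub>Z\<^esub> S b) U"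
proof -
  interpret T: star_algebra "tensor_alg Z P" by (rule star_algebra_tensor[OF Z P])
  let ?m = "tensor_lift Z (\<lambda>a b. a \<otimes>\<^bsub>Z\<^esub> S b)"
  note m = tensor_lift_antihom(3,4)
  have sandwich: "?m (tens Z P r p \<otimes>\<^bsub>tensor_alg Z P\<^esub> V) = r \<otimes>\<^bsub>Z\<^esub> (?m V \<otimes>\<^bsub>Z\<^esub> S p)"
    if p: "p \<in> carrier P" and r: "r \<in> carrier Z" for p r
    by (rule tensor_linear_eqI[OF Z P linear_map_compose[OF T.mult_linear_map(2) m(1)]
          linear_map_compose[OF linear_map_compose[OF m(1) Z.mult_linear_map(1)] Z.mult_linear_map(2)] _ V])
      (use p r in \<open>simp_all add: tens_closed[OF Z P] tens_mult[OF Z P] m(2) antihom Z.m_assoc\<close>)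
  show ?thesis
    by (rule tensor_linear_eqI[OF Z P linear_map_compose[OF T.mult_linear_map(1)[OF V] m(1)] _ _ U])
      (use linear_mapD[OF m(1)] in \<open>auto simp: sandwich eq m(2) antihom Z.smult_mult_left Z.smult_mult_right
        linear_map_def Z.smult_rules(2) Z.smult_rules(3)[symmetric] mult.commute\<close>)
qed

end

lemma star_hom_opposite: "star_hom A B f \<Longrightarrow> star_hom (opposite_alg A) (opposite_alg B) f"
  by (rule star_homI) (auto simp: linear_map_def dest: star_homD)

definition ns_comult where
  "ns_comult G1 G2 G3 = descend (\<lambda>x. tensor_map (ns_alg G1 G2) (ns_alg G2 G3) (ns_map G1 G2) (ns_map G2 G3)
     (cocomposition G1 G2 G3 x))"

definition ns_counit ::
  "('x::finite, 'y::finite, 'a::finite, 'b::finite) game \<Rightarrow>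
   ('x, 'y, 'a, 'b, 'x, 'y, 'a, 'b) game_elt set \<Rightarrow> complex" where
  "ns_counit G = descend (univ_hom complex_alg (case_gen (\<lambda>i j. of_bool (i = j)) (\<lambda>i j. of_bool (i = j))))"

definition ns_antipode where
  "ns_antipode G1 G2 = descend (\<lambda>x. ns_map G2 G1
     (univ_hom (opposite_alg (game_alg G2 G1)) (case_gen (transposed (genU G2 G1)) (transposed (genW G2 G1))) x))"

subsection \<open>Comultiplication\<close>

context
  fixes G1 :: "('x1::finite, 'y1::finite, 'a1::finite, 'b1::finite) game"
    and G2 :: "('x2::finite, 'y2::finite, 'a2::finite, 'b2::finite) game"
    and G3 :: "('x3::finite, 'y3::finite, 'a3::finite, 'b3::finite) game"
begin

lemma cocomposition:
  shows "star_hom (game_alg G1 G3) (tensor_alg (game_alg G1 G2) (game_alg G2 G3)) (cocomposition G1 G2 G3)" (is ?hom)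
    and "cocomposition G1 G2 G3 (genU G1 G3 i j) =
      compose_unitaries (game_alg G1 G2) (game_alg G2 G3) (genU G1 G2) (genU G2 G3) i j" (is ?U)
    and "cocomposition G1 G2 G3 (genW G1 G3 i' j') =
      compose_unitaries (game_alg G1 G2) (game_alg G2 G3) (genW G1 G2) (genW G2 G3) i' j'" (is ?W)
proof -
  note A = star_algebra_game_alg[of G1 G2] and B = star_algebra_game_alg[of G2 G3]
  have eq: "cocomposition G1 G2 G3 = univ_hom (tensor_alg (game_alg G1 G2) (game_alg G2 G3))
    (case_gen (compose_unitaries (game_alg G1 G2) (game_alg G2 G3) (genU G1 G2) (genU G2 G3))
       (compose_unitaries (game_alg G1 G2) (game_alg G2 G3) (genW G1 G2) (genW G2 G3)))"
    by (simp add: cocomposition_def Let_def compose_unitaries_def[abs_def])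
  note h = game_hom[OF star_algebra_tensor[OF A B] magic_unitary_compose[OF A B game_alg_relations(1) game_alg_relations(1)]
     magic_unitary_compose[OF A B game_alg_relations(2) game_alg_relations(2)]
     intertwines_compose[OF A B _ _ _ _ game_alg_relations(3) game_alg_relations(3)]]
  show ?hom ?U ?W
    unfolding eq by (intro h gen_closed)+
qed

text \<open>
  On the block of answers the composed matrix satisfies the column relations, hence, as a magic
  unitary, also the row relations that the quotient imposes there.
\<close>

lemma ns_comult:
  shows "star_hom (ns_alg G1 G3) (tensor_alg (ns_alg G1 G2) (ns_alg G2 G3)) (ns_comult G1 G2 G3)" (is ?hom)
    and "x \<in> carrier (game_alg G1 G3) \<Longrightarrow> ns_comult G1 G2 G3 (ns_map G1 G3 x) =
      tensor_map (ns_alg G1 G2) (ns_alg G2 G3) (ns_map G1 G2) (ns_map G2 G3) (cocomposition G1 G2 G3 x)"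
    and "ns_comult G1 G2 G3 (nsU G1 G3 i j) =
      compose_unitaries (ns_alg G1 G2) (ns_alg G2 G3) (nsU G1 G2) (nsU G2 G3) i j" (is ?U)
    and "ns_comult G1 G2 G3 (nsW G1 G3 i' j') =
      compose_unitaries (ns_alg G1 G2) (ns_alg G2 G3) (nsW G1 G2) (nsW G2 G3) i' j'" (is ?W)
proof -
  let ?F = "\<lambda>x. tensor_map (ns_alg G1 G2) (ns_alg G2 G3) (ns_map G1 G2) (ns_map G2 G3) (cocomposition G1 G2 G3 x)"
  note A = star_algebra_game_alg[of G1 G2] and B = star_algebra_game_alg[of G2 G3]
  note C = star_algebra_ns_alg[of G1 G2] and D = star_algebra_ns_alg[of G2 G3]
  note q = ns_map_star_hom[of G1 G2] and r = ns_map_star_hom[of G2 G3]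
  note CD = star_algebra_tensor[OF C D]
  have F: "star_hom (game_alg G1 G3) (tensor_alg (ns_alg G1 G2) (ns_alg G2 G3)) ?F"
    by (rule star_hom_compose[OF cocomposition(1) tensor_map_star_hom[OF A B C D q r]])
  have FU: "?F (genU G1 G3 i j) = compose_unitaries (ns_alg G1 G2) (ns_alg G2 G3) (nsU G1 G2) (nsU G2 G3) i j" for i j
    by (simp add: cocomposition(2) tensor_map_compose_unitaries[OF A B C D star_homD(1)[OF q] star_homD(1)[OF r]]
        nsU_def[abs_def])
  have FW: "?F (genW G1 G3 i j) = compose_unitaries (ns_alg G1 G2) (ns_alg G2 G3) (nsW G1 G2) (nsW G2 G3) i j" for i j
    by (simp add: cocomposition(3) tensor_map_compose_unitaries[OF A B C D star_homD(1)[OF q] star_homD(1)[OF r]]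
        nsW_def[abs_def])
  have U: "column_no_signalling (tensor_alg (ns_alg G1 G2) (ns_alg G2 G3)) (\<lambda>i j. ?F (genU G1 G3 i j))"
    unfolding FU by (rule column_no_signalling_compose[OF C D _ _ ns_column(1) ns_column(1)]) simp_all
  have W: "column_no_signalling (tensor_alg (ns_alg G1 G2) (ns_alg G2 G3)) (\<lambda>i j. ?F (genW G1 G3 j i))"
    unfolding FW
    by (rule column_no_signalling_transposed[OF CD magic_unitary_compose[OF C D ns_magic(2) ns_magic(2)]
          column_no_signalling_compose[OF C D _ _ ns_column(4) ns_column(4)]]) simp_all
  note d = ns_descend[OF CD F U W, folded ns_comult_def]
  show ?hom
    by (rule d)
  show "x \<in> carrier (game_alg G1 G3) \<Longrightarrow> ns_comult G1 G2 G3 (ns_map G1 G3 x) = ?F x"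
    by (rule d)
  show ?U ?W
    using d(2)[of "genU G1 G3 i j"] d(2)[of "genW G1 G3 i' j'"] FU FW by (simp_all add: nsU_def nsW_def)
qed

end

text \<open>
  For four games, so that the coassociativity of both Hopf algebras and of both coactions, the
  commutation of the coactions and the identities behind the Galois maps are all special cases.
\<close>

lemma ns_coassoc:
  fixes G1 :: "('x1::finite, 'y1::finite, 'a1::finite, 'b1::finite) game"
    and G2 :: "('x2::finite, 'y2::finite, 'a2::finite, 'b2::finite) game"
    and G3 :: "('x3::finite, 'y3::finite, 'a3::finite, 'b3::finite) game"
    and G4 :: "('x4::finite, 'y4::finite, 'a4::finite, 'b4::finite) game"
  assumes "z \<in> carrier (ns_alg G1 G4)"
  shows "tensor_assoc (ns_alg G1 G2) (ns_alg G2 G3) (ns_alg G3 G4)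
      (tensor_map (tensor_alg (ns_alg G1 G2) (ns_alg G2 G3)) (ns_alg G3 G4) (ns_comult G1 G2 G3) id (ns_comult G1 G3 G4 z)) =
    tensor_map (ns_alg G1 G2) (tensor_alg (ns_alg G2 G3) (ns_alg G3 G4)) id (ns_comult G2 G3 G4) (ns_comult G1 G2 G4 z)"
proof -
  note A = star_algebra_ns_alg
  note T = star_algebra_tensor[OF A A]
  note l = star_hom_compose[OF star_hom_compose[OF ns_comult(1)
        tensor_map_star_hom[OF A A T A ns_comult(1) star_hom_ident(2)]] tensor_assoc_star_hom[OF A A A]]
  note r = star_hom_compose[OF ns_comult(1) tensor_map_star_hom[OF A A A T star_hom_ident(2) ns_comult(1)]]
  show ?thesis
    by (rule ns_hom_eqI[OF l r _ _ assms])
      (simp_all add: ns_comult(3,4) tensor_map_compose_unitaries[OF A A T A star_homD(1)[OF ns_comult(1)] linear_map_ident(2)]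
        tensor_map_compose_unitaries[OF A A A T linear_map_ident(2) star_homD(1)[OF ns_comult(1)]]
        compose_unitaries_assoc[OF A A A])
qed

subsection \<open>Counit\<close>

lemma finsum_complex_alg: "finite S \<Longrightarrow> finsum complex_alg f S = sum f S"
proof (induction S rule: finite_induct)
  interpret star_algebra complex_alg by (rule star_algebra_complex_alg)
  {
    case empty then show ?case by simp
  next
    case (insert x S) then show ?case by simp
  }
qed

lemma delta_magic_unitary: "magic_unitary complex_alg (\<lambda>i j. of_bool (i = j))"
  by (auto simp: magic_unitary_def finsum_complex_alg of_bool_def)

lemma delta_intertwines: "intertwines complex_alg L L (\<lambda>i j. of_bool (i = j)) (\<lambda>i j. of_bool (i = j))"
  by (auto simp: intertwines_def finsum_complex_alg of_bool_def if_distrib[of "(*) _"] cong: if_cong)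

lemma delta_column_no_signalling: "column_no_signalling complex_alg (\<lambda>i j. of_bool (i = j))"
proof -
  have card_eq: "card {s. s = s' \<and> P} = of_bool P" "card {s. P \<and> s = s'} = of_bool P" for s' :: 'z and P
    by (cases P; simp)+
  show ?thesis
    by (simp add: column_no_signalling_def finsum_complex_alg card_eq)
qed

lemma ns_counit:
  fixes G :: "('x::finite, 'y::finite, 'a::finite, 'b::finite) game"
  shows "star_hom (ns_alg G G) complex_alg (ns_counit G)"
    and "ns_counit G (nsU G G i j) = of_bool (i = j)"
    and "ns_counit G (nsW G G i' j') = of_bool (i' = j')"
proof -
  note C = star_algebra_complex_alg
  note h = game_hom[OF C delta_magic_unitary delta_magic_unitary delta_intertwines]
  let ?F = "univ_hom complex_alg (case_gen (\<lambda>i j. of_bool (i = j)) (\<lambda>i j. of_bool (i = j)))"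
  have U: "column_no_signalling complex_alg (\<lambda>i j. ?F (genU G G i j))"
    unfolding h(2) by (rule delta_column_no_signalling)
  have W: "column_no_signalling complex_alg (\<lambda>i j. ?F (genW G G j i))"
    unfolding h(3) using delta_column_no_signalling by (simp add: eq_commute)
  note d = ns_descend[OF C h(1) U W]
  show "star_hom (ns_alg G G) complex_alg (ns_counit G)"
    unfolding ns_counit_def by (rule d)
  show "ns_counit G (nsU G G i j) = of_bool (i = j)" "ns_counit G (nsW G G i' j') = of_bool (i' = j')"
    by (simp_all add: ns_counit_def nsU_def nsW_def d(2) h(2,3))
qed

context
  fixes G1 :: "('x1::finite, 'y1::finite, 'a1::finite, 'b1::finite) game"
    and G2 :: "('x2::finite, 'y2::finite, 'a2::finite, 'b2::finite) game"
begin

interpretation Z: star_algebra "ns_alg G1 G2" by (rule star_algebra_ns_alg)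

lemma ns_alg_delta_sum:
  fixes f :: "'i::finite \<Rightarrow> _"
  assumes "\<And>\<eta>. f \<eta> \<in> carrier (ns_alg G1 G2)"
  shows "(\<Oplus>\<^bsub>ns_alg G1 G2\<^esub>\<eta>\<in>UNIV. of_bool (i = \<eta>) \<odot>\<^bsub>ns_alg G1 G2\<^esub> f \<eta>) = f i"
    "(\<Oplus>\<^bsub>ns_alg G1 G2\<^esub>\<eta>\<in>UNIV. of_bool (\<eta> = i) \<odot>\<^bsub>ns_alg G1 G2\<^esub> f \<eta>) = f i"
  using assms by (subst Z.finsum_single[where i = i]; simp add: Z.smult_rules)+

lemma ns_counit_left:
  assumes "z \<in> carrier (ns_alg G1 G2)"
  shows "tensor_lift (ns_alg G1 G2) (\<lambda>a z. ns_counit G1 a \<odot>\<^bsub>ns_alg G1 G2\<^esub> z) (ns_comult G1 G1 G2 z) = z"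
proof -
  note A = star_algebra_ns_alg
  note l = tensor_lift_counit(1,2)[OF A A ns_counit(1)]
  show ?thesis
    by (rule ns_hom_eqI[OF star_hom_compose[OF ns_comult(1) l(1)] star_hom_ident(1) _ _ assms])
      (simp_all add: ns_comult(3,4) linear_map_compose_unitaries[OF A A A star_homD(1)[OF l(1)]] l(2) ns_counit(2,3) ns_alg_delta_sum)
qed

lemma ns_counit_right:
  assumes "z \<in> carrier (ns_alg G1 G2)"
  shows "tensor_lift (ns_alg G1 G2) (\<lambda>z b. ns_counit G2 b \<odot>\<^bsub>ns_alg G1 G2\<^esub> z) (ns_comult G1 G2 G2 z) = z"
proof -
  note A = star_algebra_ns_alg
  note l = tensor_lift_counit(3,4)[OF A A ns_counit(1)]
  show ?thesis
    by (rule ns_hom_eqI[OF star_hom_compose[OF ns_comult(1) l(1)] star_hom_ident(1) _ _ assms])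
      (simp_all add: ns_comult(3,4) linear_map_compose_unitaries[OF A A A star_homD(1)[OF l(1)]] l(2) ns_counit(2,3) ns_alg_delta_sum)
qed

subsection \<open>Antipode\<close>

text \<open>
  The transposed generators satisfy the relations of the reversed pair of games by
  \<open>intertwines_transposed\<close> and the last two statements of \<open>ns_column\<close>.
\<close>

lemma ns_antipode:
  shows "star_hom (ns_alg G1 G2) (opposite_alg (ns_alg G2 G1)) (ns_antipode G1 G2)"
    and "ns_antipode G1 G2 (nsU G1 G2 i j) = nsU G2 G1 j i"
    and "ns_antipode G1 G2 (nsW G1 G2 i' j') = nsW G2 G1 j' i'"
proof -
  note A = star_algebra_game_alg[of G2 G1] and B = star_algebra_ns_alg[of G2 G1]
  note h = game_hom[OF star_algebra_opposite[OF A]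
      opposite_magic(1)[THEN iffD2, OF magic_unitary_transposed[OF game_alg_relations(1)]]
      opposite_magic(1)[THEN iffD2, OF magic_unitary_transposed[OF game_alg_relations(2)]]
      opposite_magic(2)[THEN iffD2, OF intertwines_transposed[OF A game_alg_relations]]]
  let ?F = "\<lambda>x. ns_map G2 G1 (univ_hom (opposite_alg (game_alg G2 G1)) (case_gen (transposed (genU G2 G1)) (transposed (genW G2 G1))) x)"
  have F: "star_hom (game_alg G1 G2) (opposite_alg (ns_alg G2 G1)) ?F"
    by (rule star_hom_compose[OF h(1) star_hom_opposite[OF ns_map_star_hom]])
  have FU: "?F (genU G1 G2 i j) = nsU G2 G1 j i" and FW: "?F (genW G1 G2 i' j') = nsW G2 G1 j' i'" for i j i' j'
    by (simp_all add: h(2,3) nsU_def nsW_def)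
  have U: "column_no_signalling (opposite_alg (ns_alg G2 G1)) (\<lambda>i j. ?F (genU G1 G2 i j))"
    unfolding FU opposite_magic(3) by (rule ns_column(3))
  have W: "column_no_signalling (opposite_alg (ns_alg G2 G1)) (\<lambda>i j. ?F (genW G1 G2 j i))"
    unfolding FW opposite_magic(3) by (rule ns_column(4))
  note d = ns_descend[OF star_algebra_opposite[OF B] F U W, folded ns_antipode_def]
  show "star_hom (ns_alg G1 G2) (opposite_alg (ns_alg G2 G1)) (ns_antipode G1 G2)" by (rule d)
  show "ns_antipode G1 G2 (nsU G1 G2 i j) = nsU G2 G1 j i" "ns_antipode G1 G2 (nsW G1 G2 i' j') = nsW G2 G1 j' i'"
    using FU FW d(2) by (simp_all add: nsU_def nsW_def)
qed

end

context
  fixes G1 :: "('x1::finite, 'y1::finite, 'a1::finite, 'b1::finite) game"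
    and G2 :: "('x2::finite, 'y2::finite, 'a2::finite, 'b2::finite) game"
begin

interpretation Z: star_algebra "ns_alg G1 G2" by (rule star_algebra_ns_alg)

lemma magic_unitary_orthogonality:
  fixes p :: "'i::finite \<Rightarrow> 'j::finite \<Rightarrow> _"
  assumes p: "magic_unitary (ns_alg G1 G2) p"
  shows "(\<Oplus>\<^bsub>ns_alg G1 G2\<^esub>\<eta>\<in>UNIV. p \<eta> i \<otimes>\<^bsub>ns_alg G1 G2\<^esub> p \<eta> j) = of_bool (i = j) \<odot>\<^bsub>ns_alg G1 G2\<^esub> \<one>\<^bsub>ns_alg G1 G2\<^esub>"
    and "(\<Oplus>\<^bsub>ns_alg G1 G2\<^esub>\<eta>\<in>UNIV. p i' \<eta> \<otimes>\<^bsub>ns_alg G1 G2\<^esub> p j' \<eta>) = of_bool (i' = j') \<odot>\<^bsub>ns_alg G1 G2\<^esub> \<one>\<^bsub>ns_alg G1 G2\<^esub>"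
  using magic_unitaryD[OF p] by (cases "i = j"; cases "i' = j'"; simp add: Z.smult_rules)+

text \<open>
  On generators the law says that two columns of a magic unitary are orthogonal; products are covered
  by \<open>tensor_lift_antihom_mult_left\<close>.
\<close>

lemma ns_antipode_left:
  assumes "b \<in> carrier (ns_alg G2 G2)"
  shows "tensor_lift (ns_alg G1 G2) (\<lambda>a b. ns_antipode G2 G1 a \<otimes>\<^bsub>ns_alg G1 G2\<^esub> b) (ns_comult G2 G1 G2 b) =
    ns_counit G2 b \<odot>\<^bsub>ns_alg G1 G2\<^esub> \<one>\<^bsub>ns_alg G1 G2\<^esub>"
  using assms
proof (induction rule: ns_induct)
  interpret P: star_algebra "ns_alg G2 G1" by (rule star_algebra_ns_alg)
  note A = star_algebra_ns_alg
  note S = ns_antipode(1)[of G2 G1]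
  note m = tensor_lift_antihom(1,2)[OF A A S] and mm = tensor_lift_antihom_mult_left[OF A A S]
  note \<Delta> = star_homD[OF ns_comult(1)[of G2 G2 G1]] and \<epsilon> = star_homD[OF ns_counit(1)[of G2], simplified]
  {
    case one
    show ?case using antihom(5)[OF A A S]
      by (simp add: \<Delta>(6) tens_one[OF A A] m(2) \<epsilon>(6) Z.smult_rules)
  next
    case (U i j)
    show ?case
      by (simp add: ns_comult(3) linear_map_compose_unitaries[OF A A A m(1)] m(2) ns_antipode(2) magic_unitary_orthogonality[OF ns_magic(1)] ns_counit(2))
  next
    case (W i j)
    show ?case
      by (simp add: ns_comult(4) linear_map_compose_unitaries[OF A A A m(1)] m(2) ns_antipode(3) magic_unitary_orthogonality[OF ns_magic(2)] ns_counit(3))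
  next
    case (add x y)
    then show ?case by (simp add: \<Delta>(2,4) linear_mapD(2)[OF m(1)] \<epsilon> Z.smult_rules)
  next
    case (mult x y)
    then show ?case by (simp add: \<Delta>(2,3) mm \<epsilon> Z.smult_rules)
  next
    case (smult c x)
    then show ?case by (simp add: \<Delta>(2,5) linear_mapD(3)[OF m(1)] \<epsilon> Z.smult_rules)
  }
qed

lemma ns_antipode_right:
  assumes "a \<in> carrier (ns_alg G1 G1)"
  shows "tensor_lift (ns_alg G1 G2) (\<lambda>a b. a \<otimes>\<^bsub>ns_alg G1 G2\<^esub> ns_antipode G2 G1 b) (ns_comult G1 G2 G1 a) =
    ns_counit G1 a \<odot>\<^bsub>ns_alg G1 G2\<^esub> \<one>\<^bsub>ns_alg G1 G2\<^esub>"
  using assms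
proof (induction rule: ns_induct)
  interpret P: star_algebra "ns_alg G2 G1" by (rule star_algebra_ns_alg)
  note A = star_algebra_ns_alg
  note S = ns_antipode(1)[of G2 G1]
  note m = tensor_lift_antihom(3,4)[OF A A S] and mm = tensor_lift_antihom_mult_right[OF A A S]
  note \<Delta> = star_homD[OF ns_comult(1)[of G1 G1 G2]] and \<epsilon> = star_homD[OF ns_counit(1)[of G1], simplified]
  {
    case one
    show ?case using antihom(5)[OF A A S]
      by (simp add: \<Delta>(6) tens_one[OF A A] m(2) \<epsilon>(6) Z.smult_rules)
  next
    case (U i j)
    show ?case
      by (simp add: ns_comult(3) linear_map_compose_unitaries[OF A A A m(1)] m(2) ns_antipode(2) magic_unitary_orthogonality[OF ns_magic(1)] ns_counit(2))
  next
    case (W i j)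
    show ?case
      by (simp add: ns_comult(4) linear_map_compose_unitaries[OF A A A m(1)] m(2) ns_antipode(3) magic_unitary_orthogonality[OF ns_magic(2)] ns_counit(3))
  next
    case (add x y)
    then show ?case by (simp add: \<Delta>(2,4) linear_mapD(2)[OF m(1)] \<epsilon> Z.smult_rules)
  next
    case (mult x y)
    then show ?case by (simp add: \<Delta>(2,3) mm \<epsilon> Z.smult_rules(3)[symmetric] mult.commute)
  next
    case (smult c x)
    then show ?case by (simp add: \<Delta>(2,5) linear_mapD(3)[OF m(1)] \<epsilon> Z.smult_rules)
  }
qed

end

section \<open>The no-signalling Hopf algebra of a game\<close>

context
  fixes G :: "('x::finite, 'y::finite, 'a::finite, 'b::finite) game"
begin

lemma same_game_hopf_alg: "same_star_algebra (game_hopf_alg G) (game_alg G G)"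
  by (simp add: same_star_algebra_def game_hopf_alg_def star_alg.defs)

lemma game_hopf_alg_simps:
  "comult (game_hopf_alg G) = cocomposition G G G"
  "counit (game_hopf_alg G) = univ_hom complex_alg (case_gen (\<lambda>i j. of_bool (i = j)) (\<lambda>i j. of_bool (i = j)))"
  "antipode (game_hopf_alg G) = univ_hom (opposite_alg (game_alg G G))
     (case_gen (transposed (genU G G)) (transposed (genW G G)))"
  by (simp_all add: game_hopf_alg_def star_alg.defs hopf_alg.defs)

lemma star_algebra_game_hopf_alg: "star_algebra (game_hopf_alg G)"
  by (rule star_algebra_if_same[OF same_game_hopf_alg star_algebra_game_alg])

lemma game_hopf_gen_closed:
  "genU G G i j \<in> carrier (game_hopf_alg G)" "genW G G i' j' \<in> carrier (game_hopf_alg G)"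
  by (simp_all add: same_fields(1)[OF same_game_hopf_alg])

lemma block_ns_relators_closed:
  assumes "\<And>i j. u i j \<in> carrier (game_hopf_alg G)"
  shows "block_ns_relators (game_hopf_alg G) u \<subseteq> carrier (game_hopf_alg G)"
proof -
  interpret H: star_algebra "game_hopf_alg G" by (rule star_algebra_game_hopf_alg)
  show ?thesis unfolding block_ns_relators_def
    by (intro Un_least UN_least relators_closed(3)[OF star_algebra_game_hopf_alg] H.finsum_closed) (auto simp: assms)
qed

lemma block_ns_relators_zero_iff:
  fixes u :: "'s::finite \<times> 't::finite \<Rightarrow> 's \<times> 't \<Rightarrow> _"
  assumes V: "star_algebra V" and F: "star_hom (game_hopf_alg G) V F"
    and u: "\<And>i j. u i j \<in> carrier (game_hopf_alg G)"
  shows "F ` block_ns_relators (game_hopf_alg G) u \<subseteq> {\<zero>\<^bsub>V\<^esub>} \<longleftrightarrow>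
    column_no_signalling V (\<lambda>i j. F (u i j)) \<and> column_no_signalling V (\<lambda>i j. F (u j i))"
proof -
  interpret H: star_algebra "game_hopf_alg G" by (rule star_algebra_game_hopf_alg)
  interpret V: star_algebra V by (rule V)
  note f = linear_map_finsum[OF star_algebra_game_hopf_alg V star_homD(1)[OF F]]
  note [simp] = star_homD(2)[OF F] u
  show ?thesis
    unfolding block_ns_relators_def image_Un image_UN Un_subset_iff UN_subset_iff column_no_signalling_def
    by (simp add: relators_image(3)[OF star_algebra_game_hopf_alg V F] indep_relators_zero_iff[OF V] f Pi_def
        H.finsum_closed V.finsum_closed)
      blast
qed

text \<open>
  Each ideal vanishes in the quotient by the other one: the relations of the no-signalling algebra are
  among those of the Hopf algebra, and \<open>ns_column\<close> provides the converse.
\<close>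

lemma hopf_ns_ideal_eq: "hopf_ns_ideal G = ns_ideal G G"
proof
  let ?H = "game_hopf_alg G"
  let ?R = "block_ns_relators ?H (genU G G) \<union> block_ns_relators ?H (genW G G)"
  note H = star_algebra_game_hopf_alg and closed = game_hopf_gen_closed
  have R: "?R \<subseteq> carrier ?H"
    by (intro Un_least block_ns_relators_closed closed)
  have J: "star_ideal (hopf_ns_ideal G) ?H"
    unfolding hopf_ns_ideal_def by (rule star_ideal_gen[OF H R])
  interpret J: star_algebra_ideal ?H "hopf_ns_ideal G"
    by (intro star_algebra_ideal.intro star_algebra_ideal_axioms.intro H J)
  have ns: "star_hom ?H (ns_alg G G) (ns_map G G)"
    unfolding same_star_hom(1)[OF same_game_hopf_alg] by (rule ns_map_star_hom)
  have "ns_map G G ` ?R \<subseteq> {\<zero>\<^bsub>ns_alg G G\<^esub>}"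
    unfolding image_Un Un_subset_iff
      block_ns_relators_zero_iff[OF star_algebra_ns_alg ns closed(1)]
      block_ns_relators_zero_iff[OF star_algebra_ns_alg ns closed(2)]
    using ns_column[of G G] by (simp add: nsU_def[abs_def] nsW_def[abs_def])
  then have zero: "ns_map G G x = \<zero>\<^bsub>ns_alg G G\<^esub>" if "x \<in> hopf_ns_ideal G" for x
    using gen_star_ideal_kernel[OF H star_algebra_ns_alg ns R] that unfolding hopf_ns_ideal_def by blast
  show "hopf_ns_ideal G \<subseteq> ns_ideal G G"
  proof
    fix x assume x: "x \<in> hopf_ns_ideal G"
    then have "x \<in> carrier (game_alg G G)"
      using star_ideal_subset[OF J] unfolding same_fields(1)[OF same_game_hopf_alg] by blast
    from ns_map_zero_iff[OF this] zero[OF x] show "x \<in> ns_ideal G G" by simp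
  qed
  have q: "star_hom (game_alg G G) J.Q J.\<pi>"
    using J.quot_map_star_hom unfolding same_star_hom(1)[OF same_game_hopf_alg] .
  have "?R \<subseteq> hopf_ns_ideal G" unfolding hopf_ns_ideal_def by (rule gen_star_ideal_superset)
  then have "J.\<pi> ` ?R \<subseteq> {\<zero>\<^bsub>J.Q\<^esub>}"
    using R by (intro image_subsetI singleton_iff[THEN iffD2] J.quot_map_zero_iff[THEN iffD2]) blast+
  then have "J.\<pi> ` ns_relators G G \<subseteq> {\<zero>\<^bsub>J.Q\<^esub>}"
    unfolding image_Un Un_subset_iff ns_relators_zero_iff[OF J.star_algebra_quot q]
      block_ns_relators_zero_iff[OF J.star_algebra_quot J.quot_map_star_hom closed(1)]
      block_ns_relators_zero_iff[OF J.star_algebra_quot J.quot_map_star_hom closed(2)] by blast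
  then have zero': "J.\<pi> x = \<zero>\<^bsub>J.Q\<^esub>" if "x \<in> ns_ideal G G" for x
    using gen_star_ideal_kernel[OF star_algebra_game_alg J.star_algebra_quot q ns_relators_closed] that
    unfolding ns_ideal_eq by blast
  show "ns_ideal G G \<subseteq> hopf_ns_ideal G"
  proof
    fix x assume x: "x \<in> ns_ideal G G"
    then have "x \<in> carrier ?H"
      using star_ideal_subset[OF star_algebra_ideal.star_ideal[OF star_algebra_ideal_ns[of G G]]]
      unfolding same_fields(1)[OF same_game_hopf_alg] by blast
    from J.quot_map_zero_iff[OF this] zero'[OF x] show "x \<in> hopf_ns_ideal G" by simp
  qed
qed

lemma quot_game_hopf_alg:
  "quot_alg (game_hopf_alg G) (hopf_ns_ideal G) = ns_alg G G"
  "quot_map (game_hopf_alg G) (hopf_ns_ideal G) = ns_map G G"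
  unfolding hopf_ns_ideal_eq same_quot[OF same_game_hopf_alg] ns_alg_def by simp_all

lemma same_ns_hopf_alg: "same_star_algebra (ns_hopf_alg G) (ns_alg G G)"
  by (simp add: same_star_algebra_def ns_hopf_alg_def quot_hopf_alg_def quot_game_hopf_alg star_alg.defs)

lemma ns_hopf_alg_simps:
  "comult (ns_hopf_alg G) = ns_comult G G G"
  "counit (ns_hopf_alg G) = ns_counit G"
  "antipode (ns_hopf_alg G) = ns_antipode G G"
  by (simp_all add: ns_hopf_alg_def quot_hopf_alg_def quot_game_hopf_alg game_hopf_alg_simps star_alg.defs hopf_alg.defs
     ns_comult_def ns_counit_def ns_antipode_def)

text \<open>
  Rewriting with these equations replaces the Hopf algebra by its underlying star-algebra
  \<open>ns_alg G G\<close> in every notion that occurs in the definition of a bi-Galois extension.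
\<close>

lemmas ns_hopf_alg_transfer = ns_hopf_alg_simps same_fields[OF same_ns_hopf_alg] same_linear_map[OF same_ns_hopf_alg]
  same_star_hom[OF same_ns_hopf_alg] same_tensor[OF same_ns_hopf_alg] same_tensor_lift[OF same_ns_hopf_alg]
  same_tensor_map[OF same_ns_hopf_alg] same_tensor_assoc[OF same_ns_hopf_alg]

lemma hopf_star_algebra_ns: "hopf_star_algebra (ns_hopf_alg G)"
proof -
  have "star_algebra (ns_hopf_alg G)"
    by (rule star_algebra_if_same[OF same_ns_hopf_alg star_algebra_ns_alg])
  then show ?thesis
    unfolding hopf_star_algebra_def counit_left_def counit_right_def ns_hopf_alg_transfer
    by (intro conjI ballI ns_comult(1) ns_counit(1) ns_coassoc ns_counit_left ns_counit_right
        ns_antipode_left ns_antipode_right antihom_linear[OF star_algebra_ns_alg star_algebra_ns_alg ns_antipode(1)])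
qed

end

section \<open>The bi-Galois extension\<close>

lemma galois_data_ns:
  fixes G1 :: "('x1::finite, 'y1::finite, 'a1::finite, 'b1::finite) game"
    and G2 :: "('x2::finite, 'y2::finite, 'a2::finite, 'b2::finite) game"
  shows "galois_data (ns_alg G1 G1) (ns_alg G1 G2) (ns_alg G2 G1) (ns_alg G2 G2)
    (ns_comult G1 G1 G1) (ns_comult G1 G1 G2) (ns_comult G1 G2 G1) (ns_comult G1 G2 G2) (ns_comult G2 G1 G2) (ns_comult G2 G2 G2)
    (ns_antipode G2 G1) (ns_counit G1) (ns_counit G2)"
  by (intro galois_data.intro star_algebra_ns_alg ns_coassoc ns_antipode_left ns_antipode_right ns_counit_left
      ns_counit_right star_homD(1)[OF ns_comult(1)] star_homD(1)[OF ns_counit(1)]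
      antihom_linear[OF star_algebra_ns_alg star_algebra_ns_alg ns_antipode(1)])

lemma bi_galois_extension_ns:
  fixes G1 :: "('x1::finite, 'y1::finite, 'a1::finite, 'b1::finite) game"
    and G2 :: "('x2::finite, 'y2::finite, 'a2::finite, 'b2::finite) game"
  shows "bi_galois_extension (ns_hopf_alg G1) (ns_hopf_alg G2) (ns_alg G1 G2) (ns_comult G1 G1 G2) (ns_comult G1 G2 G2)"
proof -
  interpret galois_data "ns_alg G1 G1" "ns_alg G1 G2" "ns_alg G2 G1" "ns_alg G2 G2" "ns_comult G1 G1 G1" "ns_comult G1 G1 G2"
    "ns_comult G1 G2 G1" "ns_comult G1 G2 G2" "ns_comult G2 G1 G2" "ns_comult G2 G2 G2" "ns_antipode G2 G1" "ns_counit G1" "ns_counit G2"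
    by (rule galois_data_ns)
  have "left_coaction (ns_hopf_alg G1) (ns_alg G1 G2) (ns_comult G1 G1 G2)"
    unfolding left_coaction_def counit_left_def ns_hopf_alg_transfer
    by (intro conjI ballI ns_comult(1) ns_coassoc[symmetric] ns_counit_left)
  moreover have "right_coaction (ns_alg G1 G2) (ns_hopf_alg G2) (ns_comult G1 G2 G2)"
    unfolding right_coaction_def counit_right_def ns_hopf_alg_transfer
    by (intro conjI ballI ns_comult(1) ns_coassoc ns_counit_right)
  moreover have "bij_betw (galois_left (ns_hopf_alg G1) (ns_alg G1 G2) (ns_comult G1 G1 G2))
      (carrier (tensor_alg (ns_alg G1 G2) (ns_alg G1 G2))) (carrier (tensor_alg (ns_hopf_alg G1) (ns_alg G1 G2)))"
    using galois_left_bij unfolding galois_left_def ns_hopf_alg_transfer .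
  moreover have "bij_betw (galois_right (ns_alg G1 G2) (ns_hopf_alg G2) (ns_comult G1 G2 G2))
      (carrier (tensor_alg (ns_alg G1 G2) (ns_alg G1 G2))) (carrier (tensor_alg (ns_alg G1 G2) (ns_hopf_alg G2)))"
    using galois_right_bij unfolding galois_right_def ns_hopf_alg_transfer .
  moreover have "tensor_assoc (ns_hopf_alg G1) (ns_alg G1 G2) (ns_hopf_alg G2)
      (tensor_map (tensor_alg (ns_hopf_alg G1) (ns_alg G1 G2)) (ns_hopf_alg G2) (ns_comult G1 G1 G2) id (ns_comult G1 G2 G2 z)) =
    tensor_map (ns_hopf_alg G1) (tensor_alg (ns_alg G1 G2) (ns_hopf_alg G2)) id (ns_comult G1 G2 G2) (ns_comult G1 G1 G2 z)"
    if "z \<in> carrier (ns_alg G1 G2)" for z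
    unfolding ns_hopf_alg_transfer by (rule ns_coassoc[OF that])
  ultimately show ?thesis
    unfolding bi_galois_extension_def by (intro conjI ballI hopf_star_algebra_ns star_algebra_ns_alg)
qed

theorem theorem5p12:
  fixes G1 :: "('x1::finite, 'y1::finite, 'a1::finite, 'b1::finite) game"
    and G2 :: "('x2::finite, 'y2::finite, 'a2::finite, 'b2::finite) game"
  assumes "card (UNIV :: ('x1 \<times> 'y1) set) = card (UNIV :: ('x2 \<times> 'y2) set)"
    and "card (UNIV :: ('a1 \<times> 'b1) set) = card (UNIV :: ('a2 \<times> 'b2) set)"
  defines "\<pi>1 \<equiv> quot_map (game_hopf_alg G1) (hopf_ns_ideal G1)"
    and "\<pi>2 \<equiv> quot_map (game_hopf_alg G2) (hopf_ns_ideal G2)"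
    and "q \<equiv> quot_map (game_alg G1 G2) (ns_ideal G1 G2)"
    and "\<delta> \<equiv> cocomposition G1 G1 G2"
    and "\<gamma> \<equiv> cocomposition G1 G2 G2"
  shows "\<exists>\<delta>' \<gamma>'.
    bi_galois_extension (ns_hopf_alg G1) (ns_hopf_alg G2) (ns_alg G1 G2) \<delta>' \<gamma>' \<and>
    (\<forall>z\<in>carrier (game_alg G1 G2).
       \<delta>' (q z) = tensor_map (ns_hopf_alg G1) (ns_alg G1 G2) \<pi>1 q (\<delta> z)) \<and>
    (\<forall>z\<in>carrier (game_alg G1 G2).
       \<gamma>' (q z) = tensor_map (ns_alg G1 G2) (ns_hopf_alg G2) q \<pi>2 (\<gamma> z))"
proof (intro exI conjI ballI)
  show "bi_galois_extension (ns_hopf_alg G1) (ns_hopf_alg G2) (ns_alg G1 G2) (ns_comult G1 G1 G2) (ns_comult G1 G2 G2)"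
    by (rule bi_galois_extension_ns)
  fix z assume "z \<in> carrier (game_alg G1 G2)"
  then show "ns_comult G1 G1 G2 (q z) = tensor_map (ns_hopf_alg G1) (ns_alg G1 G2) \<pi>1 q (\<delta> z)"
    "ns_comult G1 G2 G2 (q z) = tensor_map (ns_alg G1 G2) (ns_hopf_alg G2) q \<pi>2 (\<gamma> z)"
    unfolding \<pi>1_def \<pi>2_def q_def \<delta>_def \<gamma>_def quot_game_hopf_alg ns_hopf_alg_transfer
    by (simp_all add: ns_comult(2))
qed

end
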